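(* Let $n\ge 1$ be an integer, let $\alpha>0$ and $1<q\le 1+\frac{\alpha}{n}$ be real numbers, and let $\mathbb S=(0,+\infty)\times\mathbb R^n$. Let $\mathcal L=\sum_{i,j=1}^n\frac{\partial}{\partial x_i}\left[a_{ij}(t,x)\frac{\partial}{\partial x_j}\right]$, where the $a_{ij}$ are measurable and locally bounded in $\mathbb S$, $a_{ij}=a_{ji}$ a.e. in $\mathbb S$, and $0\le\sum_{i,j=1}^n a_{ij}(t,x)\xi_i\xi_j\le A(t,x)|\xi|^2$ for all $\xi\in\mathbb R^n$ and almost all $(t,x)\in\mathbb S$, with $A$ a measurable, non-negative, locally bounded function in $\mathbb S$. Suppose that, for the given $\alpha$ and some constant $c>0$, $$\operatorname*{ess\,sup}_{(t,x)\in(0,+\infty)\times\{R/2<|x|<R\}}A(t,x)\le cR^{2-\alpha}\quad\text{for all }R>1 .$$ Let $(u,v)$ be an entire weak solution of the Cauchy problem, with arbitrary (possibly different) initial data for $u=u(t,x)$ and $v=v(t,x)$, for the inequality $$u_t-\mathcal Lu-|u|^{q-1}u\ \ge\ v_t-\mathcal Lv-|v|^{q-1}v$$ in $\mathbb S$, such that $u\ge v$. Then $u=v$ in $\mathbb S$.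
   Context: For a bounded domain $\Pi\subset\mathbb S$ and $\hat q=\max\{1,q\}$, $W^{\mathcal L,q}(\Pi)$ denotes the completion of $C^\infty(\Pi)$ with respect to the norm $$\|w\|_{W^{\mathcal L,q}(\Pi)}=\int_\Pi|w_t|\,dt\,dx+\left[\int_\Pi\sum_{i,j=1}^n a_{ij}(t,x)\frac{\partial w}{\partial x_i}\frac{\partial w}{\partial x_j}\,dt\,dx\right]^{1/2}+\left[\int_\Pi|w|^{\hat q}\,dt\,dx\right]^{1/\hat q}.$$ A function $w$ belongs to $W^{\mathcal L,q}_{\mathrm{loc}}(\mathbb S)$ if it belongs to $W^{\mathcal L,q}(\Pi)$ for every bounded domain $\Pi$ in $\mathbb S$. Expressions involving derivatives of elements of this space are understood in the sense of the completion. A pair $(u,v)$ of functions defined and measurable in $\mathbb S$ is an entire weak solution of $u_t-\mathcal Lu-|u|^{q-1}u\ge v_t-\mathcal Lv-|v|^{q-1}v$ in $\mathbb S$ if $u,v\in W^{\mathcal L,q}_{\mathrm{loc}}(\mathbb S)$ and, for every non-negative $\varphi\in C^\infty(\mathbb S)$ with compact support in $\mathbb S$, $$\int_{\mathbb S}\Big[u_t\varphi+\sum_{i,j=1}^n a_{ij}\frac{\partial\varphi}{\partial x_i}\frac{\partial u}{\partial x_j}-|u|^{q-1}u\,\varphi\Big]dt\,dx\ \ge\ \int_{\mathbb S}\Big[v_t\varphi+\sum_{i,j=1}^n a_{ij}\frac{\partial\varphi}{\partial x_i}\frac{\partial v}{\partial x_j}-|v|^{q-1}v\,\varphi\Big]dt\,dx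 .$$ An entire weak solution of the Cauchy problem is such an entire weak solution $(u,v)$ in $\mathbb S$ considered together with initial data for $u$ and $v$ on the hyperplane $t=0$. The initial data are arbitrary; no particular sense in which they are attained is prescribed, and no condition is imposed on the behaviour of $u$ and $v$ at $t=0$ or at infinity (the statement is a direct corollary of the same conclusion for all entire weak solutions $(u,v)$ in $\mathbb S$ with $u\ge v$, without any restriction at $t=0$). *)

theory Defs
  imports "HOL-Analysis.Analysis" "HOL-Probability.Essential_Supremum"
begin

text \<open>
  Points of space-time are pairs \<open>(t, x)\<close> in \<open>real \<times> (real^'n)\<close>, the spatial dimension being
  \<open>CARD('n)\<close>. All measure theory is with respect to Lebesgue measure.
\<close>

definition half_space :: "(real \<times> (real^'n)) set" where
  "half_space = {0<..} \<times> UNIV"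

definition locally_bounded_on :: "'a::topological_space set \<Rightarrow> ('a \<Rightarrow> real) \<Rightarrow> bool" where
  "locally_bounded_on S f \<longleftrightarrow> (\<forall>K. compact K \<and> K \<subseteq> S \<longrightarrow> bounded (f ` K))"

text \<open>Intended for open \<open>S\<close> only; the values of \<open>f\<close> off \<open>S\<close> are then irrelevant.\<close>

primrec Ck_on :: "nat \<Rightarrow> 'a::euclidean_space set \<Rightarrow> ('a \<Rightarrow> real) \<Rightarrow> bool" where
  "Ck_on 0 S f \<longleftrightarrow> continuous_on S f"
| "Ck_on (Suc k) S f \<longleftrightarrow> (\<forall>z\<in>S. f differentiable (at z)) \<and>
     (\<forall>b\<in>Basis. Ck_on k S (\<lambda>z. frechet_derivative f (at z) b))"

definition smooth_on :: "'a::euclidean_space set \<Rightarrow> ('a \<Rightarrow> real) \<Rightarrow> bool" where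
  "smooth_on S f \<longleftrightarrow> (\<forall>k. Ck_on k S f)"

definition time_deriv :: "(real \<times> (real^'n) \<Rightarrow> real) \<Rightarrow> real \<times> (real^'n) \<Rightarrow> real" where
  "time_deriv f z = frechet_derivative f (at z) (1, 0)"

definition space_grad :: "(real \<times> (real^'n) \<Rightarrow> real) \<Rightarrow> real \<times> (real^'n) \<Rightarrow> real^'n" where
  "space_grad f z = (\<chi> i. frechet_derivative f (at z) (0, axis i 1))"

definition aform :: "real^'n^'n \<Rightarrow> real^'n \<Rightarrow> real^'n \<Rightarrow> real" where
  "aform M \<xi> \<eta> = (\<Sum>i\<in>UNIV. \<Sum>j\<in>UNIV. M $ i $ j * \<xi> $ i * \<eta> $ j)"

text \<open>
  The norm of \<open>W\<^sup>\<L>\<^sup>,\<^sup>q(\<Omega>)\<close>, written for a triple \<open>(w, wt, wx)\<close> in which \<open>wt\<close> and \<open>wx\<close> take the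
  places of the time derivative and the spatial gradient of \<open>w\<close>. It is the norm proper only
  when all three integrals are finite, which \<open>W_finite\<close> records.
\<close>

definition W_norm :: "(real \<times> (real^'n) \<Rightarrow> real^'n^'n) \<Rightarrow> real \<Rightarrow> (real \<times> (real^'n)) set \<Rightarrow>
    (real \<times> (real^'n) \<Rightarrow> real) \<Rightarrow> (real \<times> (real^'n) \<Rightarrow> real) \<Rightarrow> (real \<times> (real^'n) \<Rightarrow> real^'n) \<Rightarrow> real" where
  "W_norm a q \<Omega> w wt wx =
     (LINT z|lebesgue_on \<Omega>. \<bar>wt z\<bar>)
   + sqrt (LINT z|lebesgue_on \<Omega>. aform (a z) (wx z) (wx z))
   + (LINT z|lebesgue_on \<Omega>. \<bar>w z\<bar> powr (max 1 q)) powr (1 / max 1 q)"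

definition W_finite :: "(real \<times> (real^'n) \<Rightarrow> real^'n^'n) \<Rightarrow> real \<Rightarrow> (real \<times> (real^'n)) set \<Rightarrow>
    (real \<times> (real^'n) \<Rightarrow> real) \<Rightarrow> (real \<times> (real^'n) \<Rightarrow> real) \<Rightarrow> (real \<times> (real^'n) \<Rightarrow> real^'n) \<Rightarrow> bool" where
  "W_finite a q \<Omega> w wt wx \<longleftrightarrow>
     w \<in> borel_measurable (lebesgue_on \<Omega>) \<and>
     wt \<in> borel_measurable (lebesgue_on \<Omega>) \<and>
     wx \<in> borel_measurable (lebesgue_on \<Omega>) \<and>
     integrable (lebesgue_on \<Omega>) (\<lambda>z. \<bar>wt z\<bar>) \<and>
     integrable (lebesgue_on \<Omega>) (\<lambda>z. aform (a z) (wx z) (wx z)) \<and>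
     integrable (lebesgue_on \<Omega>) (\<lambda>z. \<bar>w z\<bar> powr (max 1 q))"

text \<open>
  The completion \<open>W\<^sup>\<L>\<^sup>,\<^sup>q(\<Omega>)\<close>. Sending a smooth \<open>f\<close> of finite norm to
  \<open>(f, time_deriv f, space_grad f)\<close> embeds \<open>C\<^sup>\<infinity>(\<Omega>)\<close> isometrically into the triples of finite
  norm, that is, into the product of \<open>L\<^sup>q\<close> (with exponent \<open>max 1 q\<close>), \<open>L\<^sup>1\<close> and the
  \<open>a\<close>-weighted \<open>L\<^sup>2\<close> space of vector fields. This product is complete (modulo triples of norm
  zero), so the completion is the closure of the image. The gradient has to be carried along as
  a separate component: \<open>a\<close> may be degenerate, and then the function alone need not determine
  its gradient in the completion. The component \<open>wx\<close> matters only up to fields with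
  \<open>aform (a z) (wx z) (wx z) = 0\<close> almost everywhere, which do not contribute to
  \<open>aform (a z) \<xi> (wx z)\<close> either.
\<close>

definition W_space :: "(real \<times> (real^'n) \<Rightarrow> real^'n^'n) \<Rightarrow> real \<Rightarrow> (real \<times> (real^'n)) set \<Rightarrow>
    (real \<times> (real^'n) \<Rightarrow> real) \<Rightarrow> (real \<times> (real^'n) \<Rightarrow> real) \<Rightarrow> (real \<times> (real^'n) \<Rightarrow> real^'n) \<Rightarrow> bool" where
  "W_space a q \<Omega> w wt wx \<longleftrightarrow>
     W_finite a q \<Omega> w wt wx \<and>
     (\<exists>f. (\<forall>k::nat. smooth_on \<Omega> (f k) \<and>
                W_finite a q \<Omega> (f k) (time_deriv (f k)) (space_grad (f k))) \<and>
          (\<lambda>k. W_norm a q \<Omega> (\<lambda>z. f k z - w z) (\<lambda>z. time_deriv (f k) z - wt z)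
                  (\<lambda>z. space_grad (f k) z - wx z)) \<longlonglongrightarrow> 0)"

definition W_loc :: "(real \<times> (real^'n) \<Rightarrow> real^'n^'n) \<Rightarrow> real \<Rightarrow>
    (real \<times> (real^'n) \<Rightarrow> real) \<Rightarrow> (real \<times> (real^'n) \<Rightarrow> real) \<Rightarrow> (real \<times> (real^'n) \<Rightarrow> real^'n) \<Rightarrow> bool" where
  "W_loc a q w wt wx \<longleftrightarrow>
     (\<forall>\<Omega>. open \<Omega> \<and> connected \<Omega> \<and> \<Omega> \<noteq> {} \<and> bounded \<Omega> \<and> \<Omega> \<subseteq> half_space \<longrightarrow>
          W_space a q \<Omega> w wt wx)"

definition test_function :: "(real \<times> (real^'n) \<Rightarrow> real) \<Rightarrow> bool" where
  "test_function \<phi> \<longleftrightarrow> smooth_on half_space \<phi> \<and>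
     compact (closure {z \<in> half_space. \<phi> z \<noteq> 0}) \<and>
     closure {z \<in> half_space. \<phi> z \<noteq> 0} \<subseteq> half_space"

text \<open>
  The left-hand side of the weak formulation for \<open>u\<close>, with \<open>ut\<close> and \<open>ux\<close> the derivatives of \<open>u\<close>
  in the sense of the completion.
\<close>

definition weak_functional :: "(real \<times> (real^'n) \<Rightarrow> real^'n^'n) \<Rightarrow> real \<Rightarrow>
    (real \<times> (real^'n) \<Rightarrow> real) \<Rightarrow> (real \<times> (real^'n) \<Rightarrow> real) \<Rightarrow> (real \<times> (real^'n) \<Rightarrow> real^'n) \<Rightarrow>
    (real \<times> (real^'n) \<Rightarrow> real) \<Rightarrow> real" where
  "weak_functional a q u ut ux \<phi> =
     (LINT z|lebesgue_on half_space.
        ut z * \<phi> z + aform (a z) (space_grad \<phi> z) (ux z) - \<bar>u z\<bar> powr (q - 1) * u z * \<phi> z)"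

text \<open>
  No initial data appear below: for the Cauchy problem they are arbitrary, no sense in which
  they are attained is prescribed, and so they do not constrain \<open>(u, v)\<close>.
\<close>

definition entire_weak_solution :: "(real \<times> (real^'n) \<Rightarrow> real^'n^'n) \<Rightarrow> real \<Rightarrow>
    (real \<times> (real^'n) \<Rightarrow> real) \<Rightarrow> (real \<times> (real^'n) \<Rightarrow> real) \<Rightarrow> bool" where
  "entire_weak_solution a q u v \<longleftrightarrow>
     u \<in> borel_measurable (lebesgue_on half_space) \<and>
     v \<in> borel_measurable (lebesgue_on half_space) \<and>
     (\<exists>ut ux vt vx. W_loc a q u ut ux \<and> W_loc a q v vt vx \<and>
        (\<forall>\<phi>. test_function \<phi> \<and> (\<forall>z\<in>half_space. 0 \<le> \<phi> z) \<longrightarrow>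
           weak_functional a q u ut ux \<phi> \<ge> weak_functional a q v vt vx \<phi>))"

end

theory Submission
  imports Defs
begin

text \<open>
  Put \<open>w = u - v \<ge> 0\<close>. Since \<open>|u|\<^sup>q\<^sup>-\<^sup>1 u - |v|\<^sup>q\<^sup>-\<^sup>1 v \<ge> 2\<^sup>-\<^sup>q w\<^sup>q\<close>, the function \<open>w\<close> is a weak supersolution of
  \<open>w\<^sub>t - L w \<ge> 2\<^sup>-\<^sup>q w\<^sup>q\<close>. Test it with \<open>h(w) \<zeta>\<close>, where \<open>\<zeta>\<close> is a cutoff of the cylinder
  \<open>1/R \<le> t \<le> 2R\<^sup>\<alpha>\<close>, \<open>|x| \<le> R\<close>, and \<open>h\<close> decreases from 2 to 1 like \<open>1 + (1 + w/M)\<^sup>-\<^sup>\<nu>\<close> with \<open>\<nu> = (q - 1)/2\<close>.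
  The term with \<open>h'(w)\<close> absorbs the gradient of \<open>w\<close>, and the increase of \<open>\<zeta>\<close> near \<open>t = 0\<close> has the
  good sign, so that nothing is needed there. With \<open>M = \<delta> R\<^sup>-\<^sup>\<alpha>\<^sup>/\<^sup>(\<^sup>q\<^sup>-\<^sup>1\<^sup>)\<close> and \<open>p = 1 + \<nu> < q\<close> this gives
  \<open>\<integral> w\<^sup>q \<zeta> \<le> C \<delta>\<^sup>1\<^sup>-\<^sup>q \<integral>\<^sub>E M\<^sup>q (1 + (w/M)\<^sup>p)\<close> up to a power of the cutoff, where \<open>E\<close> is the part of the cylinder
  on which \<open>\<zeta>\<close> varies (apart from its increase near \<open>t = 0\<close>). The condition on \<open>q\<close> says exactly that \<open>M\<^sup>q\<close> times the
  volume of the cylinder is at most a constant times \<open>\<delta>\<^sup>q\<close>. Taking \<open>\<delta> = 1\<close> and absorbing, one finds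
  \<open>w\<^sup>q \<in> L\<^sup>1\<close>; then, for fixed \<open>\<delta>\<close>, the integral of \<open>w\<^sup>q\<close> over \<open>E\<close> tends to 0 as \<open>R \<rightarrow> \<infinity>\<close>, and
  \<open>\<integral> w\<^sup>q \<le> C \<delta>\<close> remains.
\<close>

section \<open>Smooth functions\<close>

text \<open>The obstacle is that the nonlinear test function is not admissible. Only smooth \<phi>
  are allowed, while \<open>u - v\<close> lies in a completion, where \<open>ut\<close> and
  \<open>ux\<close> are limits without a chain rule and, the form being possibly degenerate,
  \<open>ux\<close> need not even be determined by \<open>u\<close>. So the inequality is tested
  with \<open>h (ws k) * \<zeta>\<close> for smooth approximations \<open>ws k\<close>, time is
  integrated by parts for \<open>ws k\<close>, and only then does k tend to infinity. This shapes
  \<open>h\<close>: it is bounded, because \<open>ut\<close> is only in L^1, and smooth on the whole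
  real line, because \<open>ws k\<close> may be negative even though \<open>u - v\<close> is not.

  The decay of \<open>h\<close> is dictated by the absorption. Young's inequality leaves the energy
  of the gradient of the cutoff divided by -h', and -1/h' grows like M (1 + w/M)^(1 + \<nu>); this
  stays below the power q of w because 1 + \<nu> < q. The scale M balances the remainder, of size
  R^(-\<alpha>) M, against M^q. At the largest admissible q the volume of the cylinder just
  compensates M^q, so R alone brings no smallness; that is the task of \<delta>.\<close>

lemma frechet_derivative_eqI:
  "(f has_derivative D) (at z) \<Longrightarrow> frechet_derivative f (at z) = D"
  by (metis frechet_derivative_at)

lemma Ck_on_subset: "Ck_on k S f \<Longrightarrow> T \<subseteq> S \<Longrightarrow> Ck_on k T f"
  by (induction k arbitrary: f) (auto intro: continuous_on_subset)

text \<open>Openness of \<open>S\<close> makes \<open>f\<close> and \<open>g\<close> agree near each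
  point of \<open>S\<close>, so they share their derivatives there and the induction can go
  on.\<close>

lemma Ck_on_cong:
  assumes "open S" and "Ck_on k S f" and "\<And>z. z \<in> S \<Longrightarrow> f z = g z"
  shows "Ck_on k S g"
  using assms(2,3)
proof (induction k arbitrary: f g)
  case 0
  then show ?case by (simp cong: continuous_on_cong)
next
  case (Suc k)
  have D: "(g has_derivative frechet_derivative f (at z)) (at z)" if "z \<in> S" for z
  proof -
    have "(f has_derivative frechet_derivative f (at z)) (at z)"
      using Suc.prems(1) that by (simp add: frechet_derivative_works)
    then show ?thesis
      using assms(1) that Suc.prems(2) by (rule has_derivative_transform_within_open)
  qed
  then have E: "frechet_derivative g (at z) = frechet_derivative f (at z)" if "z \<in> S" for z
    using that by (intro frechet_derivative_eqI)
  show ?case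
    unfolding Ck_on.simps
  proof (intro conjI ballI)
    show "g differentiable (at z)" if "z \<in> S" for z
      using D[OF that] by (auto simp: differentiable_def)
    show "Ck_on k S (\<lambda>z. frechet_derivative g (at z) b)" if "b \<in> Basis" for b
      by (rule Suc.IH[of "\<lambda>z. frechet_derivative f (at z) b"])
         (use Suc.prems(1) that in \<open>simp_all add: E\<close>)
  qed
qed

text \<open>Derivatives are taken at points, so only the continuity at the bottom of the recursion
  has to be glued, and there openness enters. The purpose is to extend a product with a cutoff by
  zero.\<close>

lemma Ck_on_Un:
  assumes "open S" "open T" "Ck_on k S f" "Ck_on k T f"
  shows "Ck_on k (S \<union> T) f"
  using assms(3,4)
  by (induction k arbitrary: f) (auto intro: continuous_on_open_Un assms(1,2))

lemma Ck_on_Suc_imp: "Ck_on (Suc k) S f \<Longrightarrow> Ck_on k S f"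
proof (induction k arbitrary: f)
  case 0
  then show ?case
    by (auto intro!: continuous_at_imp_continuous_on differentiable_imp_continuous_within)
next
  case (Suc k)
  then show ?case by (metis Ck_on.simps(2))
qed

lemma Ck_on_const: "Ck_on k S (\<lambda>z. c)"
  by (induction k arbitrary: c) auto

text \<open>Exchanges \<open>frechet_derivative\<close>, which is chosen by description, for an
  explicit \<open>D\<close>, so that the usual differentiation rules can drive inductions on
  \<open>k\<close>.\<close>

lemma Ck_on_SucI:
  assumes "open S" and "\<And>z. z \<in> S \<Longrightarrow> (f has_derivative D z) (at z)"
    and "\<And>b. b \<in> Basis \<Longrightarrow> Ck_on k S (\<lambda>z. D z b)"
  shows "Ck_on (Suc k) S f"
proof -
  have E: "frechet_derivative f (at z) = D z" if "z \<in> S" for z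
    using that assms(2) by (intro frechet_derivative_eqI)
  show ?thesis
    unfolding Ck_on.simps
  proof (intro conjI ballI)
    show "f differentiable (at z)" if "z \<in> S" for z
      using assms(2)[OF that] by (auto simp: differentiable_def)
    show "Ck_on k S (\<lambda>z. frechet_derivative f (at z) b)" if "b \<in> Basis" for b
      by (rule Ck_on_cong[OF assms(1) assms(3)[OF that]]) (simp add: E)
  qed
qed

lemma Ck_on_has_derivative:
  "Ck_on (Suc k) S f \<Longrightarrow> z \<in> S \<Longrightarrow> (f has_derivative frechet_derivative f (at z)) (at z)"
  by (simp add: frechet_derivative_works)

lemma Ck_on_bounded_linear:
  assumes "open S" "bounded_linear f"
  shows "Ck_on k S f"
proof (cases k)
  case 0
  then show ?thesis using assms by (simp add: linear_continuous_on)
next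
  case (Suc j)
  show ?thesis unfolding Suc
    by (rule Ck_on_SucI[OF assms(1), where D="\<lambda>z. f"])
       (auto simp: Ck_on_const bounded_linear_imp_has_derivative assms)
qed

lemma Ck_on_add:
  assumes "open S" "Ck_on k S f" "Ck_on k S g"
  shows "Ck_on k S (\<lambda>z. f z + g z)"
  using assms(2,3)
proof (induction k arbitrary: f g)
  case 0
  then show ?case by (auto intro: continuous_intros)
next
  case (Suc k)
  show ?case
  proof (rule Ck_on_SucI[OF assms(1) has_derivative_add])
    fix b :: 'a assume "b \<in> Basis"
    then show "Ck_on k S (\<lambda>z. frechet_derivative f (at z) b + frechet_derivative g (at z) b)"
      using Suc.prems by (intro Suc.IH) auto
  qed (use Suc.prems in \<open>blast intro: Ck_on_has_derivative\<close>)+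
qed

lemma Ck_on_mult:
  assumes "open S" "Ck_on k S f" "Ck_on k S g"
  shows "Ck_on k S (\<lambda>z. f z * g z)"
  using assms(2,3)
proof (induction k arbitrary: f g)
  case 0
  then show ?case by (auto intro: continuous_intros)
next
  case (Suc k)
  show ?case
  proof (rule Ck_on_SucI[OF assms(1) has_derivative_mult])
    fix b :: 'a assume "b \<in> Basis"
    then show "Ck_on k S (\<lambda>z. f z * frechet_derivative g (at z) b + frechet_derivative f (at z) b * g z)"
      using Suc.prems Suc.prems[THEN Ck_on_Suc_imp] by (intro Ck_on_add assms(1) Suc.IH) auto
  qed (use Suc.prems in \<open>blast intro: Ck_on_has_derivative\<close>)+
qed

text \<open>Differentiating \<open>F n (f z)\<close> produces \<open>F (Suc n) (f z)\<close>.
  Carrying the whole tower of derivatives, with \<open>n\<close> arbitrary in the induction on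
  \<open>k\<close>, therefore closes the argument.\<close>

lemma Ck_on_compose:
  fixes F :: "nat \<Rightarrow> real \<Rightarrow> real"
  assumes "open S" and F: "\<And>n x. x \<in> I \<Longrightarrow> (F n has_field_derivative F (Suc n) x) (at x)"
    and "f ` S \<subseteq> I" and "Ck_on k S f"
  shows "Ck_on k S (\<lambda>z. F n (f z))"
  using assms(4)
proof (induction k arbitrary: n)
  case 0
  have "continuous_on I (F n)"
    using F by (meson DERIV_isCont continuous_at_imp_continuous_on)
  then show ?case
    using 0 assms(3) by (auto intro: continuous_on_compose2)
next
  case (Suc k)
  show ?case
  proof (rule Ck_on_SucI[OF assms(1)])
    fix z assume z: "z \<in> S"
    show "((\<lambda>z. F n (f z)) has_derivative (\<lambda>y. F (Suc n) (f z) * frechet_derivative f (at z) y)) (at z)"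
      using has_derivative_compose[OF Ck_on_has_derivative[OF Suc.prems z], of "F n"]
        F[of "f z" n] assms(3) z by (auto simp: has_field_derivative_def)
  next
    fix b :: 'a assume "b \<in> Basis"
    then show "Ck_on k S (\<lambda>z. F (Suc n) (f z) * frechet_derivative f (at z) b)"
      using Suc.prems Ck_on_Suc_imp[OF Suc.prems] by (intro Ck_on_mult assms(1) Suc.IH) auto
  qed
qed

section \<open>Closure properties of smooth functions\<close>

lemma smooth_on_subset: "smooth_on S f \<Longrightarrow> T \<subseteq> S \<Longrightarrow> smooth_on T f"
  unfolding smooth_on_def by (metis Ck_on_subset)

lemma smooth_on_cong:
  "open S \<Longrightarrow> smooth_on S f \<Longrightarrow> (\<And>z. z \<in> S \<Longrightarrow> f z = g z) \<Longrightarrow> smooth_on S g"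
  unfolding smooth_on_def by (metis Ck_on_cong)

lemma smooth_on_Un: "open S \<Longrightarrow> open T \<Longrightarrow> smooth_on S f \<Longrightarrow> smooth_on T f \<Longrightarrow> smooth_on (S \<union> T) f"
  by (auto simp: smooth_on_def Ck_on_Un)

lemma smooth_on_const: "smooth_on S (\<lambda>z. c)"
  by (auto simp: smooth_on_def Ck_on_const)

lemma smooth_on_bounded_linear: "open S \<Longrightarrow> bounded_linear f \<Longrightarrow> smooth_on S f"
  by (auto simp: smooth_on_def Ck_on_bounded_linear)

lemma smooth_on_add: "open S \<Longrightarrow> smooth_on S f \<Longrightarrow> smooth_on S g \<Longrightarrow> smooth_on S (\<lambda>z. f z + g z)"
  by (auto simp: smooth_on_def Ck_on_add)

lemma smooth_on_mult: "open S \<Longrightarrow> smooth_on S f \<Longrightarrow> smooth_on S g \<Longrightarrow> smooth_on S (\<lambda>z. f z * g z)"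
  by (auto simp: smooth_on_def Ck_on_mult)

lemma smooth_on_diff:
  assumes "open S" "smooth_on S f" "smooth_on S g"
  shows "smooth_on S (\<lambda>z. f z - g z)"
  using smooth_on_add[OF assms(1,2) smooth_on_mult[OF assms(1) smooth_on_const[of S "-1"] assms(3)]]
  by simp

lemma smooth_on_power: "open S \<Longrightarrow> smooth_on S f \<Longrightarrow> smooth_on S (\<lambda>z. f z ^ n)"
  by (induction n) (auto simp: smooth_on_const intro: smooth_on_mult)

lemma smooth_on_sum:
  "open S \<Longrightarrow> (\<And>i. i \<in> J \<Longrightarrow> smooth_on S (f i)) \<Longrightarrow> smooth_on S (\<lambda>z. \<Sum>i\<in>J. f i z)"
  by (induction J rule: infinite_finite_induct) (auto simp: smooth_on_const intro: smooth_on_add)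

lemma smooth_on_compose:
  fixes F :: "nat \<Rightarrow> real \<Rightarrow> real"
  assumes "open S" and "\<And>n x. x \<in> I \<Longrightarrow> (F n has_field_derivative F (Suc n) x) (at x)"
    and "f ` S \<subseteq> I" and "smooth_on S f"
  shows "smooth_on S (\<lambda>z. F n (f z))"
  unfolding smooth_on_def
proof
  fix k
  show "Ck_on k S (\<lambda>z. F n (f z))"
    by (rule Ck_on_compose[OF assms(1), where I=I]) (use assms in \<open>auto simp: smooth_on_def\<close>)
qed

text \<open>One real exponent covers reciprocals (\<open>c = - 1\<close>), square roots
  (\<open>c = 1 / 2\<close>) and the decay of the profile (\<open>c = - \<nu>\<close>). The tower of
  derivatives has falling factorials as coefficients.\<close>

lemma smooth_on_powr:
  assumes "open S" "smooth_on S f" "\<And>z. z \<in> S \<Longrightarrow> f z > 0"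
  shows "smooth_on S (\<lambda>z. f z powr c)"
proof -
  define F where "F n x = (\<Prod>i<n. c - real i) * x powr (c - real n)" for n and x :: real
  have "(F n has_field_derivative F (Suc n) x) (at x)" if "x \<in> {0<..}" for n x
    using DERIV_cmult[OF has_real_derivative_powr[of x "c - real n"], of "\<Prod>i<n. c - real i"] that
    by (simp add: F_def[abs_def] mult.assoc diff_diff_eq add.commute)
  then have "smooth_on S (\<lambda>z. F 0 (f z))"
    by (rule smooth_on_compose[OF assms(1), where I="{0<..}"]) (use assms in auto)
  then show ?thesis by (simp add: F_def)
qed

section \<open>A smooth cutoff on the real line\<close>

definition flat_exp :: "real \<Rightarrow> real" where
  "flat_exp x = (if x > 0 then exp (- (1 / x)) else 0)"

text \<open>The polynomial factors in the derivatives of \<open>exp (- (1 / x))\<close>. With y =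
  1/x one has dy/dx = - y^2, so P(y) exp(- y) has derivative y^2 (P(y) - P'(y)) exp(- y), which is
  the recursion.\<close>

primrec flat_poly :: "nat \<Rightarrow> real poly" where
  "flat_poly 0 = 1"
| "flat_poly (Suc n) = [:0, 0, 1:] * (flat_poly n - pderiv (flat_poly n))"

lemma tendsto_poly_times_exp_minus:
  "((\<lambda>y. poly p y * exp (- y)) \<longlongrightarrow> (0::real)) at_top"
proof -
  have *: "((\<lambda>y::real. y ^ n * exp (- y)) \<longlongrightarrow> 0) at_top" for n
    using tendsto_power_div_exp_0[of n] by (simp add: exp_minus field_simps)
  have "((\<lambda>y. \<Sum>i\<le>degree p. coeff p i * (y ^ i * exp (- y))) \<longlongrightarrow> (\<Sum>i\<le>degree p. coeff p i * 0)) at_top"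
    by (intro tendsto_intros *)
  then show ?thesis
    by (simp add: poly_altdef sum_distrib_right mult.assoc)
qed

lemma flat_exp_derivs:
  defines "E \<equiv> \<lambda>n x. if x > 0 then poly (flat_poly n) (1 / x) * exp (- (1 / x)) else (0::real)"
  shows "(E n has_field_derivative E (Suc n) x) (at x)"
proof -
  consider "x > 0" | "x < 0" | "x = 0" by linarith
  then show ?thesis
  proof cases
    case 1
    have "((\<lambda>x. poly (flat_poly n) (1 / x) * exp (- (1 / x))) has_field_derivative E (Suc n) x) (at x)"
    proof -
      have i: "((\<lambda>x. 1 / x) has_field_derivative - (1 / x\<^sup>2)) (at x)"
        using 1 by (auto intro!: derivative_eq_intros simp: power2_eq_square)
      have e: "((\<lambda>x. exp (- (1 / x))) has_field_derivative exp (- (1 / x)) * - (- (1 / x\<^sup>2))) (at x)"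
        by (rule DERIV_fun_exp[OF DERIV_minus[OF i]])
      have "((\<lambda>x. poly (flat_poly n) (1 / x)) has_field_derivative
          poly (pderiv (flat_poly n)) (1 / x) * - (1 / x\<^sup>2)) (at x)"
        by (rule DERIV_chain2[OF poly_DERIV i])
      from DERIV_mult[OF this e] show ?thesis
        by (rule DERIV_cong) (use 1 in \<open>simp add: E_def power2_eq_square field_simps\<close>)
    qed
    then show ?thesis
      by (rule has_field_derivative_transform_within_open[where S="{0<..}"]) (use 1 in \<open>auto simp: E_def\<close>)
  next
    case 2
    have "((\<lambda>x. 0) has_field_derivative E (Suc n) x) (at x)"
      using 2 unfolding E_def by (auto intro!: derivative_eq_intros)
    then show ?thesis
      by (rule has_field_derivative_transform_within_open[where S="{..<0}"]) (use 2 in \<open>auto simp: E_def\<close>)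
  next
    case 3
    \<comment> \<open>With y = 1/h the difference quotient at 0 is y P(y) exp(- y);
      \<open>pCons 0\<close> is the extra factor y from the division by h.\<close>
    have "((\<lambda>y. poly (pCons 0 (flat_poly n)) y * exp (- y)) \<longlongrightarrow> 0) at_top"
      by (rule tendsto_poly_times_exp_minus)
    then have R: "((\<lambda>h. poly (pCons 0 (flat_poly n)) (inverse h) * exp (- inverse h)) \<longlongrightarrow> 0) (at_right 0)"
      by (rule filterlim_compose[OF _ filterlim_inverse_at_top_right])
    have "((\<lambda>h. (E n (0 + h) - E n 0) / h) \<longlongrightarrow> 0) (at_right 0)"
      by (rule Lim_transform_eventually[OF R])
         (auto simp: eventually_at_filter E_def field_simps)
    moreover have "((\<lambda>h. (E n (0 + h) - E n 0) / h) \<longlongrightarrow> 0) (at_left 0)"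
      by (rule Lim_transform_eventually[OF tendsto_const])
         (auto simp: eventually_at_filter E_def)
    ultimately have "((\<lambda>h. (E n (0 + h) - E n 0) / h) \<longlongrightarrow> 0) (at 0)"
      by (simp add: filterlim_split_at)
    moreover have "E (Suc n) 0 = 0"
      by (simp add: E_def)
    ultimately show ?thesis
      by (simp only: 3 DERIV_def)
  qed
qed

lemma smooth_on_flat_exp:
  assumes "open S" "smooth_on S f"
  shows "smooth_on S (\<lambda>z. flat_exp (f z))"
proof -
  define E where "E n x = (if x > 0 then poly (flat_poly n) (1 / x) * exp (- (1 / x)) else (0::real))" for n x
  have "smooth_on S (\<lambda>z. E 0 (f z))"
    by (rule smooth_on_compose[OF assms(1), where I=UNIV])
       (use assms flat_exp_derivs in \<open>auto simp: E_def[abs_def]\<close>)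
  then show ?thesis by (simp add: E_def flat_exp_def cong: if_cong)
qed

lemma flat_exp_mono: "x \<le> y \<Longrightarrow> flat_exp x \<le> flat_exp y"
  by (auto simp: flat_exp_def frac_le)

lemma flat_exp_nonneg: "0 \<le> flat_exp x"
  by (simp add: flat_exp_def)

text \<open>The classical smooth step: 1 up to \<open>s = 1\<close>, 0 from \<open>s = 2\<close> on.
  The two flat exponentials never vanish together, so the quotient stays smooth.\<close>

definition cutoff :: "real \<Rightarrow> real" where
  "cutoff s = flat_exp (2 - s) / (flat_exp (2 - s) + flat_exp (s - 1))"

lemma cutoff_denominator_pos: "0 < flat_exp (2 - s) + flat_exp (s - 1)"
  by (cases "s < 2") (auto simp: flat_exp_def add_pos_nonneg)

lemma cutoff_eq_1: "s \<le> 1 \<Longrightarrow> cutoff s = 1"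
  by (auto simp: cutoff_def flat_exp_def)

lemma cutoff_eq_0: "2 \<le> s \<Longrightarrow> cutoff s = 0"
  by (auto simp: cutoff_def flat_exp_def)

lemma cutoff_nonneg: "0 \<le> cutoff s"
  by (simp add: cutoff_def flat_exp_nonneg)

lemma cutoff_le_1: "cutoff s \<le> 1"
  using cutoff_denominator_pos[of s] by (simp add: cutoff_def flat_exp_nonneg)

lemma cutoff_antimono:
  assumes "x \<le> y"
  shows "cutoff y \<le> cutoff x"
proof -
  have "flat_exp (2 - y) * flat_exp (x - 1) \<le> flat_exp (2 - x) * flat_exp (y - 1)"
    using assms by (intro mult_mono flat_exp_mono flat_exp_nonneg) auto
  then show ?thesis
    using cutoff_denominator_pos[of x] cutoff_denominator_pos[of y]
    by (simp add: cutoff_def divide_simps algebra_simps)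
qed

lemma smooth_on_cutoff:
  assumes "open S" "smooth_on S f"
  shows "smooth_on S (\<lambda>z. cutoff (f z))"
proof -
  have "smooth_on S (\<lambda>z. flat_exp (2 - f z) * (flat_exp (2 - f z) + flat_exp (f z - 1)) powr (- 1))"
    by (intro smooth_on_mult smooth_on_powr smooth_on_add smooth_on_flat_exp smooth_on_diff
        smooth_on_const assms cutoff_denominator_pos)
  then show ?thesis
    using cutoff_denominator_pos
    by (simp add: cutoff_def powr_minus divide_inverse less_imp_le)
qed

lemma cutoff_derivative:
  obtains D C where "\<And>s. (cutoff has_real_derivative D s) (at s)" "continuous_on UNIV D"
    "\<And>s. D s \<le> 0" "\<And>s. - C \<le> D s" "C \<ge> 0" "\<And>s. \<not> (1 < s \<and> s < 2) \<Longrightarrow> D s = 0"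
proof -
  have "smooth_on UNIV cutoff"
    using smooth_on_cutoff[of UNIV "\<lambda>x. x"] smooth_on_bounded_linear[of UNIV "\<lambda>x::real. x"] by simp
  then have k: "Ck_on (Suc 0) UNIV cutoff"
    unfolding smooth_on_def by blast
  define D where "D s = frechet_derivative cutoff (at s) 1" for s :: real
  have D: "(cutoff has_real_derivative D s) (at s)" for s
  proof -
    have d: "(cutoff has_derivative frechet_derivative cutoff (at s)) (at s)"
      using k by (rule Ck_on_has_derivative) simp
    then have "frechet_derivative cutoff (at s) x = D s * x" for x
      unfolding D_def using linear_cmul[OF has_derivative_linear[OF d], of x 1] by simp
    then have "frechet_derivative cutoff (at s) = (*) (D s)"
      by (simp add: fun_eq_iff)
    then show ?thesis
      using d unfolding has_field_derivative_def by simp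
  qed
  have cont: "continuous_on UNIV D"
    using k by (simp add: D_def[abs_def])
  have le: "D s \<le> 0" for s
  proof (rule ccontr)
    assume "\<not> D s \<le> 0"
    then obtain d where "d > 0" "\<And>h. 0 < h \<Longrightarrow> h < d \<Longrightarrow> cutoff s < cutoff (s + h)"
      using DERIV_pos_inc_right[OF D[of s]] by auto
    from this(2)[of "d/2"] this(1) show False
      using cutoff_antimono[of s "s + d/2"] by auto
  qed
  \<comment> \<open>At these points, 1 and 2 included, \<open>cutoff\<close> attains its maximum 1
    or its minimum 0. Vanishing at the endpoints themselves is what later gives strict inequalities
    for the annulus.\<close>
  have zero: "D s = 0" if "\<not> (1 < s \<and> s < 2)" for s
  proof (cases "s \<le> 1")
    case True
    show ?thesis
      by (rule DERIV_local_max[OF D, of 1]) (auto simp: cutoff_eq_1[OF True] cutoff_le_1)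
  next
    case False
    then show ?thesis
      using that by (intro DERIV_local_min[OF D, of 1]) (auto simp: cutoff_eq_0 cutoff_nonneg)
  qed
  have "bounded (D ` {1..2})"
    by (intro compact_imp_bounded compact_continuous_image continuous_on_subset[OF cont]) auto
  then obtain C where C: "\<forall>s\<in>{1..2}. \<bar>D s\<bar> \<le> C" "C > 0"
    unfolding bounded_pos by auto
  have "- C \<le> D s" for s
    using bspec[OF C(1), of s] C(2) zero[of s] by (cases "1 < s \<and> s < 2") auto
  then show thesis
    using that[OF D cont le] C(2) zero by (meson less_imp_le)
qed

section \<open>Lebesgue integration\<close>

lemma AE_lebesgue_on_subset:
  assumes "AE z in lebesgue_on S. P z" "T \<subseteq> S" "S \<in> sets lebesgue" "T \<in> sets lebesgue"
  shows "AE z in lebesgue_on T. P z"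
proof -
  have "AE z in lebesgue. z \<in> S \<longrightarrow> P z"
    using assms(1,3) by (simp add: AE_restrict_space_iff)
  then have "AE z in lebesgue. z \<in> T \<longrightarrow> P z"
    by eventually_elim (use assms(2) in auto)
  then show ?thesis
    using assms(4) by (simp add: AE_restrict_space_iff)
qed

lemma
  fixes f :: "'a::euclidean_space \<Rightarrow> real"
  assumes "T \<subseteq> S" "S \<in> sets lebesgue" "T \<in> sets lebesgue"
    and "\<And>z. z \<in> S \<Longrightarrow> z \<notin> T \<Longrightarrow> f z = 0"
  shows integral_lebesgue_on_support: "integral\<^sup>L (lebesgue_on S) f = integral\<^sup>L (lebesgue_on T) f"
    and integrable_lebesgue_on_support: "integrable (lebesgue_on S) f = integrable (lebesgue_on T) f"
proof -
  have eq: "(\<lambda>z. indicator S z *\<^sub>R f z) = (\<lambda>z. indicator T z *\<^sub>R f z)"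
    using assms by (auto simp: indicator_def fun_eq_iff)
  have sets: "S \<inter> space lebesgue \<in> sets lebesgue" "T \<inter> space lebesgue \<in> sets lebesgue"
    using assms by auto
  show "integral\<^sup>L (lebesgue_on S) f = integral\<^sup>L (lebesgue_on T) f"
    and "integrable (lebesgue_on S) f = integrable (lebesgue_on T) f"
    unfolding integral_restrict_space[OF sets(1)] integral_restrict_space[OF sets(2)]
      integrable_restrict_space[OF sets(1)] integrable_restrict_space[OF sets(2)] eq by simp_all
qed

lemma open_half_space: "open half_space"
  unfolding half_space_def by (intro open_Times) auto

lemma half_space_sets: "half_space \<in> sets lebesgue"
  by (intro sets_completionI_sets) (simp add: open_half_space)

lemma finite_measure_lebesgue_on_bounded:
  fixes S :: "'a::euclidean_space set"
  assumes "bounded S" "open S"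
  shows "finite_measure (lebesgue_on S)"
proof
  show "emeasure (lebesgue_on S) (space (lebesgue_on S)) \<noteq> \<infinity>"
    using emeasure_bounded_finite[OF assms(1)] assms(2) by (simp add: emeasure_restrict_space space_restrict_space)
qed

text \<open>Fubini, with the fundamental theorem of calculus in \<open>t\<close>: every line of
  constant \<open>x\<close> leaves the compact set \<open>K\<close> at both ends, so each inner
  integral is a difference of two zeros.\<close>

lemma integral_partial_derivative_eq_0:
  fixes G G' :: "real \<times> 'b::euclidean_space \<Rightarrow> real"
  assumes cont: "continuous_on UNIV G'" and "compact K"
    and deriv: "\<And>t x. ((\<lambda>t. G (t, x)) has_real_derivative G' (t, x)) (at t)"
    and supp: "\<And>z. z \<notin> K \<Longrightarrow> G z = 0" "\<And>z. z \<notin> K \<Longrightarrow> G' z = 0"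
  shows "integral\<^sup>L lebesgue G' = 0"
proof -
  have [measurable]: "G' \<in> borel_measurable borel"
    using cont by (rule borel_measurable_continuous_onI)
  have eq: "indicator K z *\<^sub>R G' z = G' z" for z
    by (cases "z \<in> K") (simp_all add: supp(2))
  have int: "integrable lborel G'"
    using borel_integrable_compact[OF \<open>compact K\<close> continuous_on_subset[OF cont], simplified eq]
    by (simp add: set_integrable_def eq)
  obtain B where B: "\<And>z. z \<in> K \<Longrightarrow> norm z \<le> B" "B > 0"
    using compact_imp_bounded[OF \<open>compact K\<close>] unfolding bounded_pos by blast
  have outside: "(t, x) \<notin> K" if "\<bar>t\<bar> > B" for t x
    using B(1)[of "(t, x)"] that norm_fst_le[of t x] by auto
  have inner: "(LINT t|lborel. G' (t, x)) = 0" for x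
  proof -
    have c: "continuous_on {- B - 1..B + 1} (\<lambda>t. G' (t, x))"
      by (intro continuous_on_compose2[OF cont] continuous_intros) auto
    \<comment> \<open>The endpoints lie at distance B + 1 from 0, not B, because
      \<open>outside\<close> asks for strict inequality.\<close>
    have "(LINT t|lborel. indicator {- B - 1..B + 1} t *\<^sub>R G' (t, x)) = G (B + 1, x) - G (- B - 1, x)"
      using B(2) deriv
      by (intro integral_FTC_atLeastAtMost[OF _ _ c])
         (auto intro: has_vector_derivative_at_within simp: has_real_derivative_iff_has_vector_derivative)
    moreover have "(\<lambda>t. indicator {- B - 1..B + 1} t *\<^sub>R G' (t, x)) = (\<lambda>t. G' (t, x))"
    proof
      fix t
      show "indicator {- B - 1..B + 1} t *\<^sub>R G' (t, x) = G' (t, x)"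
        using supp(2)[of "(t, x)"] outside[of t x] by (cases "\<bar>t\<bar> > B") (auto simp: indicator_def)
    qed
    ultimately show ?thesis
      using supp(1)[of "(B + 1, x)"] supp(1)[of "(- B - 1, x)"] outside[of "B + 1" x]
        outside[of "- B - 1" x] B(2) by (simp only:) simp
  qed
  have "integrable (lborel \<Otimes>\<^sub>M lborel) (\<lambda>(t, x). G' (t, x))"
    using int by (simp add: lborel_prod)
  then have "(LINT x|lborel. LINT t|lborel. G' (t, x)) = integral\<^sup>L (lborel \<Otimes>\<^sub>M lborel) (\<lambda>(t, x). G' (t, x))"
    by (rule lborel_pair.integral_snd)
  then have "integral\<^sup>L lborel G' = 0"
    by (simp add: inner lborel_prod)
  then show ?thesis
    by (simp add: integral_completion)
qed

text \<open>Dominated convergence with majorant \<open>B * \<bar>G z\<bar>\<close>. In the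
  applications the bounded factor carries the nonlinear dependence on the approximation, or a
  cutoff, while \<open>G\<close> stays fixed.\<close>

lemma
  fixes G :: "'a \<Rightarrow> real"
  assumes "integrable M G" and [measurable]: "\<And>k. b k \<in> borel_measurable M" "c \<in> borel_measurable M"
    and "\<And>k z. \<bar>b k z\<bar> \<le> B" and "AE z in M. (\<lambda>k. b k z) \<longlonglongrightarrow> c z"
  shows tendsto_integral_bounded_mult: "(\<lambda>k. LINT z|M. b k z * G z) \<longlonglongrightarrow> (LINT z|M. c z * G z)"
    and integrable_bounded_mult_limit: "integrable M (\<lambda>z. c z * G z)"
proof -
  have [measurable]: "G \<in> borel_measurable M"
    using assms(1) by auto
  have i: "integrable M (\<lambda>z. B * \<bar>G z\<bar>)"
    using assms(1) by simp
  have l: "AE z in M. (\<lambda>k. b k z * G z) \<longlonglongrightarrow> c z * G z"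
    using assms(5) by eventually_elim (intro tendsto_intros)
  have n: "AE z in M. norm (b k z * G z) \<le> B * \<bar>G z\<bar>" for k
    using assms(4) by (auto simp: abs_mult intro!: mult_right_mono)
  show "(\<lambda>k. LINT z|M. b k z * G z) \<longlonglongrightarrow> (LINT z|M. c z * G z)"
    by (rule integral_dominated_convergence[OF _ _ i l n]) measurable
  show "integrable M (\<lambda>z. c z * G z)"
    by (rule integrable_dominated_convergence[OF _ _ i l n]) measurable
qed

lemma integrable_bounded_mult:
  fixes G :: "'a \<Rightarrow> real"
  assumes "integrable M G" "b \<in> borel_measurable M" and "\<And>z. z \<in> space M \<Longrightarrow> \<bar>b z\<bar> \<le> B"
  shows "integrable M (\<lambda>z. b z * G z)"
proof (rule Bochner_Integration.integrable_bound)
  show "integrable M (\<lambda>z. B * \<bar>G z\<bar>)"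
    using assms(1) by simp
  show "AE z in M. norm (b z * G z) \<le> norm (B * \<bar>G z\<bar>)"
    using assms(3) by (intro AE_I2) (force simp: abs_mult intro!: mult_right_mono)
qed (use assms in measurable)

section \<open>The quadratic form\<close>

lemma aform_add_left: "aform M (\<xi> + \<xi>') \<eta> = aform M \<xi> \<eta> + aform M \<xi>' \<eta>"
  by (simp add: aform_def algebra_simps sum.distrib)

lemma aform_add_right: "aform M \<xi> (\<eta> + \<eta>') = aform M \<xi> \<eta> + aform M \<xi> \<eta>'"
  by (simp add: aform_def algebra_simps sum.distrib)

lemma aform_diff_left: "aform M (\<xi> - \<xi>') \<eta> = aform M \<xi> \<eta> - aform M \<xi>' \<eta>"
  by (simp add: aform_def algebra_simps sum_subtractf)

lemma aform_diff_right: "aform M \<xi> (\<eta> - \<eta>') = aform M \<xi> \<eta> - aform M \<xi> \<eta>'"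
  by (simp add: aform_def algebra_simps sum_subtractf)

lemma aform_scaleR_left: "aform M (c *\<^sub>R \<xi>) \<eta> = c * aform M \<xi> \<eta>"
  by (simp add: aform_def algebra_simps sum_distrib_left)

lemma aform_scaleR_right: "aform M \<xi> (c *\<^sub>R \<eta>) = c * aform M \<xi> \<eta>"
  by (simp add: aform_def algebra_simps sum_distrib_left)

lemma aform_commute:
  assumes "\<And>i j. M $ i $ j = M $ j $ i"
  shows "aform M \<xi> \<eta> = aform M \<eta> \<xi>"
  unfolding aform_def by (subst sum.swap) (simp add: assms mult_ac)

text \<open>Semidefiniteness at \<xi> + e \<eta> and \<xi> - e \<eta>, divided by e. It works
  without any ellipticity, which the matrix may lack.\<close>

lemma aform_young:
  assumes "\<And>i j. M $ i $ j = M $ j $ i" and "\<And>\<xi>. 0 \<le> aform M \<xi> \<xi>" and "0 < e"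
  shows "2 * \<bar>aform M \<xi> \<eta>\<bar> \<le> aform M \<xi> \<xi> / e + e * aform M \<eta> \<eta>"
proof -
  have c: "aform M \<eta> \<xi> = aform M \<xi> \<eta>"
    by (rule aform_commute[OF assms(1)])
  have "0 \<le> aform M (\<xi> + e *\<^sub>R \<eta>) (\<xi> + e *\<^sub>R \<eta>)" "0 \<le> aform M (\<xi> - e *\<^sub>R \<eta>) (\<xi> - e *\<^sub>R \<eta>)"
    by (rule assms)+
  then have "e * (2 * \<bar>aform M \<xi> \<eta>\<bar>) \<le> aform M \<xi> \<xi> + e * (e * aform M \<eta> \<eta>)"
    by (simp add: aform_add_left aform_add_right aform_diff_left aform_diff_right
        aform_scaleR_left aform_scaleR_right c abs_if algebra_simps)
  then show ?thesis
    using assms(3) by (simp add: field_simps)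
qed

text \<open>Parallelogram law: the two sides differ by the form at
  \<open>\<xi> + \<eta>\<close>.\<close>

lemma aform_diff_le:
  assumes "\<And>\<xi>. 0 \<le> aform M \<xi> \<xi>"
  shows "aform M (\<xi> - \<eta>) (\<xi> - \<eta>) \<le> 2 * aform M \<xi> \<xi> + 2 * aform M \<eta> \<eta>"
  using assms[of "\<xi> + \<eta>"]
  by (simp add: aform_add_left aform_add_right aform_diff_left aform_diff_right)

lemma borel_measurable_aform:
  fixes a :: "'z \<Rightarrow> real^'n^'n"
  assumes "\<And>i j. (\<lambda>z. a z $ i $ j) \<in> borel_measurable M"
    and "\<xi> \<in> borel_measurable M" "\<eta> \<in> borel_measurable M"
  shows "(\<lambda>z. aform (a z) (\<xi> z) (\<eta> z)) \<in> borel_measurable M"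
proof -
  have "(\<lambda>z. f z $ i) \<in> borel_measurable M" if "f \<in> borel_measurable M" for f :: "'z \<Rightarrow> real^'n" and i
    using that by (rule measurable_compose) (intro borel_measurable_continuous_onI continuous_intros)
  then show ?thesis
    unfolding aform_def using assms by (intro borel_measurable_sum borel_measurable_times) auto
qed

section \<open>The nonlinearity\<close>

text \<open>For equal signs, (s - r)^q \<le> s^q - r^q holds with constant 1. Only opposite signs
  cost a factor: there x - y is at most twice the larger of x and - y, whence
  \<open>2 powr (- q)\<close>.\<close>

lemma signed_power_diff_ge:
  fixes x y q :: real
  assumes "1 < q" "y \<le> x"
  shows "2 powr (- q) * (x - y) powr q \<le> \<bar>x\<bar> powr (q - 1) * x - \<bar>y\<bar> powr (q - 1) * y"
proof -
  have *: "(s - r) powr q \<le> s powr (q - 1) * s - r powr (q - 1) * r" if "0 \<le> r" "r \<le> s" for r s :: real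
  proof -
    have "(s - r) powr q = (s - r) powr (q - 1) * (s - r)"
      using that by (simp add: powr_diff)
    also have "\<dots> \<le> s powr (q - 1) * (s - r)"
      using that assms by (intro mult_right_mono powr_mono2) auto
    also have "\<dots> \<le> s powr (q - 1) * s - r powr (q - 1) * r"
      using that assms by (simp add: algebra_simps mult_left_mono powr_mono2 mult_right_mono)
    finally show ?thesis .
  qed
  have two: "2 powr (- q) \<le> 1"
    using assms powr_mono[of "- q" 0 2] by simp
  consider "0 \<le> y" | "x \<le> 0" | "y < 0" "0 < x" by linarith
  then show ?thesis
  proof cases
    case 1
    have "2 powr (- q) * (x - y) powr q \<le> (x - y) powr q"
      using two by (simp add: mult_left_le_one_le)
    then show ?thesis
      using *[of y x] 1 assms by simp
  next
    case 2
    have "2 powr (- q) * (x - y) powr q \<le> (x - y) powr q"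
      using two by (simp add: mult_left_le_one_le)
    then show ?thesis
      using *[of "- x" "- y"] 2 assms by simp
  next
    case 3
    define m where "m = max x (- y)"
    have "2 powr (- q) * (x - y) powr q = ((x - y) / 2) powr q"
      using assms by (simp add: powr_divide powr_minus_divide)
    also have "\<dots> \<le> m powr q"
      using 3 assms by (intro powr_mono2) (auto simp: m_def)
    also have "\<dots> \<le> x powr q + (- y) powr q"
      by (simp add: m_def max_def)
    also have "\<dots> = \<bar>x\<bar> powr (q - 1) * x - \<bar>y\<bar> powr (q - 1) * y"
      using 3 by (simp add: powr_diff)
    finally show ?thesis .
  qed
qed

lemma abs_diff_powr_le:
  fixes x y q :: real
  assumes "0 \<le> q"
  shows "\<bar>x - y\<bar> powr q \<le> 2 powr q * (\<bar>x\<bar> powr q + \<bar>y\<bar> powr q)"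
proof -
  have "\<bar>x - y\<bar> powr q \<le> (2 * max \<bar>x\<bar> \<bar>y\<bar>) powr q"
    using assms by (intro powr_mono2) auto
  also have "\<dots> \<le> 2 powr q * (\<bar>x\<bar> powr q + \<bar>y\<bar> powr q)"
    by (simp add: powr_mult max_def)
  finally show ?thesis .
qed

section \<open>Smooth approximation\<close>

lemma space_grad_time_deriv_has_derivative:
  assumes "(f has_derivative D) (at z)"
  shows "time_deriv f z = D (1, 0)" "space_grad f z = (\<chi> i. D (0, axis i 1))"
  using frechet_derivative_eqI[OF assms] by (simp_all add: time_deriv_def space_grad_def)

lemma smooth_on_has_derivative:
  assumes "smooth_on S f" "z \<in> S"
  shows "(f has_derivative frechet_derivative f (at z)) (at z)"
  using assms(1) unfolding smooth_on_def by (metis Ck_on_has_derivative assms(2))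

lemma
  assumes "smooth_on S f" "smooth_on S g" "z \<in> S"
  shows time_deriv_diff: "time_deriv (\<lambda>z. f z - g z) z = time_deriv f z - time_deriv g z"
    and space_grad_diff: "space_grad (\<lambda>z. f z - g z) z = space_grad f z - space_grad g z"
proof -
  have "((\<lambda>z. f z - g z) has_derivative
      (\<lambda>y. frechet_derivative f (at z) y - frechet_derivative g (at z) y)) (at z)"
    by (intro has_derivative_diff smooth_on_has_derivative[OF assms(1,3)] smooth_on_has_derivative[OF assms(2,3)])
  from space_grad_time_deriv_has_derivative[OF this]
  show "time_deriv (\<lambda>z. f z - g z) z = time_deriv f z - time_deriv g z"
    and "space_grad (\<lambda>z. f z - g z) z = space_grad f z - space_grad g z"
    by (simp_all add: time_deriv_def space_grad_def vec_eq_iff)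
qed

text \<open>A vanishing sum of three non-negative terms vanishes termwise, after which the square
  root and the power 1/q are undone. Integrability of the differences is recorded alongside, since
  the integral of a non-integrable function has value 0 and its convergence alone would say
  nothing.\<close>

lemma W_space_approx:
  assumes "1 < q" and am: "\<And>i j. (\<lambda>z. a z $ i $ j) \<in> borel_measurable (lebesgue_on \<Omega>)"
    and psd: "AE z in lebesgue_on \<Omega>. \<forall>\<xi>. 0 \<le> aform (a z) \<xi> \<xi>"
    and W: "W_space a q \<Omega> u ut ux"
  obtains f where "\<And>k::nat. smooth_on \<Omega> (f k)"
    "\<And>k. W_finite a q \<Omega> (f k) (time_deriv (f k)) (space_grad (f k))"
    "\<And>k. integrable (lebesgue_on \<Omega>) (\<lambda>z. \<bar>time_deriv (f k) z - ut z\<bar>)"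
    "(\<lambda>k. LINT z|lebesgue_on \<Omega>. \<bar>time_deriv (f k) z - ut z\<bar>) \<longlonglongrightarrow> 0"
    "\<And>k. integrable (lebesgue_on \<Omega>) (\<lambda>z. aform (a z) (space_grad (f k) z - ux z) (space_grad (f k) z - ux z))"
    "(\<lambda>k. LINT z|lebesgue_on \<Omega>. aform (a z) (space_grad (f k) z - ux z) (space_grad (f k) z - ux z)) \<longlonglongrightarrow> 0"
    "\<And>k. integrable (lebesgue_on \<Omega>) (\<lambda>z. \<bar>f k z - u z\<bar> powr q)"
    "(\<lambda>k. LINT z|lebesgue_on \<Omega>. \<bar>f k z - u z\<bar> powr q) \<longlonglongrightarrow> 0"
proof -
  let ?M = "lebesgue_on \<Omega>"
  have mq: "max 1 q = q"
    using assms(1) by simp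
  obtain f where f: "\<And>k::nat. smooth_on \<Omega> (f k)"
      "\<And>k. W_finite a q \<Omega> (f k) (time_deriv (f k)) (space_grad (f k))"
      "(\<lambda>k. W_norm a q \<Omega> (\<lambda>z. f k z - u z) (\<lambda>z. time_deriv (f k) z - ut z)
         (\<lambda>z. space_grad (f k) z - ux z)) \<longlonglongrightarrow> 0"
    and u: "W_finite a q \<Omega> u ut ux"
    using W unfolding W_space_def by blast
  have [measurable]: "u \<in> borel_measurable ?M" "ut \<in> borel_measurable ?M" "ux \<in> borel_measurable ?M"
    "f k \<in> borel_measurable ?M" "time_deriv (f k) \<in> borel_measurable ?M"
    "space_grad (f k) \<in> borel_measurable ?M" for k
    using f(2)[of k] u unfolding W_finite_def by auto
  define T where "T k = (LINT z|?M. \<bar>time_deriv (f k) z - ut z\<bar>)" for k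
  define X where "X k = (LINT z|?M. aform (a z) (space_grad (f k) z - ux z) (space_grad (f k) z - ux z))" for k
  define L where "L k = (LINT z|?M. \<bar>f k z - u z\<bar> powr q)" for k
  have X0: "0 \<le> X k" for k
    unfolding X_def using psd by (intro integral_nonneg_AE) (auto elim: AE_mp)
  have T0: "0 \<le> T k" and L0: "0 \<le> L k" for k
    unfolding T_def L_def by simp_all
  have N: "(\<lambda>k. T k + sqrt (X k) + L k powr (1 / q)) \<longlonglongrightarrow> 0"
    using f(3) unfolding W_norm_def mq T_def X_def L_def .
  have Tl: "T \<longlonglongrightarrow> 0"
    by (rule tendsto_sandwich[OF _ _ tendsto_const N]) (auto simp: T0 X0)
  have "(\<lambda>k. sqrt (X k)) \<longlonglongrightarrow> 0"
    by (rule tendsto_sandwich[OF _ _ tendsto_const N]) (auto simp: T0 X0)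
  from tendsto_power[OF this, of 2] have Xl: "X \<longlonglongrightarrow> 0"
    by (simp add: X0)
  have "(\<lambda>k. L k powr (1 / q)) \<longlonglongrightarrow> 0"
    by (rule tendsto_sandwich[OF _ _ tendsto_const N]) (auto simp: T0 X0)
  then have "(\<lambda>k. (L k powr (1 / q)) powr q) \<longlonglongrightarrow> 0"
    by (rule tendsto_zero_powrI[OF _ tendsto_const]) (use assms(1) in auto)
  then have Ll: "L \<longlonglongrightarrow> 0"
    using assms(1) L0 by (simp add: powr_powr)
  have ti: "integrable ?M (\<lambda>z. \<bar>time_deriv (f k) z - ut z\<bar>)" for k
  proof -
    have "integrable ?M (\<lambda>z. time_deriv (f k) z)" "integrable ?M ut"
      using f(2)[of k] u unfolding W_finite_def by (auto simp: integrable_abs_iff)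
    then show ?thesis by auto
  qed
  have xi: "integrable ?M (\<lambda>z. aform (a z) (space_grad (f k) z - ux z) (space_grad (f k) z - ux z))" for k
  proof (rule Bochner_Integration.integrable_bound)
    show "integrable ?M (\<lambda>z. 2 * aform (a z) (space_grad (f k) z) (space_grad (f k) z) + 2 * aform (a z) (ux z) (ux z))"
      using f(2)[of k] u unfolding W_finite_def by auto
    show "(\<lambda>z. aform (a z) (space_grad (f k) z - ux z) (space_grad (f k) z - ux z)) \<in> borel_measurable ?M"
      by (intro borel_measurable_aform am) measurable
    show "AE z in ?M. norm (aform (a z) (space_grad (f k) z - ux z) (space_grad (f k) z - ux z))
        \<le> norm (2 * aform (a z) (space_grad (f k) z) (space_grad (f k) z) + 2 * aform (a z) (ux z) (ux z))"
      using psd by eventually_elim (use aform_diff_le in \<open>auto intro: order_trans[OF _ abs_ge_self]\<close>)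
  qed
  have li: "integrable ?M (\<lambda>z. \<bar>f k z - u z\<bar> powr q)" for k
  proof (rule Bochner_Integration.integrable_bound)
    show "integrable ?M (\<lambda>z. 2 powr q * (\<bar>f k z\<bar> powr q + \<bar>u z\<bar> powr q))"
      using f(2)[of k] u unfolding W_finite_def mq by auto
    show "AE z in ?M. norm (\<bar>f k z - u z\<bar> powr q) \<le> norm (2 powr q * (\<bar>f k z\<bar> powr q + \<bar>u z\<bar> powr q))"
    proof (rule AE_I2)
      fix z
      have "norm (\<bar>f k z - u z\<bar> powr q) \<le> 2 powr q * (\<bar>f k z\<bar> powr q + \<bar>u z\<bar> powr q)"
        using abs_diff_powr_le[of q "f k z" "u z"] assms(1) by simp
      then show "norm (\<bar>f k z - u z\<bar> powr q) \<le> norm (2 powr q * (\<bar>f k z\<bar> powr q + \<bar>u z\<bar> powr q))"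
        unfolding real_norm_def by (rule order_trans[OF _ abs_ge_self])
    qed
  qed measurable
  show thesis
    by (rule that[OF f(1,2) ti Tl[unfolded T_def[abs_def]] xi Xl[unfolded X_def[abs_def]]
          li Ll[unfolded L_def[abs_def]]])
qed

text \<open>Passes from L^q to L^1 on sets of finite measure: once \<bar>s\<bar> exceeds the
  threshold e, the factor \<open>\<bar>s\<bar> powr (1 - q)\<close> is at most
  \<open>e powr (1 - q)\<close>.\<close>

lemma abs_le_eps_powr:
  fixes s e q :: real
  assumes "1 < q" "0 < e"
  shows "\<bar>s\<bar> \<le> e + e powr (1 - q) * \<bar>s\<bar> powr q"
proof (cases "\<bar>s\<bar> \<le> e")
  case True
  then show ?thesis by (simp add: add_increasing2)
next
  case False
  have "e powr (1 - q) * \<bar>s\<bar> powr q \<ge> \<bar>s\<bar> powr (1 - q) * \<bar>s\<bar> powr q"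
    using False assms by (intro mult_right_mono powr_mono2') auto
  moreover have "\<bar>s\<bar> powr (1 - q) * \<bar>s\<bar> powr q = \<bar>s\<bar>"
    using False assms by (simp flip: powr_add)
  ultimately show ?thesis
    using assms by simp
qed

text \<open>\<open>D e\<close> may blow up as e tends to 0; what counts is that e is fixed before k
  grows. In the choice of e the denominator \<open>C + 1\<close> allows for
  \<open>C = 0\<close>.\<close>

lemma tendsto_0_of_le_eps:
  fixes x y :: "nat \<Rightarrow> real"
  assumes "y \<longlonglongrightarrow> 0" and "\<And>k. 0 \<le> x k" and "0 \<le> C"
    and "\<And>e k. 0 < e \<Longrightarrow> x k \<le> e * C + D e * y k"
  shows "x \<longlonglongrightarrow> 0"
proof (rule tendstoI)
  fix r :: real assume "0 < r"
  define e where "e = r / (2 * (C + 1))"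
  have e: "0 < e" "e * C < r / 2"
    using \<open>0 < r\<close> assms(3) by (auto simp: e_def field_simps)
  have "(\<lambda>k. e * C + D e * y k) \<longlonglongrightarrow> e * C + D e * 0"
    by (intro tendsto_intros assms(1))
  then have "\<forall>\<^sub>F k in sequentially. e * C + D e * y k < r"
    by (rule order_tendstoD) (use e \<open>0 < r\<close> in auto)
  then show "\<forall>\<^sub>F k in sequentially. dist (x k) 0 < r"
    by eventually_elim (use assms(2) assms(4)[OF e(1)] in \<open>force intro: le_less_trans\<close>)
qed

text \<open>Continuous functions of the approximations will have to converge almost everywhere, and
  convergence in L^1 yields this only along a subsequence. It is extracted last, and the norm
  convergences are inherited by it.\<close>

lemma W_space_diff_approx:
  assumes "1 < q" and \<Omega>: "open \<Omega>" "bounded \<Omega>"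
    and am: "\<And>i j. (\<lambda>z. a z $ i $ j) \<in> borel_measurable (lebesgue_on \<Omega>)"
    and psd: "AE z in lebesgue_on \<Omega>. \<forall>\<xi>. 0 \<le> aform (a z) \<xi> \<xi>"
    and Wu: "W_space a q \<Omega> u ut ux" and Wv: "W_space a q \<Omega> v vt vx"
  obtains w where "\<And>k::nat. smooth_on \<Omega> (w k)"
    "\<And>k. w k \<in> borel_measurable (lebesgue_on \<Omega>)"
    "\<And>k. time_deriv (w k) \<in> borel_measurable (lebesgue_on \<Omega>)"
    "\<And>k. space_grad (w k) \<in> borel_measurable (lebesgue_on \<Omega>)"
    "\<And>k. integrable (lebesgue_on \<Omega>) (\<lambda>z. \<bar>time_deriv (w k) z - (ut z - vt z)\<bar>)"
    "(\<lambda>k. LINT z|lebesgue_on \<Omega>. \<bar>time_deriv (w k) z - (ut z - vt z)\<bar>) \<longlonglongrightarrow> 0"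
    "\<And>k. integrable (lebesgue_on \<Omega>) (\<lambda>z. aform (a z) (space_grad (w k) z - (ux z - vx z)) (space_grad (w k) z - (ux z - vx z)))"
    "(\<lambda>k. LINT z|lebesgue_on \<Omega>. aform (a z) (space_grad (w k) z - (ux z - vx z)) (space_grad (w k) z - (ux z - vx z))) \<longlonglongrightarrow> 0"
    "\<And>k. integrable (lebesgue_on \<Omega>) (\<lambda>z. \<bar>w k z - (u z - v z)\<bar>)"
    "(\<lambda>k. LINT z|lebesgue_on \<Omega>. \<bar>w k z - (u z - v z)\<bar>) \<longlonglongrightarrow> 0"
    "AE z in lebesgue_on \<Omega>. (\<lambda>k. w k z) \<longlonglongrightarrow> u z - v z"
proof -
  let ?M = "lebesgue_on \<Omega>"
  interpret finite_measure ?M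
    by (rule finite_measure_lebesgue_on_bounded) (use \<Omega> in auto)
  obtain f where f: "\<And>k::nat. smooth_on \<Omega> (f k)"
    "\<And>k. W_finite a q \<Omega> (f k) (time_deriv (f k)) (space_grad (f k))"
    "\<And>k. integrable ?M (\<lambda>z. \<bar>time_deriv (f k) z - ut z\<bar>)"
    "(\<lambda>k. LINT z|?M. \<bar>time_deriv (f k) z - ut z\<bar>) \<longlonglongrightarrow> 0"
    "\<And>k. integrable ?M (\<lambda>z. aform (a z) (space_grad (f k) z - ux z) (space_grad (f k) z - ux z))"
    "(\<lambda>k. LINT z|?M. aform (a z) (space_grad (f k) z - ux z) (space_grad (f k) z - ux z)) \<longlonglongrightarrow> 0"
    "\<And>k. integrable ?M (\<lambda>z. \<bar>f k z - u z\<bar> powr q)"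
    "(\<lambda>k. LINT z|?M. \<bar>f k z - u z\<bar> powr q) \<longlonglongrightarrow> 0"
    using W_space_approx[OF assms(1) am psd Wu] by blast
  obtain g where g: "\<And>k::nat. smooth_on \<Omega> (g k)"
    "\<And>k. W_finite a q \<Omega> (g k) (time_deriv (g k)) (space_grad (g k))"
    "\<And>k. integrable ?M (\<lambda>z. \<bar>time_deriv (g k) z - vt z\<bar>)"
    "(\<lambda>k. LINT z|?M. \<bar>time_deriv (g k) z - vt z\<bar>) \<longlonglongrightarrow> 0"
    "\<And>k. integrable ?M (\<lambda>z. aform (a z) (space_grad (g k) z - vx z) (space_grad (g k) z - vx z))"
    "(\<lambda>k. LINT z|?M. aform (a z) (space_grad (g k) z - vx z) (space_grad (g k) z - vx z)) \<longlonglongrightarrow> 0"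
    "\<And>k. integrable ?M (\<lambda>z. \<bar>g k z - v z\<bar> powr q)"
    "(\<lambda>k. LINT z|?M. \<bar>g k z - v z\<bar> powr q) \<longlonglongrightarrow> 0"
    using W_space_approx[OF assms(1) am psd Wv] by blast
  have [measurable]: "u \<in> borel_measurable ?M" "ut \<in> borel_measurable ?M" "ux \<in> borel_measurable ?M"
    "v \<in> borel_measurable ?M" "vt \<in> borel_measurable ?M" "vx \<in> borel_measurable ?M"
    "f k \<in> borel_measurable ?M" "time_deriv (f k) \<in> borel_measurable ?M"
    "space_grad (f k) \<in> borel_measurable ?M"
    "g k \<in> borel_measurable ?M" "time_deriv (g k) \<in> borel_measurable ?M"
    "space_grad (g k) \<in> borel_measurable ?M" for k
    using f(2)[of k] g(2)[of k] Wu Wv unfolding W_finite_def W_space_def by auto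
  define w where "w k z = f k z - g k z" for k z
  have sm: "smooth_on \<Omega> (w k)" for k
    unfolding w_def[abs_def] by (intro smooth_on_diff \<Omega> f g)
  have td: "time_deriv (w k) z = time_deriv (f k) z - time_deriv (g k) z"
    and sg: "space_grad (w k) z = space_grad (f k) z - space_grad (g k) z" if "z \<in> \<Omega>" for k z
    unfolding w_def[abs_def] using time_deriv_diff[OF f(1) g(1) that] space_grad_diff[OF f(1) g(1) that] by auto
  have wm [measurable]: "w k \<in> borel_measurable ?M" for k
    unfolding w_def[abs_def] by measurable
  have tm [measurable]: "time_deriv (w k) \<in> borel_measurable ?M" for k
    by (subst measurable_cong[OF td]) (auto simp: space_restrict_space)
  have gm [measurable]: "space_grad (w k) \<in> borel_measurable ?M" for k
    by (subst measurable_cong[OF sg]) (auto simp: space_restrict_space)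

  have ti: "integrable ?M (\<lambda>z. \<bar>time_deriv (w k) z - (ut z - vt z)\<bar>)"
    and tb: "(LINT z|?M. \<bar>time_deriv (w k) z - (ut z - vt z)\<bar>)
      \<le> (LINT z|?M. \<bar>time_deriv (f k) z - ut z\<bar>) + (LINT z|?M. \<bar>time_deriv (g k) z - vt z\<bar>)" for k
  proof -
    let ?B = "\<lambda>z. \<bar>time_deriv (f k) z - ut z\<bar> + \<bar>time_deriv (g k) z - vt z\<bar>"
    have B: "integrable ?M ?B"
      by (intro Bochner_Integration.integrable_add f g)
    have le: "AE z in ?M. \<bar>time_deriv (w k) z - (ut z - vt z)\<bar> \<le> ?B z"
      by (intro AE_I2) (auto simp: td space_restrict_space)
    show i: "integrable ?M (\<lambda>z. \<bar>time_deriv (w k) z - (ut z - vt z)\<bar>)"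
      by (rule Bochner_Integration.integrable_bound[OF B]) (use le in auto)
    show "(LINT z|?M. \<bar>time_deriv (w k) z - (ut z - vt z)\<bar>)
      \<le> (LINT z|?M. \<bar>time_deriv (f k) z - ut z\<bar>) + (LINT z|?M. \<bar>time_deriv (g k) z - vt z\<bar>)"
      using integral_mono_AE[OF i B le] f(3) g(3) by simp
  qed
  have t0: "(\<lambda>k. LINT z|?M. \<bar>time_deriv (w k) z - (ut z - vt z)\<bar>) \<longlonglongrightarrow> 0"
    by (rule tendsto_sandwich[OF _ _ tendsto_const tendsto_add_zero[OF f(4) g(4)]]) (auto simp: tb)

  let ?Q = "\<lambda>k z. aform (a z) (space_grad (w k) z - (ux z - vx z)) (space_grad (w k) z - (ux z - vx z))"
  have xi: "integrable ?M (?Q k)" and xn: "0 \<le> integral\<^sup>L ?M (?Q k)"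
    and xb: "integral\<^sup>L ?M (?Q k)
      \<le> 2 * (LINT z|?M. aform (a z) (space_grad (f k) z - ux z) (space_grad (f k) z - ux z))
       + 2 * (LINT z|?M. aform (a z) (space_grad (g k) z - vx z) (space_grad (g k) z - vx z))" for k
  proof -
    let ?B = "\<lambda>z. 2 * aform (a z) (space_grad (f k) z - ux z) (space_grad (f k) z - ux z)
       + 2 * aform (a z) (space_grad (g k) z - vx z) (space_grad (g k) z - vx z)"
    have B: "integrable ?M ?B"
      by (intro Bochner_Integration.integrable_add integrable_mult_right f g)
    have "AE z in ?M. z \<in> \<Omega>"
      by (rule AE_I2) (simp add: space_restrict_space)
    with psd have le: "AE z in ?M. 0 \<le> ?Q k z \<and> ?Q k z \<le> ?B z"
    proof eventually_elim
      case (elim z)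
      have eq: "space_grad (w k) z - (ux z - vx z) = (space_grad (f k) z - ux z) - (space_grad (g k) z - vx z)"
        using sg[of z k] elim by simp
      show ?case
        unfolding eq using elim aform_diff_le[of "a z"] by blast
    qed
    have [measurable]: "?Q k \<in> borel_measurable ?M"
      by (intro borel_measurable_aform am) measurable
    show i: "integrable ?M (?Q k)"
      by (rule Bochner_Integration.integrable_bound[OF B]) (use le in auto)
    show "0 \<le> integral\<^sup>L ?M (?Q k)"
      by (rule integral_nonneg_AE) (use le in auto)
    have "integral\<^sup>L ?M (?Q k) \<le> integral\<^sup>L ?M ?B"
      by (rule integral_mono_AE[OF i B]) (use le in auto)
    then show "integral\<^sup>L ?M (?Q k)
      \<le> 2 * (LINT z|?M. aform (a z) (space_grad (f k) z - ux z) (space_grad (f k) z - ux z))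
       + 2 * (LINT z|?M. aform (a z) (space_grad (g k) z - vx z) (space_grad (g k) z - vx z))"
      using f(5)[of k] g(5)[of k] by simp
  qed
  have x0: "(\<lambda>k. integral\<^sup>L ?M (?Q k)) \<longlonglongrightarrow> 0"
    by (rule tendsto_sandwich[OF _ _ tendsto_const tendsto_add_zero[OF
          tendsto_mult_right_zero[OF f(6), of 2] tendsto_mult_right_zero[OF g(6), of 2]]])
       (use xn xb in auto)

  let ?D = "\<lambda>k z. \<bar>w k z - (u z - v z)\<bar>"
  let ?P = "\<lambda>k z. \<bar>f k z - u z\<bar> powr q + \<bar>g k z - v z\<bar> powr q"
  have P: "integrable ?M (?P k)" for k
    by (intro Bochner_Integration.integrable_add f g)
  have Dle: "?D k z \<le> e * 2 + e powr (1 - q) * ?P k z" if "0 < e" for e k z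
    using abs_le_eps_powr[OF assms(1) that, of "f k z - u z"] abs_le_eps_powr[OF assms(1) that, of "g k z - v z"]
    by (auto simp: w_def algebra_simps)
  have Pe: "integrable ?M (\<lambda>z. e * 2 + e powr (1 - q) * ?P k z)" for e k
    by (rule Bochner_Integration.integrable_add[OF integrable_const integrable_mult_right[OF P]])
  have di: "integrable ?M (?D k)" for k
    by (rule Bochner_Integration.integrable_bound[OF Pe[of 1 k]])
       (use Dle[of 1 k] in \<open>simp_all add: order_trans[OF _ abs_ge_self]\<close>)
  have db: "integral\<^sup>L ?M (?D k) \<le> e * (2 * measure ?M (space ?M)) + e powr (1 - q) * integral\<^sup>L ?M (?P k)"
    if "0 < e" for e k
  proof -
    have "integral\<^sup>L ?M (?D k) \<le> (LINT z|?M. e * 2 + e powr (1 - q) * ?P k z)"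
      by (rule integral_mono[OF di Pe]) (rule Dle[OF that])
    also have "\<dots> = (LINT z|?M. e * 2) + (LINT z|?M. e powr (1 - q) * ?P k z)"
      by (rule Bochner_Integration.integral_add[OF integrable_const integrable_mult_right[OF P]])
    also have "\<dots> = e * (2 * measure ?M (space ?M)) + e powr (1 - q) * integral\<^sup>L ?M (?P k)"
      by simp
    finally show ?thesis .
  qed
  have "(\<lambda>k. integral\<^sup>L ?M (?P k)) \<longlonglongrightarrow> 0"
    using tendsto_add_zero[OF f(8) g(8)] f(7) g(7) by simp
  then have d0: "(\<lambda>k. integral\<^sup>L ?M (?D k)) \<longlonglongrightarrow> 0"
    by (rule tendsto_0_of_le_eps[OF _ _ _ db]) auto
  have wi: "integrable ?M (\<lambda>z. w k z - (u z - v z))" for k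
    using di[of k] by (subst (asm) integrable_abs_iff) auto
  obtain r where r: "strict_mono r" "AE z in ?M. (\<lambda>k. w (r k) z - (u z - v z)) \<longlonglongrightarrow> 0"
    using tendsto_L1_AE_subseq[of ?M "\<lambda>k z. w k z - (u z - v z)", OF wi] d0
    unfolding real_norm_def by blast
  have "AE z in ?M. (\<lambda>k. w (r k) z) \<longlonglongrightarrow> u z - v z"
    using r(2) by eventually_elim (rule Lim_null[THEN iffD2])
  then show thesis
    by (rule that[of "\<lambda>k. w (r k)", OF sm wm tm gm ti LIMSEQ_subseq_LIMSEQ[OF t0 r(1), unfolded o_def]
          xi LIMSEQ_subseq_LIMSEQ[OF x0 r(1), unfolded o_def]
          di LIMSEQ_subseq_LIMSEQ[OF d0 r(1), unfolded o_def]])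
qed

section \<open>Testing with a function of the solution\<close>

lemma smooth_on_continuous_derivs:
  fixes f :: "real \<times> (real^'n) \<Rightarrow> real"
  assumes "smooth_on S f"
  shows "continuous_on S f" "continuous_on S (time_deriv f)" "continuous_on S (space_grad f)"
proof -
  have 0: "Ck_on 0 S f" and 1: "Ck_on (Suc 0) S f"
    using assms unfolding smooth_on_def by blast+
  show "continuous_on S f"
    using 0 by simp
  have b: "(1, 0) \<in> (Basis :: (real \<times> (real^'n)) set)" "(0, axis i 1) \<in> (Basis :: (real \<times> (real^'n)) set)" for i
    by (auto simp: Basis_prod_def Basis_vec_def)
  show "continuous_on S (time_deriv f)"
    using 1 b(1) by (simp add: time_deriv_def[abs_def])
  show "continuous_on S (space_grad f)"
    using 1 b(2) by (simp add: space_grad_def[abs_def] continuous_on_vec_lambda)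
qed

lemma derivs_eq_0_outside:
  fixes f :: "real \<times> (real^'n) \<Rightarrow> real"
  assumes "closed K" and "\<And>z. z \<notin> K \<Longrightarrow> f z = 0" and "z \<notin> K"
  shows "time_deriv f z = 0" "space_grad f z = 0"
proof -
  have "(f has_derivative (\<lambda>y. 0)) (at z)"
    by (rule has_derivative_transform_within_open[OF has_derivative_const, of "- K" z 0])
       (use assms in auto)
  from space_grad_time_deriv_has_derivative[OF this]
  show "time_deriv f z = 0" "space_grad f z = 0"
    by (simp_all add: vec_eq_iff)
qed

lemma space_grad_add_scaleR:
  fixes z :: "real \<times> (real^'n)"
  assumes "(f has_derivative (\<lambda>y. c * frechet_derivative g (at z) y + d * frechet_derivative k (at z) y)) (at z)"
  shows "space_grad f z = c *\<^sub>R space_grad g z + d *\<^sub>R space_grad k z"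
  using space_grad_time_deriv_has_derivative(2)[OF assms] by (simp add: space_grad_def vec_eq_iff)

lemma has_time_deriv:
  fixes f :: "real \<times> (real^'n) \<Rightarrow> real"
  assumes "(f has_derivative D) (at (t, x))"
  shows "((\<lambda>t. f (t, x)) has_real_derivative time_deriv f (t, x)) (at t)"
proof -
  have "((\<lambda>t. (t, x)) has_derivative (\<lambda>s. (s, 0))) (at t)"
    by (rule has_derivative_Pair[OF has_derivative_ident has_derivative_const])
  from has_derivative_compose[OF this assms]
  have d: "((\<lambda>t. f (t, x)) has_derivative (\<lambda>s. D (s, 0))) (at t)" .
  have "D (s, 0) = D (1, 0) * s" for s
    using linear_cmul[OF has_derivative_linear[OF assms], of s "(1, 0)"] by simp
  then have "(\<lambda>s. D (s, 0)) = (*) (time_deriv f (t, x))"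
    unfolding space_grad_time_deriv_has_derivative(1)[OF assms] by (intro ext)
  with d show ?thesis
    unfolding has_field_derivative_def by (simp only:)
qed

text \<open>\<open>h\<close> is the nonlinear factor of the test function, and \<open>H\<close>
  enters because h(w) w_t is the time derivative of H(w). \<open>h_smooth\<close> is a closure
  property since test functions must be smooth of all orders, and the bounds are required on the
  whole real line since approximations of a non-negative function may be negative.\<close>

locale test_data =
  fixes \<Omega> K :: "(real \<times> (real^'n)) set" and \<zeta> :: "real \<times> (real^'n) \<Rightarrow> real"
    and h h' H :: "real \<Rightarrow> real" and B :: real
  assumes \<Omega>: "open \<Omega>" "bounded \<Omega>" "\<Omega> \<subseteq> half_space" and K: "compact K" "K \<subseteq> \<Omega>"
    and \<zeta>: "smooth_on UNIV \<zeta>" "\<And>z. 0 \<le> \<zeta> z" "\<And>z. z \<notin> K \<Longrightarrow> \<zeta> z = 0"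
    and h_smooth: "\<And>(S :: (real \<times> (real^'n)) set) f. open S \<Longrightarrow> smooth_on S f \<Longrightarrow> smooth_on S (\<lambda>z. h (f z))"
    and h_deriv: "\<And>s. (h has_real_derivative h' s) (at s)" and h'_cont: "continuous_on UNIV h'"
    and h_bound: "\<And>s. 0 \<le> h s" "\<And>s. h s \<le> B" "\<And>s. \<bar>h' s\<bar> \<le> B"
    and H_deriv: "\<And>s. (H has_real_derivative h s) (at s)"
begin

lemma closed_K: "closed K"
  using K compact_imp_closed by blast

lemma B_nonneg: "0 \<le> B"
  using h_bound[of 0] by linarith

lemma measurable_h [measurable]:
  "h \<in> borel_measurable borel" "h' \<in> borel_measurable borel" "H \<in> borel_measurable borel"
  using h_deriv H_deriv
  by (auto intro!: borel_measurable_continuous_onI h'_cont continuous_at_imp_continuous_on DERIV_isCont)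

lemma measurable_\<zeta> [measurable]:
  "\<zeta> \<in> borel_measurable (lebesgue_on \<Omega>)" "time_deriv \<zeta> \<in> borel_measurable (lebesgue_on \<Omega>)"
  "space_grad \<zeta> \<in> borel_measurable (lebesgue_on \<Omega>)"
  using smooth_on_continuous_derivs[OF smooth_on_subset[OF \<zeta>(1), of \<Omega>]] \<Omega>
  by (auto intro!: continuous_imp_measurable_on_sets_lebesgue)

lemma \<zeta>_derivs_outside: "z \<notin> K \<Longrightarrow> time_deriv \<zeta> z = 0" "z \<notin> K \<Longrightarrow> space_grad \<zeta> z = 0"
  using derivs_eq_0_outside[OF closed_K \<zeta>(3)] by auto

lemma \<zeta>_bounds:
  obtains C where "0 \<le> C" "\<And>z. \<bar>\<zeta> z\<bar> \<le> C" "\<And>z. \<bar>time_deriv \<zeta> z\<bar> \<le> C" "\<And>z. norm (space_grad \<zeta> z) \<le> C"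
proof -
  have "bounded (\<zeta> ` K)" "bounded (time_deriv \<zeta> ` K)" "bounded (space_grad \<zeta> ` K)"
    using smooth_on_continuous_derivs[OF smooth_on_subset[OF \<zeta>(1), of K]] K
    by (auto intro!: compact_imp_bounded compact_continuous_image)
  then obtain C1 C2 C3 where C: "\<forall>z\<in>K. norm (\<zeta> z) \<le> C1" "\<forall>z\<in>K. norm (time_deriv \<zeta> z) \<le> C2"
      "\<forall>z\<in>K. norm (space_grad \<zeta> z) \<le> C3" "C1 > 0" "C2 > 0" "C3 > 0"
    unfolding bounded_pos by auto
  show thesis
  proof (rule that[of "C1 + C2 + C3"])
    show "\<bar>\<zeta> z\<bar> \<le> C1 + C2 + C3" "\<bar>time_deriv \<zeta> z\<bar> \<le> C1 + C2 + C3" "norm (space_grad \<zeta> z) \<le> C1 + C2 + C3" for z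
      using C \<zeta>(3)[of z] \<zeta>_derivs_outside[of z] by (cases "z \<in> K"; fastforce)+
  qed (use C in auto)
qed

text \<open>Extended by zero, because \<open>w\<close> is controlled only on \<open>\<Omega>\<close>
  whereas a test function lives on the whole half-space.\<close>

definition test_fun :: "(real \<times> (real^'n) \<Rightarrow> real) \<Rightarrow> real \<times> (real^'n) \<Rightarrow> real" where
  "test_fun w z = (if z \<in> \<Omega> then h (w z) * \<zeta> z else 0)"

lemma test_fun_eq_0: "z \<notin> K \<Longrightarrow> test_fun w z = 0"
  by (simp add: test_fun_def \<zeta>)

lemma test_fun_nonneg: "0 \<le> test_fun w z"
  by (simp add: test_fun_def \<zeta> h_bound)

text \<open>Glued from the open cover by \<open>\<Omega>\<close>, where it is a smooth product, and
  \<open>half_space - K\<close>, where it vanishes.\<close>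

lemma test_function_test_fun:
  assumes "smooth_on \<Omega> w"
  shows "test_function (test_fun w)"
proof -
  have "smooth_on \<Omega> (\<lambda>z. h (w z) * \<zeta> z)"
    by (intro smooth_on_mult h_smooth \<Omega> assms smooth_on_subset[OF \<zeta>(1)]) auto
  then have 1: "smooth_on \<Omega> (test_fun w)"
    by (rule smooth_on_cong[OF \<Omega>(1)]) (simp add: test_fun_def)
  have sm0: "smooth_on (half_space - K) (test_fun w)"
    by (rule smooth_on_cong[OF _ smooth_on_const[of _ 0]])
       (auto simp: test_fun_eq_0 open_Diff open_half_space closed_K)
  have "smooth_on half_space (test_fun w)"
  proof -
    have "\<Omega> \<union> (half_space - K) = half_space"
      using K \<Omega>(3) by auto
    then show ?thesis
      using smooth_on_Un[OF \<Omega>(1) _ 1 sm0] by (simp add: open_Diff open_half_space closed_K)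
  qed
  moreover have "closure {z \<in> half_space. test_fun w z \<noteq> 0} \<subseteq> K"
    by (rule closure_minimal[OF _ closed_K]) (use test_fun_eq_0 in auto)
  moreover from this have "compact (closure {z \<in> half_space. test_fun w z \<noteq> 0})"
    using K(1) by (meson bounded_subset closed_closure compact_eq_bounded_closed)
  ultimately show ?thesis
    using K \<Omega> by (auto simp: test_function_def)
qed

lemma space_grad_test_fun:
  assumes "smooth_on \<Omega> w" "z \<in> \<Omega>"
  shows "space_grad (test_fun w) z = h (w z) *\<^sub>R space_grad \<zeta> z + (h' (w z) * \<zeta> z) *\<^sub>R space_grad w z"
proof -
  have w: "(w has_derivative frechet_derivative w (at z)) (at z)"
    by (rule smooth_on_has_derivative[OF assms])
  have "((\<lambda>z. h (w z)) has_derivative (\<lambda>y. h' (w z) * frechet_derivative w (at z) y)) (at z)"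
    using has_derivative_compose[OF w, of h "(*) (h' (w z))"] h_deriv[of "w z"]
    by (simp add: has_field_derivative_def)
  from has_derivative_mult[OF this smooth_on_has_derivative[OF \<zeta>(1)]]
  have "((\<lambda>z. h (w z) * \<zeta> z) has_derivative (\<lambda>y. h (w z) * frechet_derivative \<zeta> (at z) y +
      (h' (w z) * \<zeta> z) * frechet_derivative w (at z) y)) (at z)"
    by (simp add: mult_ac)
  then have "(test_fun w has_derivative (\<lambda>y. h (w z) * frechet_derivative \<zeta> (at z) y +
      (h' (w z) * \<zeta> z) * frechet_derivative w (at z) y)) (at z)"
    by (rule has_derivative_transform_within_open[OF _ \<Omega>(1) assms(2)]) (simp add: test_fun_def)
  then show ?thesis
    by (rule space_grad_add_scaleR)
qed

text \<open>The integrand is the time derivative of \<open>H (w z) * \<zeta> z\<close>, whose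
  extension by zero has compact support. Time derivatives are thereby moved from \<open>w\<close> to
  the cutoff.\<close>

lemma integration_by_parts:
  assumes "smooth_on \<Omega> w"
  shows "(LINT z|lebesgue_on \<Omega>. h (w z) * \<zeta> z * time_deriv w z + H (w z) * time_deriv \<zeta> z) = 0"
proof -
  define G where "G z = (if z \<in> \<Omega> then H (w z) * \<zeta> z else 0)" for z
  define G' where "G' z = (if z \<in> \<Omega> then h (w z) * \<zeta> z * time_deriv w z + H (w z) * time_deriv \<zeta> z else 0)" for z
  have G'0: "G' z = 0" if "z \<notin> K" for z
    using that by (simp add: G'_def \<zeta> \<zeta>_derivs_outside)
  have hc: "continuous_on UNIV h" "continuous_on UNIV H"
    using h_deriv H_deriv by (auto intro!: continuous_at_imp_continuous_on DERIV_isCont)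
  have "continuous_on \<Omega> (\<lambda>z. h (w z) * \<zeta> z * time_deriv w z + H (w z) * time_deriv \<zeta> z)"
    using smooth_on_continuous_derivs[OF assms] smooth_on_continuous_derivs[OF smooth_on_subset[OF \<zeta>(1), of \<Omega>]]
    by (intro continuous_intros continuous_on_compose2[OF hc(1)] continuous_on_compose2[OF hc(2)]) auto
  then have "continuous_on \<Omega> G'"
    by (simp add: G'_def cong: continuous_on_cong)
  moreover have "continuous_on (- K) G'"
    by (rule continuous_on_eq[OF continuous_on_const[of _ 0]]) (simp add: G'0)
  ultimately have "continuous_on (\<Omega> \<union> - K) G'"
    using \<Omega>(1) closed_K by (intro continuous_on_open_Un) auto
  moreover have "\<Omega> \<union> - K = UNIV"
    using K by auto
  ultimately have cont: "continuous_on UNIV G'" by simp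
  have "((\<lambda>t. G (t, x)) has_real_derivative G' (t, x)) (at t)" for t x
  proof (cases "(t, x) \<in> \<Omega>")
    case True
    note wd = has_time_deriv[OF smooth_on_has_derivative[OF assms True]]
    note zd = has_time_deriv[OF smooth_on_has_derivative[OF \<zeta>(1), of "(t, x)"], simplified]
    have d: "((\<lambda>t. H (w (t, x)) * \<zeta> (t, x)) has_real_derivative G' (t, x)) (at t)"
      by (rule DERIV_cong[OF DERIV_mult[OF DERIV_chain2[OF H_deriv wd] zd]])
         (use True in \<open>simp add: G'_def algebra_simps\<close>)
    have o: "open ((\<lambda>t. (t, x)) -` \<Omega>)"
      by (intro continuous_open_vimage \<Omega> continuous_intros) 
    show ?thesis
      by (rule has_field_derivative_transform_within_open[OF d o]) (use True in \<open>auto simp: G_def\<close>)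
  next
    case False
    then have "(t, x) \<notin> K" using K by auto
    have d: "((\<lambda>t. 0) has_real_derivative G' (t, x)) (at t)"
      using G'0[OF \<open>(t, x) \<notin> K\<close>] by simp
    have o: "open ((\<lambda>t. (t, x)) -` (- K))"
      using closed_K by (intro continuous_open_vimage continuous_intros) auto
    show ?thesis
      by (rule has_field_derivative_transform_within_open[OF d o])
         (use \<open>(t, x) \<notin> K\<close> in \<open>auto simp: G_def \<zeta>\<close>)
  qed
  then have "integral\<^sup>L lebesgue G' = 0"
    by (rule integral_partial_derivative_eq_0[OF cont K(1)]) (auto simp: G_def \<zeta> G'0)
  then have "integral\<^sup>L (lebesgue_on UNIV) G' = 0"
    by (simp only: lebesgue_on_UNIV_eq)
  then have "integral\<^sup>L (lebesgue_on \<Omega>) G' = 0"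
    using integral_lebesgue_on_support[of \<Omega> UNIV G'] \<Omega>(1) by (auto simp: G'_def)
  then show ?thesis
    by (subst (asm) Bochner_Integration.integral_cong[OF refl, of _ G'])
       (auto simp: G'_def space_restrict_space)
qed

end

text \<open>The integrated Young inequality stands in for Cauchy-Schwarz in the weighted L^2 space.
  The free parameter \<open>e\<close> separates a factor of vanishing energy from one of bounded
  energy.\<close>

lemma integrable_aform:
  assumes am: "\<And>i j. (\<lambda>z. a z $ i $ j) \<in> borel_measurable M"
    and sym: "AE z in M. \<forall>i j. a z $ i $ j = a z $ j $ i" and psd: "AE z in M. \<forall>\<xi>. 0 \<le> aform (a z) \<xi> \<xi>"
    and "\<xi> \<in> borel_measurable M" "\<eta> \<in> borel_measurable M"
    and "integrable M (\<lambda>z. aform (a z) (\<xi> z) (\<xi> z))" "integrable M (\<lambda>z. aform (a z) (\<eta> z) (\<eta> z))"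
  shows "integrable M (\<lambda>z. aform (a z) (\<xi> z) (\<eta> z))"
    and "0 < e \<Longrightarrow> (LINT z|M. \<bar>aform (a z) (\<xi> z) (\<eta> z)\<bar>)
      \<le> (LINT z|M. aform (a z) (\<xi> z) (\<xi> z)) / e + e * (LINT z|M. aform (a z) (\<eta> z) (\<eta> z))"
proof -
  have m: "(\<lambda>z. aform (a z) (\<xi> z) (\<eta> z)) \<in> borel_measurable M"
    by (intro borel_measurable_aform assms)
  have B: "integrable M (\<lambda>z. aform (a z) (\<xi> z) (\<xi> z) / e + e * aform (a z) (\<eta> z) (\<eta> z))" for e
    by (intro Bochner_Integration.integrable_add integrable_mult_right integrable_divide assms)
  have le: "AE z in M. \<bar>aform (a z) (\<xi> z) (\<eta> z)\<bar> \<le> aform (a z) (\<xi> z) (\<xi> z) / e + e * aform (a z) (\<eta> z) (\<eta> z)"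
    if "0 < e" for e
    using sym psd
  proof eventually_elim
    case (elim z)
    then show ?case
      using aform_young[of "a z" e "\<xi> z" "\<eta> z"] that by auto
  qed
  show i: "integrable M (\<lambda>z. aform (a z) (\<xi> z) (\<eta> z))"
  proof (rule Bochner_Integration.integrable_bound[OF B[of 1] m])
    show "AE z in M. norm (aform (a z) (\<xi> z) (\<eta> z))
        \<le> norm (aform (a z) (\<xi> z) (\<xi> z) / 1 + 1 * aform (a z) (\<eta> z) (\<eta> z))"
      using le[OF zero_less_one] by eventually_elim (unfold real_norm_def, linarith)
  qed
  have "integrable M (\<lambda>z. \<bar>aform (a z) (\<xi> z) (\<eta> z)\<bar>)"
    using i by (rule Bochner_Integration.integrable_abs)
  from integral_mono_AE[OF this B le]
  show "(LINT z|M. \<bar>aform (a z) (\<xi> z) (\<eta> z)\<bar>)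
      \<le> (LINT z|M. aform (a z) (\<xi> z) (\<xi> z)) / e + e * (LINT z|M. aform (a z) (\<eta> z) (\<eta> z))" if "0 < e"
    using that assms(6,7) by simp
qed

lemma integrable_signed_power:
  fixes u :: "'a \<Rightarrow> real"
  assumes "1 < q" "u \<in> borel_measurable M" "integrable M (\<lambda>z. \<bar>u z\<bar> powr q)"
  shows "integrable M (\<lambda>z. \<bar>u z\<bar> powr (q - 1) * u z)"
proof (rule Bochner_Integration.integrable_bound[OF assms(3)])
  show "AE z in M. norm (\<bar>u z\<bar> powr (q - 1) * u z) \<le> norm (\<bar>u z\<bar> powr q)"
    by (auto simp: abs_mult powr_mult_base[symmetric] powr_diff)
qed (use assms in measurable)

context test_data
begin

text \<open>Local boundedness of \<open>A\<close> enters here: on the compact set \<open>K\<close>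
  it gives the cutoff finite energy, also where the annulus condition says nothing.\<close>

lemma integrable_aform_space_grad_\<zeta>:
  assumes am: "\<And>i j. (\<lambda>z. a z $ i $ j) \<in> borel_measurable (lebesgue_on \<Omega>)"
    and upper: "AE z in lebesgue_on \<Omega>. \<forall>\<xi>. 0 \<le> aform (a z) \<xi> \<xi> \<and> aform (a z) \<xi> \<xi> \<le> A z * (norm \<xi>)\<^sup>2"
    and A: "locally_bounded_on half_space A"
  shows "integrable (lebesgue_on \<Omega>) (\<lambda>z. aform (a z) (space_grad \<zeta> z) (space_grad \<zeta> z))"
proof -
  interpret finite_measure "lebesgue_on \<Omega>"
    by (rule finite_measure_lebesgue_on_bounded) (use \<Omega> in auto)
  obtain C where C: "0 \<le> C" "\<And>z. norm (space_grad \<zeta> z) \<le> C"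
    using \<zeta>_bounds by metis
  have "bounded (A ` K)"
    using A K \<Omega> unfolding locally_bounded_on_def by blast
  then obtain D where D: "\<forall>z\<in>K. \<bar>A z\<bar> \<le> D" "D > 0"
    unfolding bounded_pos by auto
  have "AE z in lebesgue_on \<Omega>. norm (aform (a z) (space_grad \<zeta> z) (space_grad \<zeta> z)) \<le> D * C\<^sup>2"
    using upper
  proof eventually_elim
    case (elim z)
    show ?case
    proof (cases "z \<in> K")
      case True
      have "A z * (norm (space_grad \<zeta> z))\<^sup>2 \<le> D * C\<^sup>2"
        using bspec[OF D(1) True] C D(2) by (intro mult_mono power_mono) auto
      then show ?thesis
        using elim by (metis abs_of_nonneg order_trans real_norm_def)
    next
      case False
      then show ?thesis
        using \<zeta>_derivs_outside(2)[OF False] D(2) by (simp add: aform_def)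
    qed
  qed
  then show ?thesis
    by (rule integrable_const_bound) (intro borel_measurable_aform am measurable_\<zeta>)
qed

text \<open>The formal inequality for the test function h(w) \<zeta>, after integration by parts in
  time. It is proved for \<open>h (ws k) * \<zeta>\<close>, where the chain rule is available, and
  the limit is taken term by term: most terms are a bounded convergent factor times a fixed
  integrable function, and the two others, the gradient error and the time term, are treated
  separately.\<close>

lemma weak_inequality_limit:
  fixes u v ut vt :: "real \<times> (real^'n) \<Rightarrow> real"
  assumes q: "1 < q"
    and am: "\<And>i j. (\<lambda>z. a z $ i $ j) \<in> borel_measurable (lebesgue_on \<Omega>)"
    and sym: "AE z in lebesgue_on \<Omega>. \<forall>i j. a z $ i $ j = a z $ j $ i"
    and upper: "AE z in lebesgue_on \<Omega>. \<forall>\<xi>. 0 \<le> aform (a z) \<xi> \<xi> \<and> aform (a z) \<xi> \<xi> \<le> A z * (norm \<xi>)\<^sup>2"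
    and A: "locally_bounded_on half_space A"
    and Wu: "W_space a q \<Omega> u ut ux" and Wv: "W_space a q \<Omega> v vt vx"
    and weak: "\<And>\<phi>. test_function \<phi> \<Longrightarrow> (\<And>z. 0 \<le> \<phi> z) \<Longrightarrow>
      weak_functional a q v vt vx \<phi> \<le> weak_functional a q u ut ux \<phi>"
  defines "w \<equiv> \<lambda>z. u z - v z" and "wx \<equiv> \<lambda>z. ux z - vx z"
    and "N \<equiv> \<lambda>z. \<bar>u z\<bar> powr (q - 1) * u z - \<bar>v z\<bar> powr (q - 1) * v z"
  shows "integrable (lebesgue_on \<Omega>) (\<lambda>z. h (w z) * \<zeta> z * N z)" (is ?I1)
    and "integrable (lebesgue_on \<Omega>) (\<lambda>z. h (w z) * aform (a z) (space_grad \<zeta> z) (wx z)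
        + h' (w z) * \<zeta> z * aform (a z) (wx z) (wx z) - H (w z) * time_deriv \<zeta> z)" (is ?I2)
    and "(LINT z|lebesgue_on \<Omega>. h (w z) * \<zeta> z * N z) \<le>
       (LINT z|lebesgue_on \<Omega>. h (w z) * aform (a z) (space_grad \<zeta> z) (wx z)
        + h' (w z) * \<zeta> z * aform (a z) (wx z) (wx z) - H (w z) * time_deriv \<zeta> z)" (is ?I3)
proof -
  let ?M = "lebesgue_on \<Omega>"
  have mq: "max 1 q = q" using q by simp
  have psd: "AE z in ?M. \<forall>\<xi>. 0 \<le> aform (a z) \<xi> \<xi>"
    using upper by eventually_elim blast
  interpret finite_measure ?M
    by (rule finite_measure_lebesgue_on_bounded) (use \<Omega> in auto)
  obtain C where C: "0 \<le> C" "\<And>z. \<bar>\<zeta> z\<bar> \<le> C" "\<And>z. \<bar>time_deriv \<zeta> z\<bar> \<le> C"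
    using \<zeta>_bounds by metis
  have fu: "W_finite a q \<Omega> u ut ux" and fv: "W_finite a q \<Omega> v vt vx"
    using Wu Wv unfolding W_space_def by auto
  have [measurable]: "u \<in> borel_measurable ?M" "ut \<in> borel_measurable ?M" "ux \<in> borel_measurable ?M"
    "v \<in> borel_measurable ?M" "vt \<in> borel_measurable ?M" "vx \<in> borel_measurable ?M"
    using fu fv unfolding W_finite_def by auto
  have wm [measurable]: "w \<in> borel_measurable ?M" "wx \<in> borel_measurable ?M"
    unfolding w_def wx_def by measurable
  have Zm [measurable]: "space_grad \<zeta> \<in> borel_measurable ?M"
    by (rule measurable_\<zeta>)
  define wt where "wt z = ut z - vt z" for z
  obtain ws where ws0: "\<And>k::nat. smooth_on \<Omega> (ws k)"
    "\<And>k. ws k \<in> borel_measurable ?M"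
    "\<And>k. time_deriv (ws k) \<in> borel_measurable ?M"
    "\<And>k. space_grad (ws k) \<in> borel_measurable ?M"
    "\<And>k. integrable ?M (\<lambda>z. \<bar>time_deriv (ws k) z - (ut z - vt z)\<bar>)"
    "(\<lambda>k. LINT z|?M. \<bar>time_deriv (ws k) z - (ut z - vt z)\<bar>) \<longlonglongrightarrow> 0"
    "\<And>k. integrable ?M (\<lambda>z. aform (a z) (space_grad (ws k) z - (ux z - vx z)) (space_grad (ws k) z - (ux z - vx z)))"
    "(\<lambda>k. LINT z|?M. aform (a z) (space_grad (ws k) z - (ux z - vx z)) (space_grad (ws k) z - (ux z - vx z))) \<longlonglongrightarrow> 0"
    "\<And>k. integrable ?M (\<lambda>z. \<bar>ws k z - (u z - v z)\<bar>)"
    "(\<lambda>k. LINT z|?M. \<bar>ws k z - (u z - v z)\<bar>) \<longlonglongrightarrow> 0"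
    "AE z in ?M. (\<lambda>k. ws k z) \<longlonglongrightarrow> u z - v z"
    using W_space_diff_approx[OF q \<Omega>(1,2) am psd Wu Wv] by blast
  have "u z - v z = w z" "ux z - vx z = wx z" "ut z - vt z = wt z" for z
    by (simp_all add: w_def wx_def wt_def)
  note ws = ws0[unfolded this]
  note [measurable] = ws(2,3,4)

  have hZ: "\<bar>h s * \<zeta> z\<bar> \<le> B * C" "\<bar>h' s * \<zeta> z\<bar> \<le> B * C" for s z
    unfolding abs_mult by (intro mult_mono C(2); use h_bound C(1) B_nonneg in simp)+
  have hB: "\<bar>h s\<bar> \<le> B" for s
    using h_bound by simp

  have iut: "integrable ?M ut" "integrable ?M vt"
    using fu fv unfolding W_finite_def by (auto simp: integrable_abs_iff)
  then have iwt: "integrable ?M wt"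
    unfolding wt_def by simp
  have iq: "integrable ?M (\<lambda>z. \<bar>u z\<bar> powr (q - 1) * u z)" "integrable ?M (\<lambda>z. \<bar>v z\<bar> powr (q - 1) * v z)"
    using fu fv unfolding W_finite_def mq by (auto intro!: integrable_signed_power q)
  then have iN: "integrable ?M N"
    unfolding N_def by simp
  have iQu: "integrable ?M (\<lambda>z. aform (a z) (ux z) (ux z))" "integrable ?M (\<lambda>z. aform (a z) (vx z) (vx z))"
    using fu fv unfolding W_finite_def by auto
  have iZ: "integrable ?M (\<lambda>z. aform (a z) (space_grad \<zeta> z) (space_grad \<zeta> z))"
    by (rule integrable_aform_space_grad_\<zeta>[OF am upper A])
  note cs = integrable_aform(1)[OF am sym psd]
  have iZu: "integrable ?M (\<lambda>z. aform (a z) (space_grad \<zeta> z) (ux z))"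
    and iZv: "integrable ?M (\<lambda>z. aform (a z) (space_grad \<zeta> z) (vx z))"
    by (rule cs; (rule iZ iQu | measurable))+
  have iZw: "integrable ?M (\<lambda>z. aform (a z) (space_grad \<zeta> z) (wx z))"
    unfolding wx_def aform_diff_right by (rule Bochner_Integration.integrable_diff[OF iZu iZv])
  have iuv: "integrable ?M (\<lambda>z. aform (a z) (ux z) (vx z))" "integrable ?M (\<lambda>z. aform (a z) (vx z) (ux z))"
    by (rule cs; (rule iQu | measurable))+
  have iQw: "integrable ?M (\<lambda>z. aform (a z) (wx z) (wx z))"
    unfolding wx_def aform_diff_right aform_diff_left
    by (intro Bochner_Integration.integrable_diff iQu iuv)
  \<comment> \<open>Writing \<open>space_grad (ws k)\<close> as \<open>?d k\<close> plus
    \<open>wx\<close> confines the dependence of the gradient on k to one error term,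
    \<open>I4\<close> below.\<close>
  let ?d = "\<lambda>k z. space_grad (ws k) z - wx z"
  have dm [measurable]: "?d k \<in> borel_measurable ?M" for k
    by measurable
  have idw: "integrable ?M (\<lambda>z. aform (a z) (?d k z) (wx z))"
    and idu: "integrable ?M (\<lambda>z. aform (a z) (?d k z) (ux z))"
    and idv: "integrable ?M (\<lambda>z. aform (a z) (?d k z) (vx z))"
    and iwu: "integrable ?M (\<lambda>z. aform (a z) (wx z) (ux z))"
    and iwv: "integrable ?M (\<lambda>z. aform (a z) (wx z) (vx z))" for k
    by (rule cs; (rule ws(7) iQu iQw | measurable))+

  define \<phi> where "\<phi> k = test_fun (ws k)" for k
  have \<phi>: "\<phi> k z = h (ws k z) * \<zeta> z"
    and \<phi>g: "space_grad (\<phi> k) z = h (ws k z) *\<^sub>R space_grad \<zeta> z + (h' (ws k z) * \<zeta> z) *\<^sub>R space_grad (ws k) z"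
    if "z \<in> \<Omega>" for k z
    unfolding \<phi>_def using space_grad_test_fun[OF ws(1) that] that by (simp_all add: test_fun_def)
  have wf: "weak_functional a q f ft fx (\<phi> k) =
      (LINT z|?M. h (ws k z) * \<zeta> z * ft z + h (ws k z) * aform (a z) (space_grad \<zeta> z) (fx z)
        + h' (ws k z) * \<zeta> z * (aform (a z) (?d k z) (fx z) + aform (a z) (wx z) (fx z))
        - h (ws k z) * \<zeta> z * (\<bar>f z\<bar> powr (q - 1) * f z))" for f ft fx k
  proof -
    have "\<phi> k z = 0 \<and> space_grad (\<phi> k) z = 0" if "z \<notin> \<Omega>" for z
    proof -
      have "z \<notin> K"
        using that K by auto
      then show ?thesis
        unfolding \<phi>_def
        by (intro conjI test_fun_eq_0 derivs_eq_0_outside(2)[OF closed_K, of "test_fun (ws k)"])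
    qed
    then have "weak_functional a q f ft fx (\<phi> k) =
      (LINT z|?M. ft z * \<phi> k z + aform (a z) (space_grad (\<phi> k) z) (fx z) - \<bar>f z\<bar> powr (q - 1) * f z * \<phi> k z)"
      unfolding weak_functional_def using \<Omega> half_space_sets
      by (intro integral_lebesgue_on_support) (auto simp: aform_def)
    also have "\<dots> = (LINT z|?M. h (ws k z) * \<zeta> z * ft z + h (ws k z) * aform (a z) (space_grad \<zeta> z) (fx z)
        + h' (ws k z) * \<zeta> z * (aform (a z) (?d k z) (fx z) + aform (a z) (wx z) (fx z))
        - h (ws k z) * \<zeta> z * (\<bar>f z\<bar> powr (q - 1) * f z))"
      by (intro Bochner_Integration.integral_cong refl)
         (simp add: space_restrict_space \<phi> \<phi>g aform_add_left aform_scaleR_left aform_diff_left)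
    finally show ?thesis .
  qed
  have bm: "(\<lambda>z. h (ws k z) * \<zeta> z) \<in> borel_measurable ?M" "(\<lambda>z. h' (ws k z) * \<zeta> z) \<in> borel_measurable ?M"
    "(\<lambda>z. h (ws k z)) \<in> borel_measurable ?M" for k
    by measurable
  note ib = integrable_bounded_mult[OF _ bm(1) hZ(1)] integrable_bounded_mult[OF _ bm(2) hZ(2)]
    integrable_bounded_mult[OF _ bm(3) hB]
  define I1 where "I1 k = (LINT z|?M. h (ws k z) * \<zeta> z * wt z)" for k
  define I2 where "I2 k = (LINT z|?M. h (ws k z) * aform (a z) (space_grad \<zeta> z) (wx z))" for k
  define I3 where "I3 k = (LINT z|?M. h' (ws k z) * \<zeta> z * aform (a z) (wx z) (wx z))" for k
  define I4 where "I4 k = (LINT z|?M. h' (ws k z) * \<zeta> z * aform (a z) (?d k z) (wx z))" for k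
  define I5 where "I5 k = (LINT z|?M. h (ws k z) * \<zeta> z * N z)" for k
  have key: "I5 k \<le> I1 k + I2 k + I3 k + I4 k" for k
  proof -
    have tf: "weak_functional a q v vt vx (\<phi> k) \<le> weak_functional a q u ut ux (\<phi> k)"
      using weak test_function_test_fun[OF ws(1)] test_fun_nonneg unfolding \<phi>_def by blast
    let ?F = "\<lambda>f ft fx z. h (ws k z) * \<zeta> z * ft z + h (ws k z) * aform (a z) (space_grad \<zeta> z) (fx z)
        + h' (ws k z) * \<zeta> z * (aform (a z) (?d k z) (fx z) + aform (a z) (wx z) (fx z))
        - h (ws k z) * \<zeta> z * (\<bar>f z\<bar> powr (q - 1) * f z)"
    have iu: "integrable ?M (?F u ut ux)"
      by (intro Bochner_Integration.integrable_add Bochner_Integration.integrable_diff ib iut iZu idu iwu iq)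
    have iv: "integrable ?M (?F v vt vx)"
      by (intro Bochner_Integration.integrable_add Bochner_Integration.integrable_diff ib iut iZv idv iwv iq)
    have "0 \<le> integral\<^sup>L ?M (?F u ut ux) - integral\<^sup>L ?M (?F v vt vx)"
      using tf unfolding wf by simp
    also have "\<dots> = (LINT z|?M. ?F u ut ux z - ?F v vt vx z)"
      by (rule Bochner_Integration.integral_diff[OF iu iv, symmetric])
    also have "\<dots> = (LINT z|?M. h (ws k z) * \<zeta> z * wt z + h (ws k z) * aform (a z) (space_grad \<zeta> z) (wx z)
        + h' (ws k z) * \<zeta> z * aform (a z) (wx z) (wx z) + h' (ws k z) * \<zeta> z * aform (a z) (?d k z) (wx z)
        - h (ws k z) * \<zeta> z * N z)"
      by (intro Bochner_Integration.integral_cong refl)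
         (simp add: wt_def wx_def N_def aform_diff_right algebra_simps)
    also have "\<dots> = I1 k + I2 k + I3 k + I4 k - I5 k"
      unfolding I1_def I2_def I3_def I4_def I5_def
      by (simp only: Bochner_Integration.integral_add Bochner_Integration.integral_diff
          Bochner_Integration.integrable_add ib iwt iZw iQw idw iN)
    finally show ?thesis by simp
  qed

  have hl: "isCont h s" "isCont h' s" for s
    using h_deriv h'_cont by (auto simp: continuous_on_eq_continuous_at intro: DERIV_isCont)
  have AE_h: "AE z in ?M. (\<lambda>k. h (ws k z)) \<longlonglongrightarrow> h (w z)"
    using ws(11) by eventually_elim (rule isCont_tendsto_compose[OF hl(1)])
  have AE_hZ: "AE z in ?M. (\<lambda>k. h (ws k z) * \<zeta> z) \<longlonglongrightarrow> h (w z) * \<zeta> z"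
    using ws(11) by eventually_elim (intro tendsto_mult tendsto_const isCont_tendsto_compose[OF hl(1)])
  have AE_h'Z: "AE z in ?M. (\<lambda>k. h' (ws k z) * \<zeta> z) \<longlonglongrightarrow> h' (w z) * \<zeta> z"
    using ws(11) by eventually_elim (intro tendsto_mult tendsto_const isCont_tendsto_compose[OF hl(2)])
  have lm: "(\<lambda>z. h (w z)) \<in> borel_measurable ?M" "(\<lambda>z. h (w z) * \<zeta> z) \<in> borel_measurable ?M"
    "(\<lambda>z. h' (w z) * \<zeta> z) \<in> borel_measurable ?M"
    by measurable
  have l2: "I2 \<longlonglongrightarrow> (LINT z|?M. h (w z) * aform (a z) (space_grad \<zeta> z) (wx z))"
    and i2: "integrable ?M (\<lambda>z. h (w z) * aform (a z) (space_grad \<zeta> z) (wx z))"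
    unfolding I2_def[abs_def]
    by (rule tendsto_integral_bounded_mult[OF iZw bm(3) lm(1) hB AE_h] integrable_bounded_mult_limit[OF iZw bm(3) lm(1) hB AE_h])+
  have l3: "I3 \<longlonglongrightarrow> (LINT z|?M. h' (w z) * \<zeta> z * aform (a z) (wx z) (wx z))"
    and i3: "integrable ?M (\<lambda>z. h' (w z) * \<zeta> z * aform (a z) (wx z) (wx z))"
    unfolding I3_def[abs_def]
    by (rule tendsto_integral_bounded_mult[OF iQw bm(2) lm(3) hZ(2) AE_h'Z] integrable_bounded_mult_limit[OF iQw bm(2) lm(3) hZ(2) AE_h'Z])+
  have l5: "I5 \<longlonglongrightarrow> (LINT z|?M. h (w z) * \<zeta> z * N z)"
    and i5: "integrable ?M (\<lambda>z. h (w z) * \<zeta> z * N z)"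
    unfolding I5_def[abs_def]
    by (rule tendsto_integral_bounded_mult[OF iN bm(1) lm(2) hZ(1) AE_hZ] integrable_bounded_mult_limit[OF iN bm(1) lm(2) hZ(1) AE_hZ])+

  have abs_int: "\<bar>LINT z|?M. b z * f z\<bar> \<le> D * (LINT z|?M. \<bar>f z\<bar>)"
    if "integrable ?M f" "integrable ?M (\<lambda>z. b z * f z)" "\<And>z. \<bar>b z\<bar> \<le> D" for b f :: "_ \<Rightarrow> real" and D
  proof -
    have "\<bar>LINT z|?M. b z * f z\<bar> \<le> (LINT z|?M. \<bar>b z * f z\<bar>)"
      by (rule integral_abs_bound)
    also have "\<dots> \<le> (LINT z|?M. D * \<bar>f z\<bar>)"
    proof (rule integral_mono)
      show "integrable ?M (\<lambda>z. \<bar>b z * f z\<bar>)" "integrable ?M (\<lambda>z. D * \<bar>f z\<bar>)"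
        using that(1,2) by (auto intro: Bochner_Integration.integrable_abs)
      show "\<bar>b z * f z\<bar> \<le> D * \<bar>f z\<bar>" for z
        unfolding abs_mult by (rule mult_right_mono[OF that(3)]) simp
    qed
    finally show ?thesis by simp
  qed
  \<comment> \<open>By Young's inequality the vanishing energy of \<open>?d k\<close> is divided by
    e and the fixed energy of \<open>wx\<close> is multiplied by e.\<close>
  have "(\<lambda>k. \<bar>I4 k\<bar>) \<longlonglongrightarrow> 0"
  proof (rule tendsto_0_of_le_eps[OF ws(8)])
    fix e :: real and k assume "0 < e"
    have "\<bar>I4 k\<bar> \<le> B * C * (LINT z|?M. \<bar>aform (a z) (?d k z) (wx z)\<bar>)"
      unfolding I4_def by (rule abs_int[OF idw ib(2)[OF idw] hZ(2)])
    also have "\<dots> \<le> B * C * ((LINT z|?M. aform (a z) (?d k z) (?d k z)) / e + e * (LINT z|?M. aform (a z) (wx z) (wx z)))"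
      using B_nonneg C(1)
      by (intro mult_left_mono integrable_aform(2)[OF am sym psd dm wm(2) ws(7) iQw \<open>0 < e\<close>]) auto
    finally show "\<bar>I4 k\<bar> \<le> e * (B * C * (LINT z|?M. aform (a z) (wx z) (wx z)))
        + B * C / e * (LINT z|?M. aform (a z) (?d k z) (?d k z))"
      by (simp add: algebra_simps)
  next
    have "0 \<le> (LINT z|?M. aform (a z) (wx z) (wx z))"
      by (rule integral_nonneg_AE) (use psd in \<open>auto elim: AE_mp\<close>)
    then show "0 \<le> B * C * (LINT z|?M. aform (a z) (wx z) (wx z))"
      using B_nonneg C(1) by simp
  qed auto
  then have l4: "I4 \<longlonglongrightarrow> 0"
    by (simp add: tendsto_rabs_zero_iff)

  have lipH: "\<bar>H r - H s\<bar> \<le> B * \<bar>r - s\<bar>" for r s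
    using field_differentiable_bound[of UNIV H h B r s] H_deriv hB
    by (auto simp: has_field_derivative_at_within)
  have iw: "integrable ?M w"
  proof -
    have "integrable ?M (\<lambda>z. 1 + \<bar>u z\<bar> powr q)" "integrable ?M (\<lambda>z. 1 + \<bar>v z\<bar> powr q)"
      using fu fv unfolding W_finite_def mq by auto
    from Bochner_Integration.integrable_add[OF this]
    show ?thesis
    proof (rule Bochner_Integration.integrable_bound)
      show "AE z in ?M. norm (w z) \<le> norm (1 + \<bar>u z\<bar> powr q + (1 + \<bar>v z\<bar> powr q))"
      proof (rule AE_I2)
        fix z
        have "\<bar>u z\<bar> \<le> 1 + \<bar>u z\<bar> powr q" "\<bar>v z\<bar> \<le> 1 + \<bar>v z\<bar> powr q"
          using abs_le_eps_powr[OF q zero_less_one, of "u z"] abs_le_eps_powr[OF q zero_less_one, of "v z"]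
          by simp_all
        then have "\<bar>w z\<bar> \<le> \<bar>1 + \<bar>u z\<bar> powr q + (1 + \<bar>v z\<bar> powr q)\<bar>"
          unfolding w_def by linarith
        then show "norm (w z) \<le> norm (1 + \<bar>u z\<bar> powr q + (1 + \<bar>v z\<bar> powr q))"
          unfolding real_norm_def .
      qed
    qed measurable
  qed
  have iD: "integrable ?M (\<lambda>z. ws k z - w z)" for k
    using ws(9)[of k] by (subst (asm) integrable_abs_iff) auto
  have iwk: "integrable ?M (ws k)" for k
    using Bochner_Integration.integrable_add[OF iD iw] by simp
  have iH: "integrable ?M (\<lambda>z. time_deriv \<zeta> z * H (f z))" if "integrable ?M f" for f
  proof (rule integrable_bounded_mult[OF _ measurable_\<zeta>(2) C(3)])
    have [measurable]: "f \<in> borel_measurable ?M" using that by auto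
    show "integrable ?M (\<lambda>z. H (f z))"
    proof (rule Bochner_Integration.integrable_bound)
      show "integrable ?M (\<lambda>z. \<bar>H 0\<bar> + B * \<bar>f z\<bar>)"
        using that by simp
      have "\<bar>H (f z)\<bar> \<le> \<bar>H 0\<bar> + B * \<bar>f z\<bar>" for z
        using lipH[of "f z" 0] by simp
      then show "AE z in ?M. norm (H (f z)) \<le> norm (\<bar>H 0\<bar> + B * \<bar>f z\<bar>)"
        by (intro AE_I2) (simp add: order_trans[OF _ abs_ge_self])
    qed measurable
  qed
  have i1: "integrable ?M (\<lambda>z. time_deriv \<zeta> z * H (w z))"
    by (rule iH[OF iw])
  \<comment> \<open>Integration by parts holds with \<open>time_deriv (ws k)\<close> in place of
    \<open>wt\<close>. The exchange costs an L^1 error times the bound of the test function, and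
    \<open>H (ws k)\<close> approaches \<open>H (w)\<close> in L^1 because \<open>H\<close> is
    Lipschitz with constant \<open>B\<close>.\<close>
  have "(\<lambda>k. I1 k + (LINT z|?M. time_deriv \<zeta> z * H (w z))) \<longlonglongrightarrow> 0"
  proof (rule tendsto_rabs_zero_cancel, rule tendsto_sandwich[OF _ _ tendsto_const])
    show "\<forall>\<^sub>F k in sequentially. \<bar>I1 k + (LINT z|?M. time_deriv \<zeta> z * H (w z))\<bar>
      \<le> B * C * (LINT z|?M. \<bar>time_deriv (ws k) z - wt z\<bar>) + C * (B * (LINT z|?M. \<bar>ws k z - w z\<bar>))"
    proof (rule always_eventually, rule allI)
      fix k
      have itk: "integrable ?M (\<lambda>z. time_deriv (ws k) z - wt z)"
        using ws(5)[of k] iwt by (subst (asm) integrable_abs_iff) auto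
      from Bochner_Integration.integrable_add[OF this iwt]
      have ik: "integrable ?M (time_deriv (ws k))" by simp
      have iHk: "integrable ?M (\<lambda>z. H (ws k z) * time_deriv \<zeta> z)" "integrable ?M (\<lambda>z. H (w z) * time_deriv \<zeta> z)"
        using iH[OF iwk] iH[OF iw] by (simp_all add: mult.commute)
      have "0 = (LINT z|?M. h (ws k z) * \<zeta> z * time_deriv (ws k) z) + (LINT z|?M. H (ws k z) * time_deriv \<zeta> z)"
        using integration_by_parts[OF ws(1), of k] Bochner_Integration.integral_add[OF ib(1)[OF ik] iHk(1)] by simp
      then have "I1 k + (LINT z|?M. time_deriv \<zeta> z * H (w z)) =
          ((LINT z|?M. h (ws k z) * \<zeta> z * wt z) - (LINT z|?M. h (ws k z) * \<zeta> z * time_deriv (ws k) z))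
          + ((LINT z|?M. H (w z) * time_deriv \<zeta> z) - (LINT z|?M. H (ws k z) * time_deriv \<zeta> z))"
        by (simp add: I1_def mult.commute[of "time_deriv \<zeta> _"])
      also have "\<dots> = - (LINT z|?M. h (ws k z) * \<zeta> z * (time_deriv (ws k) z - wt z))
          - (LINT z|?M. time_deriv \<zeta> z * (H (ws k z) - H (w z)))"
        using Bochner_Integration.integral_diff[OF ib(1)[OF ik, of k] ib(1)[OF iwt, of k]]
          Bochner_Integration.integral_diff[OF iHk]
        by (simp add: algebra_simps)
      finally have "\<bar>I1 k + (LINT z|?M. time_deriv \<zeta> z * H (w z))\<bar> \<le>
          \<bar>LINT z|?M. h (ws k z) * \<zeta> z * (time_deriv (ws k) z - wt z)\<bar>
          + \<bar>LINT z|?M. time_deriv \<zeta> z * (H (ws k z) - H (w z))\<bar>"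
        by linarith
      moreover have "\<bar>LINT z|?M. h (ws k z) * \<zeta> z * (time_deriv (ws k) z - wt z)\<bar>
          \<le> B * C * (LINT z|?M. \<bar>time_deriv (ws k) z - wt z\<bar>)"
        by (rule abs_int[OF itk ib(1)[OF itk] hZ(1)])
      moreover have "\<bar>LINT z|?M. time_deriv \<zeta> z * (H (ws k z) - H (w z))\<bar> \<le> C * (B * (LINT z|?M. \<bar>ws k z - w z\<bar>))"
      proof -
        have iHD: "integrable ?M (\<lambda>z. H (ws k z) - H (w z))"
        proof (rule Bochner_Integration.integrable_bound)
          show "integrable ?M (\<lambda>z. B * \<bar>ws k z - w z\<bar>)"
            using ws(9) by simp
          show "AE z in ?M. norm (H (ws k z) - H (w z)) \<le> norm (B * \<bar>ws k z - w z\<bar>)"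
            using lipH B_nonneg by (intro AE_I2) (simp add: abs_mult)
        qed measurable
        have "\<bar>LINT z|?M. time_deriv \<zeta> z * (H (ws k z) - H (w z))\<bar> \<le> C * (LINT z|?M. \<bar>H (ws k z) - H (w z)\<bar>)"
          by (rule abs_int[OF iHD integrable_bounded_mult[OF iHD measurable_\<zeta>(2) C(3)] C(3)])
        also have "\<dots> \<le> C * (LINT z|?M. B * \<bar>ws k z - w z\<bar>)"
          using iHD ws(9)[of k] by (intro mult_left_mono integral_mono C(1)) (auto simp: lipH)
        finally show ?thesis by simp
      qed
      ultimately show "\<bar>I1 k + (LINT z|?M. time_deriv \<zeta> z * H (w z))\<bar>
        \<le> B * C * (LINT z|?M. \<bar>time_deriv (ws k) z - wt z\<bar>) + C * (B * (LINT z|?M. \<bar>ws k z - w z\<bar>))"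
        by linarith
    qed
    show "(\<lambda>k. B * C * (LINT z|?M. \<bar>time_deriv (ws k) z - wt z\<bar>) + C * (B * (LINT z|?M. \<bar>ws k z - w z\<bar>))) \<longlonglongrightarrow> 0"
      by (intro tendsto_add_zero tendsto_mult_right_zero ws(6,10))
  qed auto
  from tendsto_diff[OF this tendsto_const[of "LINT z|?M. time_deriv \<zeta> z * H (w z)"]]
  have l1: "I1 \<longlonglongrightarrow> - (LINT z|?M. time_deriv \<zeta> z * H (w z))"
    by simp
  have lim: "(LINT z|?M. h (w z) * \<zeta> z * N z) \<le> - (LINT z|?M. time_deriv \<zeta> z * H (w z))
      + (LINT z|?M. h (w z) * aform (a z) (space_grad \<zeta> z) (wx z))
      + (LINT z|?M. h' (w z) * \<zeta> z * aform (a z) (wx z) (wx z)) + 0"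
    by (rule LIMSEQ_le[OF l5 tendsto_add[OF tendsto_add[OF tendsto_add[OF l1 l2] l3] l4]]) (use key in auto)
  show ?I1 by (rule i5)
  have i1': "integrable ?M (\<lambda>z. H (w z) * time_deriv \<zeta> z)"
    using i1 by (simp add: mult.commute)
  show ?I2
    by (intro Bochner_Integration.integrable_add Bochner_Integration.integrable_diff i1' i2 i3)
  have "(LINT z|?M. h (w z) * aform (a z) (space_grad \<zeta> z) (wx z)
        + h' (w z) * \<zeta> z * aform (a z) (wx z) (wx z) - H (w z) * time_deriv \<zeta> z)
     = (LINT z|?M. h (w z) * aform (a z) (space_grad \<zeta> z) (wx z))
      + (LINT z|?M. h' (w z) * \<zeta> z * aform (a z) (wx z) (wx z)) - (LINT z|?M. H (w z) * time_deriv \<zeta> z)"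
    by (simp only: Bochner_Integration.integral_diff[OF Bochner_Integration.integrable_add[OF i2 i3] i1']
        Bochner_Integration.integral_add[OF i2 i3])
  then show ?I3
    using lim by (simp add: mult.commute[of "time_deriv \<zeta> _"])
qed

end

section \<open>The profile\<close>

text \<open>A smooth substitute for 1 + s: comparable to it for \<open>0 \<le> s\<close>, but above
  1 on the whole real line, so that negative values of the approximations do no harm to real
  powers.\<close>

definition profile_base :: "real \<Rightarrow> real" where
  "profile_base s = 1 + s + sqrt (1 + s\<^sup>2)"

text \<open>The summand 1 keeps the factor from weakening the power term; the decaying summand
  exists for the sake of its negative derivative.\<close>

definition profile :: "real \<Rightarrow> real \<Rightarrow> real \<Rightarrow> real" where
  "profile \<nu> M s = 1 + profile_base (s / M) powr (- \<nu>)"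

definition profile_deriv :: "real \<Rightarrow> real \<Rightarrow> real \<Rightarrow> real" where
  "profile_deriv \<nu> M s =
     - (\<nu> / M) * profile_base (s / M) powr (- \<nu> - 1) * (1 + (s / M) / sqrt (1 + (s / M)\<^sup>2))"

lemma abs_less_sqrt: "\<bar>s\<bar> < sqrt (1 + s\<^sup>2)" for s :: real
proof -
  have "sqrt (s\<^sup>2) < sqrt (1 + s\<^sup>2)"
    by (intro real_sqrt_less_mono) simp
  then show ?thesis by simp
qed

lemma sqrt_pos: "0 < sqrt (1 + s\<^sup>2)" for s :: real
  by (simp add: add_pos_nonneg)

lemma profile_base_gt_1: "1 < profile_base s"
  using abs_less_sqrt[of s] by (simp add: profile_base_def)

lemma profile_base_deriv: "(profile_base has_real_derivative 1 + s / sqrt (1 + s\<^sup>2)) (at s)"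
proof -
  have "1 + s\<^sup>2 > 0" by (simp add: add_pos_nonneg)
  then show ?thesis
    unfolding profile_base_def[abs_def]
    by (auto intro!: derivative_eq_intros simp: field_simps)
qed

lemma profile_base_slope: "0 < 1 + s / sqrt (1 + s\<^sup>2)" "1 + s / sqrt (1 + s\<^sup>2) < 2"
proof -
  have "\<bar>s / sqrt (1 + s\<^sup>2)\<bar> < 1"
    using abs_less_sqrt[of s] sqrt_pos[of s] by (simp add: abs_divide)
  then show "0 < 1 + s / sqrt (1 + s\<^sup>2)" "1 + s / sqrt (1 + s\<^sup>2) < 2" by linarith+
qed

lemma profile_has_derivative:
  assumes "0 < M"
  shows "(profile \<nu> M has_real_derivative profile_deriv \<nu> M s) (at s)"
proof -
  have "((\<lambda>s. s / M) has_real_derivative 1 / M) (at s)"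
    by (rule DERIV_cdivide[OF DERIV_ident])
  from DERIV_chain2[OF profile_base_deriv this]
  have b: "((\<lambda>s. profile_base (s / M)) has_real_derivative (1 + (s / M) / sqrt (1 + (s / M)\<^sup>2)) * (1 / M)) (at s)" .
  have "((\<lambda>y. y powr (- \<nu>)) has_real_derivative - \<nu> * profile_base (s / M) powr (- \<nu> - 1)) (at (profile_base (s / M)))"
    using profile_base_gt_1[of "s / M"] by (intro has_real_derivative_powr) simp
  from DERIV_add[OF DERIV_const DERIV_chain2[OF this b], of 1]
  show ?thesis
    unfolding profile_def[abs_def] by (rule DERIV_cong) (simp add: profile_deriv_def)
qed

lemma profile_deriv_continuous:
  assumes "0 < M"
  shows "continuous_on UNIV (profile_deriv \<nu> M)"
proof -
  have "isCont profile_base s" for s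
    using profile_base_deriv by (rule DERIV_isCont)
  then have "continuous_on UNIV profile_base"
    by (simp add: continuous_at_imp_continuous_on)
  then have c: "continuous_on UNIV (\<lambda>s. profile_base (s / M))"
    by (rule continuous_on_compose2) (use assms in \<open>auto intro!: continuous_intros\<close>)
  have n: "profile_base s \<noteq> 0" "sqrt (1 + s\<^sup>2) \<noteq> 0" for s
    using profile_base_gt_1[of s] sqrt_pos[of s] by linarith+
  show ?thesis
    unfolding profile_deriv_def[abs_def]
    by (intro continuous_intros c) (use n assms in auto)
qed

lemma smooth_on_profile:
  assumes "0 < M" "open S" "smooth_on S f"
  shows "smooth_on S (\<lambda>z. profile \<nu> M (f z))"
proof -
  have f: "smooth_on S (\<lambda>z. f z * (1 / M))"
    by (intro smooth_on_mult smooth_on_const assms)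
  have pos: "0 < 1 + f z * (1 / M) + (1 + (f z * (1 / M))\<^sup>2) powr (1 / 2)" for z
    using profile_base_gt_1[of "f z * (1 / M)"] by (simp add: profile_base_def powr_half_sqrt)
  have pos2: "0 < 1 + (f z * (1 / M))\<^sup>2" for z
    by (simp add: add_pos_nonneg)
  have "smooth_on S (\<lambda>z. 1 + (1 + f z * (1 / M) + (1 + (f z * (1 / M))\<^sup>2) powr (1 / 2)) powr (- \<nu>))"
    by (intro smooth_on_add smooth_on_powr smooth_on_power smooth_on_const f assms(2) pos pos2)
  then show ?thesis
    by (simp add: profile_def profile_base_def powr_half_sqrt)
qed

lemma profile_bounds:
  assumes "0 < \<nu>"
  shows "1 \<le> profile \<nu> M s" "profile \<nu> M s \<le> 2"
proof -
  have "profile_base (s / M) powr (- \<nu>) \<le> profile_base (s / M) powr 0"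
    using profile_base_gt_1[of "s / M"] assms by (intro powr_mono) auto
  then show "1 \<le> profile \<nu> M s" "profile \<nu> M s \<le> 2"
    using profile_base_gt_1[of "s / M"] by (auto simp: profile_def)
qed

lemma profile_deriv_bound:
  assumes "0 < \<nu>" "0 < M"
  shows "\<bar>profile_deriv \<nu> M s\<bar> \<le> 2 * \<nu> / M"
proof -
  have "profile_base (s / M) powr (- \<nu> - 1) \<le> profile_base (s / M) powr 0"
    using profile_base_gt_1[of "s / M"] assms by (intro powr_mono) auto
  then have 1: "profile_base (s / M) powr (- \<nu> - 1) \<le> 1"
    using profile_base_gt_1[of "s / M"] by simp
  have "\<bar>profile_deriv \<nu> M s\<bar> =
      \<nu> / M * (profile_base (s / M) powr (- \<nu> - 1) * (1 + (s / M) / sqrt (1 + (s / M)\<^sup>2)))"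
    using assms profile_base_slope(1)[of "s / M"] by (simp add: profile_deriv_def abs_mult)
  also have "\<dots> \<le> \<nu> / M * (1 * 2)"
    using assms 1 profile_base_slope[of "s / M"] by (intro mult_left_mono mult_mono) auto
  finally show ?thesis by (simp add: mult.commute)
qed

text \<open>For \<open>0 \<le> s\<close> the slope of \<open>profile_base\<close> is at least 1 and
  its value at r is at most 2 + 2r. The left-hand side is the coefficient available for absorbing
  the gradient of the difference; its reciprocal fixes the growth of the remainder.\<close>

lemma profile_deriv_le:
  assumes "0 < \<nu>" "0 < M" "0 \<le> s"
  shows "\<nu> / M * (2 + 2 * (s / M)) powr (- (1 + \<nu>)) \<le> - profile_deriv \<nu> M s"
proof -
  define r where "r = s / M"
  have r: "0 \<le> r" using assms by (simp add: r_def)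
  have "sqrt (1 + r\<^sup>2) \<le> 1 + r"
    using r by (intro real_le_lsqrt) (auto simp: power2_eq_square algebra_simps)
  then have "profile_base r \<le> 2 + 2 * r"
    by (simp add: profile_base_def)
  then have "(2 + 2 * r) powr (- (1 + \<nu>)) \<le> profile_base r powr (- (1 + \<nu>))"
    using profile_base_gt_1[of r] assms by (intro powr_mono2') auto
  also have "\<dots> \<le> profile_base r powr (- (1 + \<nu>)) * (1 + r / sqrt (1 + r\<^sup>2))"
    using r sqrt_pos[of r] by (simp add: mult_le_cancel_left1)
  finally have "\<nu> / M * (2 + 2 * r) powr (- (1 + \<nu>)) \<le>
      \<nu> / M * (profile_base r powr (- (1 + \<nu>)) * (1 + r / sqrt (1 + r\<^sup>2)))"
    using assms by (intro mult_left_mono) auto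
  also have "\<dots> = - profile_deriv \<nu> M s"
  proof -
    have "- (1 + \<nu>) = - \<nu> - 1" by simp
    then show ?thesis
      unfolding profile_deriv_def r_def by (simp only: mult_minus_left minus_minus mult.assoc)
  qed
  finally show ?thesis by (simp add: r_def)
qed

text \<open>The free constant is fixed by \<open>H 0 = 0\<close>; the mean value theorem then makes
  \<open>H\<close> non-negative and at most linear on the half-line where the difference takes its
  values.\<close>

lemma antiderivative_exists:
  fixes h :: "real \<Rightarrow> real"
  assumes "\<And>s. isCont h s" and "\<And>s. 0 \<le> h s" "\<And>s. h s \<le> B"
  obtains H where "\<And>s. (H has_real_derivative h s) (at s)" "\<And>s. 0 \<le> s \<Longrightarrow> 0 \<le> H s" "\<And>s. 0 \<le> s \<Longrightarrow> H s \<le> B * s"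
proof -
  obtain F where F: "\<And>s. (F has_real_derivative h s) (at s)"
    using einterval_antiderivative[of "-\<infinity>" "\<infinity>" h] assms(1)
    by (auto simp: has_real_derivative_iff_has_vector_derivative)
  show thesis
  proof (rule that[of "\<lambda>s. F s - F 0"])
    show "((\<lambda>s. F s - F 0) has_real_derivative h s) (at s)" for s
      using DERIV_diff[OF F DERIV_const] by simp
    fix s :: real assume "0 \<le> s"
    then consider "s = 0" | "0 < s" by linarith
    then have "0 \<le> F s - F 0 \<and> F s - F 0 \<le> B * s"
    proof cases
      case 2
      then obtain r where r: "F s - F 0 = (s - 0) * h r"
        using MVT2[of 0 s F h] F by blast
      then show ?thesis
        using assms(2,3)[of r] 2 by (simp add: mult.commute[of s] mult_right_mono)
    qed simp
    then show "0 \<le> F s - F 0" "F s - F 0 \<le> B * s" by auto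
  qed
qed

section \<open>The cutoff\<close>

text \<open>Equal to 1 for times up to R^\<alpha> and |x|^2 \<le> R^2/2, and zero from time 2
  R^\<alpha> or radius R on. R^\<alpha> is the diffusion time of a ball of radius R for a
  coefficient of size R^(2 - \<alpha>). Using |x|^2 instead of |x| keeps the function smooth at the
  origin.\<close>

definition box_cutoff :: "real \<Rightarrow> real \<Rightarrow> real \<times> (real^'n) \<Rightarrow> real" where
  "box_cutoff \<alpha> R z = cutoff (fst z / R powr \<alpha>) * cutoff (2 * (snd z \<bullet> snd z) / R\<^sup>2)"

text \<open>Kept apart from \<open>box_cutoff\<close>, and outside the power \<open>m\<close>,
  because its derivative is non-negative and is discarded rather than estimated.\<close>

definition rise :: "real \<Rightarrow> real \<times> (real^'n) \<Rightarrow> real" where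
  "rise R z = 1 - cutoff (R * fst z)"

definition space_time_cutoff :: "real \<Rightarrow> nat \<Rightarrow> real \<Rightarrow> real \<times> (real^'n) \<Rightarrow> real" where
  "space_time_cutoff \<alpha> m R z = rise R z * box_cutoff \<alpha> R z ^ m"

definition cyl :: "real \<Rightarrow> real \<Rightarrow> (real \<times> (real^'n)) set" where
  "cyl \<alpha> R = {1 / R..2 * R powr \<alpha>} \<times> cball 0 R"

text \<open>Contains the points of the cylinder near which \<open>box_cutoff\<close> varies. Small
  times belong to it only through large |x|, so that every fixed point of the half-space leaves the
  shell as R grows.\<close>

definition shell :: "real \<Rightarrow> real \<Rightarrow> (real \<times> (real^'n)) set" where
  "shell \<alpha> R = {z \<in> cyl \<alpha> R. R powr \<alpha> < fst z \<or> R\<^sup>2 / 2 < snd z \<bullet> snd z}"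

lemma box_cutoff_bounds: "0 \<le> box_cutoff \<alpha> R z" "box_cutoff \<alpha> R z \<le> 1"
  using cutoff_nonneg cutoff_le_1 by (auto simp: box_cutoff_def mult_le_one)

lemma rise_bounds: "0 \<le> rise R z" "rise R z \<le> 1"
  using cutoff_nonneg cutoff_le_1 by (auto simp: rise_def)

lemma space_time_cutoff_bounds: "0 \<le> space_time_cutoff \<alpha> m R z" "space_time_cutoff \<alpha> m R z \<le> 1"
  using box_cutoff_bounds[of \<alpha> R z] rise_bounds[of R z]
  by (auto simp: space_time_cutoff_def power_le_one intro!: mult_le_one)

lemma compact_cyl: "compact (cyl \<alpha> R)"
  unfolding cyl_def by (intro compact_Times) auto

lemma norm_le_of_inner_le: "x \<bullet> x \<le> R\<^sup>2 \<Longrightarrow> 0 \<le> R \<Longrightarrow> norm x \<le> R" for x :: "'a::real_inner"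
  by (simp add: norm_eq_sqrt_inner real_le_lsqrt)

lemma space_time_cutoff_eq_0:
  assumes "1 < R" "0 < m" "z \<notin> cyl \<alpha> R"
  shows "space_time_cutoff \<alpha> m R z = 0"
proof -
  have T: "0 < R powr \<alpha>" using assms(1) by simp
  consider "fst z < 1 / R" | "2 * R powr \<alpha> < fst z" | "R < norm (snd z)"
    using assms(3) by (cases z) (fastforce simp: cyl_def)
  then show ?thesis
  proof cases
    case 1
    then have "R * fst z \<le> 1"
      using assms(1) by (simp add: field_simps)
    then show ?thesis by (simp add: space_time_cutoff_def rise_def cutoff_eq_1)
  next
    case 2
    then have "2 \<le> fst z / R powr \<alpha>"
      using T by (simp add: field_simps)
    then show ?thesis using assms(2) by (simp add: space_time_cutoff_def box_cutoff_def cutoff_eq_0)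
  next
    case 3
    then have "R\<^sup>2 \<le> snd z \<bullet> snd z"
      using norm_le_of_inner_le[of "snd z" R] assms(1) by (meson less_eq_real_def linorder_not_le not_less_iff_gr_or_eq zero_less_one less_trans)
    then have "2 \<le> 2 * (snd z \<bullet> snd z) / R\<^sup>2"
      using assms(1) by (simp add: field_simps)
    then show ?thesis using assms(2) by (simp add: space_time_cutoff_def box_cutoff_def cutoff_eq_0)
  qed
qed

lemma smooth_on_space_time_cutoff: "smooth_on UNIV (space_time_cutoff \<alpha> m R :: real \<times> (real^'n) \<Rightarrow> real)"
proof -
  have f: "smooth_on UNIV (\<lambda>z::real \<times> (real^'n). fst z * c)" for c
    by (intro smooth_on_mult smooth_on_const smooth_on_bounded_linear bounded_linear_fst) auto
  have "bounded_linear (\<lambda>z::real \<times> (real^'n). snd z $ i)" for i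
    by (rule bounded_linear_compose[OF bounded_linear_vec_nth bounded_linear_snd])
  then have s: "smooth_on UNIV (\<lambda>z::real \<times> (real^'n). 2 * (\<Sum>i\<in>UNIV. snd z $ i * snd z $ i) * (1 / R\<^sup>2))"
    by (intro smooth_on_mult smooth_on_sum smooth_on_const smooth_on_bounded_linear) auto
  have "smooth_on UNIV (\<lambda>z::real \<times> (real^'n). (1 - cutoff (fst z * R)) *
     (cutoff (fst z * (1 / R powr \<alpha>)) * cutoff (2 * (\<Sum>i\<in>UNIV. snd z $ i * snd z $ i) * (1 / R\<^sup>2))) ^ m)"
    by (intro smooth_on_mult smooth_on_power smooth_on_diff smooth_on_const smooth_on_cutoff f s) auto
  then show ?thesis
    by (simp add: space_time_cutoff_def[abs_def] rise_def box_cutoff_def inner_vec_def mult.commute)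
qed

lemma space_time_cutoff_derivs:
  fixes z :: "real \<times> (real^'n)"
  assumes D: "\<And>s. (cutoff has_real_derivative D s) (at s)"
  shows "time_deriv (space_time_cutoff \<alpha> m R) z =
      rise R z * (real m * box_cutoff \<alpha> R z ^ (m - 1) * (D (fst z / R powr \<alpha>) / R powr \<alpha> * cutoff (2 * (snd z \<bullet> snd z) / R\<^sup>2)))
      - R * D (R * fst z) * box_cutoff \<alpha> R z ^ m"
    and "space_grad (space_time_cutoff \<alpha> m R) z =
      (rise R z * (real m * box_cutoff \<alpha> R z ^ (m - 1) * (cutoff (fst z / R powr \<alpha>) *
        (D (2 * (snd z \<bullet> snd z) / R\<^sup>2) * (4 / R\<^sup>2))))) *\<^sub>R snd z"
proof -
  have c: "((\<lambda>z. cutoff (f z)) has_derivative (\<lambda>y. D (f z) * f' y)) (at z)"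
    if "(f has_derivative f') (at z)" for f f'
    using has_derivative_compose[OF that, of cutoff "(*) (D (f z))"] D[of "f z"]
    by (simp add: has_field_derivative_def)
  have c1: "((\<lambda>z. cutoff (R * fst z)) has_derivative (\<lambda>y. D (R * fst z) * (R * fst y))) (at z)"
    by (intro c has_derivative_mult_right has_derivative_fst has_derivative_ident)
  have c2: "((\<lambda>z. cutoff (fst z / R powr \<alpha>)) has_derivative (\<lambda>y. D (fst z / R powr \<alpha>) * (fst y / R powr \<alpha>))) (at z)"
    by (intro c bounded_linear.has_derivative[OF bounded_linear_divide] has_derivative_fst has_derivative_ident)
  have c3: "((\<lambda>z. cutoff (2 * (snd z \<bullet> snd z) / R\<^sup>2)) has_derivative
      (\<lambda>y. D (2 * (snd z \<bullet> snd z) / R\<^sup>2) * (4 / R\<^sup>2 * (snd z \<bullet> snd y)))) (at z)"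
  proof (rule c)
    have d: "((\<lambda>z. 2 / R\<^sup>2 * (snd z \<bullet> snd z)) has_derivative (\<lambda>y. 2 / R\<^sup>2 * (snd z \<bullet> snd y + snd y \<bullet> snd z))) (at z)"
      by (intro has_derivative_mult_right has_derivative_inner has_derivative_snd has_derivative_ident)
    have eq: "(\<lambda>y::real \<times> (real^'n). 2 / R\<^sup>2 * (snd z \<bullet> snd y + snd y \<bullet> snd z)) = (\<lambda>y. 4 / R\<^sup>2 * (snd z \<bullet> snd y))"
    proof
      fix y :: "real \<times> (real^'n)"
      show "2 / R\<^sup>2 * (snd z \<bullet> snd y + snd y \<bullet> snd z) = 4 / R\<^sup>2 * (snd z \<bullet> snd y)"
        by (simp add: inner_commute[of "snd y"])
    qed
    show "((\<lambda>z. 2 * (snd z \<bullet> snd z) / R\<^sup>2) has_derivative (\<lambda>y. 4 / R\<^sup>2 * (snd z \<bullet> snd y))) (at z)"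
      using d unfolding eq by (simp only: times_divide_eq_left)
  qed
  let ?b' = "\<lambda>y. cutoff (fst z / R powr \<alpha>) * (D (2 * (snd z \<bullet> snd z) / R\<^sup>2) * (4 / R\<^sup>2 * (snd z \<bullet> snd y)))
    + D (fst z / R powr \<alpha>) * (fst y / R powr \<alpha>) * cutoff (2 * (snd z \<bullet> snd z) / R\<^sup>2)"
  have b: "(box_cutoff \<alpha> R has_derivative ?b') (at z)"
    unfolding box_cutoff_def[abs_def] by (rule has_derivative_mult[OF c2 c3])
  have r: "(rise R has_derivative (\<lambda>y. 0 - D (R * fst z) * (R * fst y))) (at z)"
    unfolding rise_def[abs_def] by (rule has_derivative_diff[OF has_derivative_const c1])
  have "(space_time_cutoff \<alpha> m R has_derivative (\<lambda>y. rise R z * (of_nat m * ?b' y * box_cutoff \<alpha> R z ^ (m - 1))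
      + (0 - D (R * fst z) * (R * fst y)) * box_cutoff \<alpha> R z ^ m)) (at z)"
    unfolding space_time_cutoff_def[abs_def] by (rule has_derivative_mult[OF r has_derivative_power[OF b]])
  from space_grad_time_deriv_has_derivative[OF this]
  show "time_deriv (space_time_cutoff \<alpha> m R) z =
      rise R z * (real m * box_cutoff \<alpha> R z ^ (m - 1) * (D (fst z / R powr \<alpha>) / R powr \<alpha> * cutoff (2 * (snd z \<bullet> snd z) / R\<^sup>2)))
      - R * D (R * fst z) * box_cutoff \<alpha> R z ^ m"
    and "space_grad (space_time_cutoff \<alpha> m R) z =
      (rise R z * (real m * box_cutoff \<alpha> R z ^ (m - 1) * (cutoff (fst z / R powr \<alpha>) *
        (D (2 * (snd z \<bullet> snd z) / R\<^sup>2) * (4 / R\<^sup>2))))) *\<^sub>R snd z"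
    by (simp_all add: vec_eq_iff inner_axis mult_ac)
qed

context
  fixes D :: "real \<Rightarrow> real" and C \<alpha> R :: real and m :: nat
  assumes D: "\<And>s. (cutoff has_real_derivative D s) (at s)" "\<And>s. D s \<le> 0" "\<And>s. - C \<le> D s" "0 \<le> C"
      "\<And>s. \<not> (1 < s \<and> s < 2) \<Longrightarrow> D s = 0"
    and R: "1 < R" and m: "2 \<le> m"
begin

text \<open>The contribution of \<open>rise\<close>, which grows with R, has a favourable sign and
  drops out. What remains comes from \<open>box_cutoff\<close>; its power \<open>m - 1\<close> is
  relaxed to \<open>m - 2\<close> to match the spatial term.\<close>

lemma time_deriv_space_time_cutoff_ge:
  fixes z :: "real \<times> (real^'n)"
  shows "- time_deriv (space_time_cutoff \<alpha> m R) z
    \<le> indicator (shell \<alpha> R) z * (rise R z * box_cutoff \<alpha> R z ^ (m - 2)) * (real m * C / R powr \<alpha>)"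
    (is "_ \<le> ?r")
proof -
  have T: "0 < R powr \<alpha>" using R by simp
  let ?\<sigma> = "box_cutoff \<alpha> R z"
  have r0: "0 \<le> ?r"
    using rise_bounds[of R z] box_cutoff_bounds[of \<alpha> R z] D(4) T by simp
  show ?thesis
  proof (cases "z \<in> cyl \<alpha> R")
    case False
    have "time_deriv (space_time_cutoff \<alpha> m R) z = 0"
      by (rule derivs_eq_0_outside(1)[OF compact_imp_closed[OF compact_cyl] space_time_cutoff_eq_0 False])
         (use R m in auto)
    then show ?thesis using r0 by simp
  next
    case True
    have "R * D (R * fst z) * ?\<sigma> ^ m \<le> 0"
      using R D(2) box_cutoff_bounds[of \<alpha> R z] by (intro mult_nonpos_nonneg mult_nonneg_nonpos) auto
    then have le: "- time_deriv (space_time_cutoff \<alpha> m R) z \<le>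
      rise R z * (real m * ?\<sigma> ^ (m - 1) * ((- D (fst z / R powr \<alpha>)) / R powr \<alpha> * cutoff (2 * (snd z \<bullet> snd z) / R\<^sup>2)))"
      unfolding space_time_cutoff_derivs(1)[OF D(1)] by (simp add: algebra_simps)
    show ?thesis
    proof (cases "R powr \<alpha> < fst z")
      case gt: True
      have "?\<sigma> ^ (m - 1) \<le> ?\<sigma> ^ (m - 2)"
        using box_cutoff_bounds[of \<alpha> R z] by (intro power_decreasing) auto
      moreover have "0 \<le> (- D (fst z / R powr \<alpha>)) / R powr \<alpha>" "(- D (fst z / R powr \<alpha>)) / R powr \<alpha> \<le> C / R powr \<alpha>"
        using D(2,3)[of "fst z / R powr \<alpha>"] T by (intro divide_nonneg_pos divide_right_mono; linarith)+
      ultimately have "rise R z * (real m * ?\<sigma> ^ (m - 1) * ((- D (fst z / R powr \<alpha>)) / R powr \<alpha> * cutoff (2 * (snd z \<bullet> snd z) / R\<^sup>2)))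
         \<le> rise R z * (real m * ?\<sigma> ^ (m - 2) * (C / R powr \<alpha> * 1))"
        using rise_bounds[of R z] box_cutoff_bounds[of \<alpha> R z] T D(4)
        by (intro mult_left_mono[of _ _ "rise R z"] mult_mono mult_left_mono[of _ _ "real m"] mult_nonneg_nonneg
            cutoff_nonneg cutoff_le_1) auto
      moreover have "z \<in> shell \<alpha> R"
        using True gt by (simp add: shell_def)
      ultimately show ?thesis
        using le by (simp add: mult_ac)
    next
      case False
      then have "D (fst z / R powr \<alpha>) = 0"
        using T by (intro D(5)) simp
      then show ?thesis
        using le r0 by simp
    qed
  qed
qed

text \<open>The derivative of \<open>cutoff\<close> lives strictly between 1 and 2, which puts |x|
  strictly between R/sqrt 2 and R, inside the open annulus on which the coefficients are
  controlled.\<close>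

lemma space_grad_space_time_cutoff_support:
  fixes z :: "real \<times> (real^'n)"
  assumes "space_grad (space_time_cutoff \<alpha> m R) z \<noteq> 0"
  shows "z \<in> shell \<alpha> R" "R / 2 < norm (snd z)" "norm (snd z) < R"
proof -
  have K: "z \<in> cyl \<alpha> R"
  proof (rule ccontr)
    assume "z \<notin> cyl \<alpha> R"
    have "space_grad (space_time_cutoff \<alpha> m R) z = 0"
      by (rule derivs_eq_0_outside(2)[OF compact_imp_closed[OF compact_cyl] space_time_cutoff_eq_0 \<open>z \<notin> cyl \<alpha> R\<close>])
         (use R m in auto)
    with assms show False by simp
  qed
  have "D (2 * (snd z \<bullet> snd z) / R\<^sup>2) \<noteq> 0"
    using assms unfolding space_time_cutoff_derivs(2)[OF D(1)] by auto
  then have "1 < 2 * (snd z \<bullet> snd z) / R\<^sup>2" "2 * (snd z \<bullet> snd z) / R\<^sup>2 < 2"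
    using D(5) by blast+
  then have r: "R\<^sup>2 / 2 < snd z \<bullet> snd z" "(norm (snd z))\<^sup>2 < R\<^sup>2"
    using R by (simp_all add: field_simps power2_norm_eq_inner)
  show "z \<in> shell \<alpha> R"
    using K r by (simp add: shell_def)
  show "norm (snd z) < R"
    using r(2) R by (meson less_trans power2_less_imp_less less_imp_le zero_less_one)
  have "(R / 2)\<^sup>2 < (norm (snd z))\<^sup>2"
  proof -
    have "(R / 2)\<^sup>2 = R\<^sup>2 / 4"
      by (simp add: power_divide)
    then show ?thesis
      using r(1) zero_le_power2[of R] unfolding power2_norm_eq_inner by linarith
  qed
  then show "R / 2 < norm (snd z)"
    by (rule power2_less_imp_less) simp
qed

text \<open>The exponent is split as 2 (m - 1) = m + (m - 2): one full factor of the cutoff is set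
  aside to cancel against the cutoff in the absorbing term, the rest becomes the weight of the
  remainder.\<close>

lemma norm_space_grad_space_time_cutoff:
  fixes z :: "real \<times> (real^'n)"
  shows "(norm (space_grad (space_time_cutoff \<alpha> m R) z))\<^sup>2
    \<le> space_time_cutoff \<alpha> m R z * (rise R z * box_cutoff \<alpha> R z ^ (m - 2)) * (16 * (real m)\<^sup>2 * C\<^sup>2 / R\<^sup>2)"
    (is "?l \<le> ?r")
proof (cases "space_grad (space_time_cutoff \<alpha> m R) z = 0")
  case True
  then show ?thesis
    using space_time_cutoff_bounds[of \<alpha> m R z] rise_bounds[of R z] box_cutoff_bounds[of \<alpha> R z] by simp
next
  case False
  let ?\<sigma> = "box_cutoff \<alpha> R z" and ?d = "D (2 * (snd z \<bullet> snd z) / R\<^sup>2)" and ?c = "cutoff (fst z / R powr \<alpha>)"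
  have x: "norm (snd z) \<le> R"
    using space_grad_space_time_cutoff_support(3)[OF False] by simp
  have d: "\<bar>?d\<bar> \<le> C"
    using D(2,3)[of "2 * (snd z \<bullet> snd z) / R\<^sup>2"] by simp
  have "norm (space_grad (space_time_cutoff \<alpha> m R) z) =
      rise R z * (real m * ?\<sigma> ^ (m - 1) * (?c * (\<bar>?d\<bar> * (4 / R\<^sup>2)))) * norm (snd z)"
    unfolding space_time_cutoff_derivs(2)[OF D(1)]
    using rise_bounds[of R z] box_cutoff_bounds[of \<alpha> R z] cutoff_nonneg[of "fst z / R powr \<alpha>"]
    by (simp add: abs_mult)
  also have "\<dots> \<le> rise R z * (real m * ?\<sigma> ^ (m - 1) * (1 * (C * (4 / R\<^sup>2)))) * R"
    using rise_bounds[of R z] box_cutoff_bounds[of \<alpha> R z] cutoff_nonneg[of "fst z / R powr \<alpha>"]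
      cutoff_le_1[of "fst z / R powr \<alpha>"] d x D(4) R
    by (intro mult_mono mult_left_mono mult_right_mono) auto
  also have "\<dots> = rise R z * ?\<sigma> ^ (m - 1) * (4 * real m * C / R)"
    using R by (simp add: field_simps power2_eq_square)
  finally have "?l \<le> (rise R z * ?\<sigma> ^ (m - 1) * (4 * real m * C / R))\<^sup>2"
    by (intro power_mono) auto
  also have "\<dots> = (rise R z)\<^sup>2 * (?\<sigma> ^ m * ?\<sigma> ^ (m - 2)) * (16 * (real m)\<^sup>2 * C\<^sup>2 / R\<^sup>2)"
  proof -
    have "(?\<sigma> ^ (m - 1))\<^sup>2 = ?\<sigma> ^ m * ?\<sigma> ^ (m - 2)"
    proof -
      have "(m - 1) * 2 = m + (m - 2)" using m by simp
      then show ?thesis by (simp only: power_mult[symmetric] power_add[symmetric])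
    qed
    then show ?thesis
      by (simp add: power_mult_distrib power_divide)
  qed
  finally show ?thesis
    by (simp add: space_time_cutoff_def power2_eq_square mult_ac)
qed

end

section \<open>The energy estimate\<close>

text \<open>Young's inequality is applied with exactly the coefficient that the negative derivative
  of the profile offers, so \<eta> disappears. Since R^(2 - \<alpha>) / R^2 = R^(-\<alpha>), the
  diffusion and time terms end up on the same scale.\<close>

lemma energy_pointwise:
  fixes z :: "real \<times> (real^'n)"
  assumes D: "\<And>s. (cutoff has_real_derivative D s) (at s)" "\<And>s. D s \<le> 0" "\<And>s. - C \<le> D s" "0 \<le> C"
      "\<And>s. \<not> (1 < s \<and> s < 2) \<Longrightarrow> D s = 0"
    and R: "1 < R" and m: "2 \<le> m" and pos: "0 < \<nu>" "0 < M" "0 \<le> c"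
    and sym: "\<And>i j. P $ i $ j = P $ j $ i" and psd: "\<And>\<xi>. 0 \<le> aform P \<xi> \<xi>"
    and upper: "\<And>\<xi>. aform P \<xi> \<xi> \<le> S * (norm \<xi>)\<^sup>2"
    and annulus: "R / 2 < norm (snd z) \<Longrightarrow> norm (snd z) < R \<Longrightarrow> S \<le> c * R powr (2 - \<alpha>)"
    and w: "0 \<le> w" and H: "0 \<le> H" "H \<le> 2 * w"
  shows "profile \<nu> M w * aform P (space_grad (space_time_cutoff \<alpha> m R) z) \<eta>
      + profile_deriv \<nu> M w * space_time_cutoff \<alpha> m R z * aform P \<eta> \<eta>
      - H * time_deriv (space_time_cutoff \<alpha> m R) z
    \<le> indicator (shell \<alpha> R) z * (rise R z * box_cutoff \<alpha> R z ^ (m - 2)) *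
       (R powr (- \<alpha>) * M * ((real m * C + 16 * c * (real m)\<^sup>2 * C\<^sup>2 / \<nu>) * (2 + 2 * (w / M)) powr (1 + \<nu>)))"
proof -
  let ?\<zeta> = "space_time_cutoff \<alpha> m R"
  define X where "X = indicator (shell \<alpha> R) z * (rise R z * box_cutoff \<alpha> R z ^ (m - 2))"
  define Y where "Y = (2 + 2 * (w / M)) powr (1 + \<nu>)"
  define g where "g = space_grad ?\<zeta> z"
  have X: "0 \<le> X"
    using rise_bounds[of R z] box_cutoff_bounds[of \<alpha> R z] by (simp add: X_def)
  have wM: "0 \<le> w / M"
    using w pos by simp
  have "(2 + 2 * (w / M)) powr 1 \<le> Y"
    unfolding Y_def using wM pos by (intro powr_mono) auto
  then have Y: "2 + 2 * (w / M) \<le> Y"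
    using wM by simp
  then have Y0: "0 < Y" using wM by linarith
  have time: "- H * time_deriv ?\<zeta> z \<le> X * (R powr (- \<alpha>) * M * (real m * C * Y))"
  proof -
    have "- H * time_deriv ?\<zeta> z \<le> H * (X * (real m * C / R powr \<alpha>))"
      using mult_left_mono[OF time_deriv_space_time_cutoff_ge[OF D R m, where z=z] H(1)] by (simp add: X_def)
    also have "\<dots> \<le> (M * Y) * (X * (real m * C / R powr \<alpha>))"
    proof (rule mult_right_mono)
      have "2 * w \<le> M * (2 + 2 * (w / M))"
        using pos by (simp add: field_simps)
      also have "\<dots> \<le> M * Y"
        using Y pos by (intro mult_left_mono) auto
      finally show "H \<le> M * Y" using H(2) by linarith
      show "0 \<le> X * (real m * C / R powr \<alpha>)"
        using X D(4) by simp
    qed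
    finally show ?thesis
      by (simp add: powr_minus_divide mult_ac)
  qed
  have space: "profile \<nu> M w * aform P g \<eta> + profile_deriv \<nu> M w * ?\<zeta> z * aform P \<eta> \<eta>
    \<le> X * (R powr (- \<alpha>) * M * (16 * c * (real m)\<^sup>2 * C\<^sup>2 / \<nu> * Y))"
  proof (cases "g = 0")
    case True
    have "0 \<le> \<nu> / M * (2 + 2 * (w / M)) powr (- (1 + \<nu>))"
      using pos by simp
    then have "profile_deriv \<nu> M w \<le> 0"
      using profile_deriv_le[OF pos(1,2) w] by linarith
    then have "profile_deriv \<nu> M w * ?\<zeta> z * aform P \<eta> \<eta> \<le> 0"
      using psd[of \<eta>] space_time_cutoff_bounds(1)[of \<alpha> m R z] by (intro mult_nonpos_nonneg) auto
    moreover have "0 \<le> X * (R powr (- \<alpha>) * M * (16 * c * (real m)\<^sup>2 * C\<^sup>2 / \<nu> * Y))"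
      using X Y0 pos by simp
    ultimately show ?thesis
      using True by (simp add: aform_def)
  next
    case False
    note supp = space_grad_space_time_cutoff_support[OF D R m False[unfolded g_def]]
    have n: "(norm g)\<^sup>2 \<le> ?\<zeta> z * X * (16 * (real m)\<^sup>2 * C\<^sup>2 / R\<^sup>2)"
      using norm_space_grad_space_time_cutoff[OF D R m, where z=z] supp(1) by (simp add: g_def X_def)
    \<comment> \<open>The bound on the gradient contains the cutoff as a factor, so a non-zero
      gradient forces a positive cutoff and makes the following divisions legitimate.\<close>
    have "0 < (norm g)\<^sup>2"
      using False by simp
    then have "?\<zeta> z \<noteq> 0"
      using n by auto
    then have \<zeta>: "0 < ?\<zeta> z"
      using space_time_cutoff_bounds(1)[of \<alpha> m R z] by linarith
    \<comment> \<open>\<open>e\<close> is the true absorbing coefficient, \<open>e0\<close> an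
      explicit lower bound for it whose factor \<open>?\<zeta> z\<close> will cancel.\<close>
    define e0 where "e0 = ?\<zeta> z * (\<nu> / (M * Y))"
    define e where "e = - profile_deriv \<nu> M w * ?\<zeta> z"
    have e0: "0 < e0"
      using \<zeta> pos Y0 by (simp add: e0_def)
    have "\<nu> / (M * Y) = \<nu> / M * (2 + 2 * (w / M)) powr (- (1 + \<nu>))"
      unfolding Y_def powr_minus_divide by simp
    also have "\<dots> \<le> - profile_deriv \<nu> M w"
      by (rule profile_deriv_le[OF pos(1,2) w])
    finally have "\<nu> / (M * Y) * ?\<zeta> z \<le> e"
      unfolding e_def using \<zeta> by (intro mult_right_mono) auto
    then have ee: "e0 \<le> e" "0 < e"
      using e0 by (auto simp: e0_def mult.commute)
    \<comment> \<open>The upper bound 2 of the profile is the factor 2 on the left of Young's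
      inequality.\<close>
    have "profile \<nu> M w * aform P g \<eta> \<le> 2 * \<bar>aform P g \<eta>\<bar>"
    proof -
      have "profile \<nu> M w * aform P g \<eta> \<le> profile \<nu> M w * \<bar>aform P g \<eta>\<bar>"
        using profile_bounds(1)[OF pos(1), of M w] by (intro mult_left_mono) auto
      also have "\<dots> \<le> 2 * \<bar>aform P g \<eta>\<bar>"
        using profile_bounds(2)[OF pos(1), of M w] by (intro mult_right_mono) auto
      finally show ?thesis .
    qed
    also have "\<dots> \<le> aform P g g / e + e * aform P \<eta> \<eta>"
      by (rule aform_young[OF sym psd ee(2)])
    finally have "profile \<nu> M w * aform P g \<eta> + profile_deriv \<nu> M w * ?\<zeta> z * aform P \<eta> \<eta> \<le> aform P g g / e"
      by (simp add: e_def)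
    also have "\<dots> \<le> aform P g g / e0"
      using ee e0 psd[of g] by (intro divide_left_mono) auto
    also have "\<dots> \<le> (c * R powr (2 - \<alpha>)) * (?\<zeta> z * X * (16 * (real m)\<^sup>2 * C\<^sup>2 / R\<^sup>2)) / e0"
    proof (rule divide_right_mono)
      have "aform P g g \<le> S * (norm g)\<^sup>2" by (rule upper)
      also have "\<dots> \<le> (c * R powr (2 - \<alpha>)) * (norm g)\<^sup>2"
        using annulus supp by (intro mult_right_mono) auto
      also have "\<dots> \<le> (c * R powr (2 - \<alpha>)) * (?\<zeta> z * X * (16 * (real m)\<^sup>2 * C\<^sup>2 / R\<^sup>2))"
        using n pos by (intro mult_left_mono) auto
      finally show "aform P g g \<le> (c * R powr (2 - \<alpha>)) * (?\<zeta> z * X * (16 * (real m)\<^sup>2 * C\<^sup>2 / R\<^sup>2))" .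
    qed (use e0 in simp)
    also have "\<dots> = X * (R powr (- \<alpha>) * M * (16 * c * (real m)\<^sup>2 * C\<^sup>2 / \<nu> * Y))"
    proof -
      have "R powr (2 - \<alpha>) / R\<^sup>2 = R powr (- \<alpha>)"
        using R by (simp add: powr_diff powr_minus_divide)
      then have "R powr (2 - \<alpha>) = R powr (- \<alpha>) * R\<^sup>2"
        using R by (simp add: field_simps)
      then show ?thesis
        unfolding e0_def using \<zeta> pos Y0 R by (simp add: field_simps)
    qed
    finally show ?thesis .
  qed
  show ?thesis
    using time space unfolding g_def X_def[symmetric] Y_def[symmetric] by (simp add: algebra_simps)
qed

section \<open>Elementary inequalities between powers\<close>

lemma one_plus_powr_le:
  fixes W p :: real
  assumes "0 \<le> W" "0 \<le> p"
  shows "(2 + 2 * W) powr p \<le> 4 powr p * (1 + W powr p)"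
proof -
  have "(2 + 2 * W) powr p \<le> (4 * max 1 W) powr p"
    using assms by (intro powr_mono2) auto
  also have "\<dots> \<le> 4 powr p * (1 + W powr p)"
    using assms by (simp add: powr_mult max_def)
  finally show ?thesis .
qed

lemma powr_le_one_plus_powr:
  fixes W p q :: real
  assumes "0 \<le> W" "0 \<le> p" "p \<le> q"
  shows "W powr p \<le> 1 + W powr q"
proof (cases "W \<le> 1")
  case True
  then have "W powr p \<le> 1"
    using assms by (intro powr_le1) auto
  then show ?thesis by (simp add: add_increasing2)
next
  case False
  then have "W powr p \<le> W powr q"
    using assms by (intro powr_mono) auto
  then show ?thesis by simp
qed

text \<open>This is why the cutoff carries a high power \<open>m\<close>.\<close>

lemma powr_absorb:
  fixes W p q \<kappa> L \<sigma> :: real and m :: nat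
  assumes "0 < p" "p < q" "0 < \<kappa>" "0 \<le> L" "0 \<le> \<sigma>" "\<sigma> \<le> 1" "0 \<le> W"
    and m: "3 \<le> m" "2 * (p / (q - p)) \<le> real (m - 2)"
  shows "L * \<sigma> ^ (m - 2) * W powr p \<le> \<kappa> * \<sigma> ^ m * W powr q + L * (L / \<kappa>) powr (p / (q - p))"
proof -
  have r0: "0 \<le> L * (L / \<kappa>) powr (p / (q - p))" "0 \<le> \<kappa> * \<sigma> ^ m * W powr q"
    using assms by auto
  consider "\<sigma> = 0 \<or> W = 0 \<or> L = 0" | "0 < \<sigma>" "0 < W" "0 < L"
    using assms by linarith
  then show ?thesis
  proof cases
    case 1
    \<comment> \<open>For \<sigma> = 0 this needs \<open>m - 2\<close> to be positive, hence
      \<open>3 \<le> m\<close>: at \<open>m = 2\<close> the power would be 1.\<close>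
    then have "L * \<sigma> ^ (m - 2) * W powr p = 0"
      using m(1) by (auto simp: power_0_left)
    then show ?thesis using r0 by linarith
  next
    case 2
    have sm: "\<sigma> ^ m = \<sigma> ^ (m - 2) * \<sigma>\<^sup>2"
    proof -
      have "m - 2 + 2 = m" using m(1) by simp
      then show ?thesis by (metis power_add)
    qed
    \<comment> \<open>Either \<open>W\<close> is so large that its power q absorbs the term, or
      \<open>W powr p\<close> is bounded by a negative power of \<sigma>, which \<sigma>^(m - 2)
      compensates by the lower bound on \<open>m\<close>.\<close>
    show ?thesis
    proof (cases "L \<le> \<kappa> * \<sigma>\<^sup>2 * W powr (q - p)")
      case True
      have "L * (\<sigma> ^ (m - 2) * W powr p) \<le> (\<kappa> * \<sigma>\<^sup>2 * W powr (q - p)) * (\<sigma> ^ (m - 2) * W powr p)"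
        using True assms by (intro mult_right_mono) auto
      also have "\<dots> = \<kappa> * \<sigma> ^ m * (W powr (q - p) * W powr p)"
        by (simp add: sm mult_ac)
      also have "W powr (q - p) * W powr p = W powr q"
        by (simp flip: powr_add)
      finally show ?thesis using r0 by (simp add: mult.assoc)
    next
      case False
      let ?r = "p / (q - p)"
      have "W powr (q - p) \<le> L / \<kappa> * \<sigma> powr (- 2)"
        using False 2 assms by (simp add: powr_minus_divide field_simps)
      then have "(W powr (q - p)) powr ?r \<le> (L / \<kappa> * \<sigma> powr (- 2)) powr ?r"
        using assms by (intro powr_mono2) auto
      also have "(W powr (q - p)) powr ?r = W powr p"
        using assms by (simp add: powr_powr)
      also have "(L / \<kappa> * \<sigma> powr (- 2)) powr ?r = (L / \<kappa>) powr ?r * \<sigma> powr (- 2 * ?r)"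
        using assms 2 by (simp only: powr_mult powr_powr)
      finally have "L * \<sigma> ^ (m - 2) * W powr p \<le> L * \<sigma> ^ (m - 2) * ((L / \<kappa>) powr ?r * \<sigma> powr (- 2 * ?r))"
        using assms by (intro mult_left_mono) auto
      also have "\<dots> = L * (L / \<kappa>) powr ?r * \<sigma> powr (real (m - 2) - 2 * ?r)"
      proof -
        have "\<sigma> ^ (m - 2) * \<sigma> powr (- 2 * ?r) = \<sigma> powr (real (m - 2) - 2 * ?r)"
          using 2 by (simp add: powr_realpow[symmetric] flip: powr_add)
        then show ?thesis by (simp add: mult_ac)
      qed
      also have "\<dots> \<le> L * (L / \<kappa>) powr ?r * 1"
        using assms m by (intro mult_left_mono powr_le1) auto
      finally show ?thesis using r0 by linarith
    qed
  qed
qed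

section \<open>Volume of the cylinder and choice of the scale\<close>

lemma measure_cyl_le:
  assumes "1 < R" "0 < \<alpha>"
  shows "measure lebesgue (cyl \<alpha> R :: (real \<times> (real^'n)) set)
    \<le> 2 * unit_ball_vol (real CARD('n)) * R powr (\<alpha> + real CARD('n))"
proof -
  have "measure lebesgue (cyl \<alpha> R :: (real \<times> (real^'n)) set) = measure lborel (cyl \<alpha> R :: (real \<times> (real^'n)) set)"
    by (rule measure_completion) (simp add: borel_compact compact_cyl)
  also have "\<dots> = measure (lborel \<Otimes>\<^sub>M lborel) ({1 / R..2 * R powr \<alpha>} \<times> (cball 0 R :: (real^'n) set))"
    by (simp add: lborel_prod cyl_def)
  also have "\<dots> = measure lborel {1 / R..2 * R powr \<alpha>} * measure lborel (cball 0 R :: (real^'n) set)"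
    by (simp add: measure_def lborel.emeasure_pair_measure_Times enn2real_mult)
  also have "\<dots> \<le> 2 * R powr \<alpha> * (unit_ball_vol (real CARD('n)) * R ^ CARD('n))"
  proof -
    have "1 \<le> R powr \<alpha>" "1 / R \<le> 1"
      using assms by (auto intro!: ge_one_powr_ge_zero)
    then show ?thesis
      using assms by (intro mult_mono) (auto simp: content_cball unit_ball_vol_nonneg)
  qed
  also have "\<dots> = 2 * unit_ball_vol (real CARD('n)) * R powr (\<alpha> + real CARD('n))"
    using assms by (simp add: powr_add powr_realpow mult_ac)
  finally show ?thesis .
qed

text \<open>Origin of the exponent in \<open>M\<close>: for \<delta> = 1 it solves R^(-\<alpha>) M =
  M^q. Rescaling by \<delta> leaves the factor \<open>\<delta> powr (1 - q)\<close>.\<close>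

lemma scale_powr:
  fixes \<delta> R \<alpha> q M :: real
  assumes "1 < R" "0 < \<delta>" "1 < q"
  defines "M \<equiv> \<delta> * R powr (- \<alpha> / (q - 1))"
  shows "0 < M" "R powr (- \<alpha>) * M = \<delta> powr (1 - q) * M powr q"
proof -
  show "0 < M" using assms by (simp add: M_def)
  have "M powr (q - 1) = \<delta> powr (q - 1) * R powr (- \<alpha>)"
    using assms by (simp add: M_def powr_mult powr_powr)
  moreover have "M powr q = M * M powr (q - 1)"
    using \<open>0 < M\<close> by (simp add: powr_diff)
  moreover have "\<delta> powr (1 - q) * \<delta> powr (q - 1) = 1"
    using assms by (simp flip: powr_add)
  ultimately show "R powr (- \<alpha>) * M = \<delta> powr (1 - q) * M powr q"
    by (simp add: mult_ac)
qed

text \<open>The powers of R combine to the exponent n - \<alpha>/(q - 1), which is non-positive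
  precisely under the assumed upper bound on q. In the critical case it is 0 and there is no decay
  in R.\<close>

lemma scale_volume:
  fixes \<delta> R \<alpha> q n :: real
  assumes "1 < R" "0 < \<delta>" "1 < q" "0 < n" "q \<le> 1 + \<alpha> / n"
  shows "(\<delta> * R powr (- \<alpha> / (q - 1))) powr q * R powr (\<alpha> + n) \<le> \<delta> powr q"
proof -
  have e: "- \<alpha> / (q - 1) * q + (\<alpha> + n) = n - \<alpha> / (q - 1)"
    using assms by (simp add: field_simps)
  have "n * (q - 1) \<le> \<alpha>"
    using assms by (simp add: field_simps)
  then have "n - \<alpha> / (q - 1) \<le> 0"
    using assms by (simp add: field_simps)
  then have "R powr (n - \<alpha> / (q - 1)) \<le> R powr 0"
    using assms by (intro powr_mono) auto
  then have "R powr (- \<alpha> / (q - 1) * q + (\<alpha> + n)) \<le> 1"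
    unfolding e using assms by simp
  then have "R powr (- \<alpha> / (q - 1) * q) * R powr (\<alpha> + n) \<le> 1"
    by (simp only: powr_add)
  then have "\<delta> powr q * (R powr (- \<alpha> / (q - 1) * q) * R powr (\<alpha> + n)) \<le> \<delta> powr q * 1"
    by (intro mult_left_mono) auto
  then show ?thesis
    using assms by (simp add: powr_mult powr_powr mult_ac)
qed

section \<open>Vanishing of the difference\<close>

locale difference_inequality =
  fixes a :: "real \<times> (real^'n) \<Rightarrow> real^'n^'n" and A u v ut vt :: "real \<times> (real^'n) \<Rightarrow> real"
    and ux vx :: "real \<times> (real^'n) \<Rightarrow> real^'n" and \<alpha> q c :: real
  assumes \<alpha>: "0 < \<alpha>" and q: "1 < q" "q \<le> 1 + \<alpha> / real CARD('n)"
    and a_meas: "\<And>i j. (\<lambda>z. a z $ i $ j) \<in> borel_measurable (lebesgue_on half_space)"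
    and a_sym: "AE z in lebesgue_on half_space. \<forall>i j. a z $ i $ j = a z $ j $ i"
    and a_upper: "AE z in lebesgue_on half_space.
      \<forall>\<xi>. 0 \<le> aform (a z) \<xi> \<xi> \<and> aform (a z) \<xi> \<xi> \<le> A z * (norm \<xi>)\<^sup>2"
    and A_bounded: "locally_bounded_on half_space A"
    and c: "0 < c"
    and A_annulus: "\<And>R. 1 < R \<Longrightarrow> AE z in lebesgue_on half_space.
      R / 2 < norm (snd z) \<and> norm (snd z) < R \<longrightarrow> A z \<le> c * R powr (2 - \<alpha>)"
    and uv_meas: "u \<in> borel_measurable (lebesgue_on half_space)" "v \<in> borel_measurable (lebesgue_on half_space)"
    and W: "W_loc a q u ut ux" "W_loc a q v vt vx"
    and weak: "\<And>\<phi>. test_function \<phi> \<Longrightarrow> (\<And>z. 0 \<le> \<phi> z) \<Longrightarrow>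
      weak_functional a q v vt vx \<phi> \<le> weak_functional a q u ut ux \<phi>"
    and ordered: "AE z in lebesgue_on half_space. v z \<le> u z"
begin

abbreviation "gap_power z \<equiv> \<bar>u z - v z\<bar> powr q"

definition scale :: "real \<Rightarrow> real \<Rightarrow> real" where
  "scale \<delta> R = \<delta> * R powr (- \<alpha> / (q - 1))"

text \<open>The exponent \<open>(1 + q) / 2\<close> is 1 + \<nu> for \<nu> = (q - 1)/2, midway
  between 1 and q. The indicator records that only the shell contributes.\<close>

definition majorant :: "nat \<Rightarrow> real \<Rightarrow> real \<Rightarrow> real \<Rightarrow> real \<times> (real^'n) \<Rightarrow> real" where
  "majorant m L \<delta> R z = indicator (shell \<alpha> R) z * (rise R z * box_cutoff \<alpha> R z ^ (m - 2)) *
     (\<delta> powr (1 - q) * L * scale \<delta> R powr q * (1 + (\<bar>u z - v z\<bar> / scale \<delta> R) powr ((1 + q) / 2)))"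

lemma scale_pos: "1 < R \<Longrightarrow> 0 < \<delta> \<Longrightarrow> 0 < scale \<delta> R"
  by (simp add: scale_def)

lemma gap_power_scale:
  assumes "1 < R" "0 < \<delta>"
  shows "scale \<delta> R powr q * (\<bar>u z - v z\<bar> / scale \<delta> R) powr q = gap_power z"
  using scale_pos[OF assms] by (simp add: powr_divide)

lemma borel_measurable_cutoffs:
  "(rise R :: real \<times> (real^'n) \<Rightarrow> real) \<in> borel_measurable borel"
  "(box_cutoff \<alpha> R :: real \<times> (real^'n) \<Rightarrow> real) \<in> borel_measurable borel"
  "(space_time_cutoff \<alpha> m R :: real \<times> (real^'n) \<Rightarrow> real) \<in> borel_measurable borel"
  "(shell \<alpha> R :: (real \<times> (real^'n)) set) \<in> sets borel"
proof -
  have "isCont cutoff s" for s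
    using cutoff_derivative by (metis DERIV_isCont)
  then have [measurable]: "cutoff \<in> borel_measurable borel"
    by (intro borel_measurable_continuous_onI continuous_at_imp_continuous_on) simp
  have [measurable]: "(\<lambda>z::real \<times> (real^'n). fst z) \<in> borel_measurable borel"
    "(\<lambda>z::real \<times> (real^'n). snd z \<bullet> snd z) \<in> borel_measurable borel"
    by (intro borel_measurable_continuous_onI continuous_intros)+
  show r: "(rise R :: real \<times> (real^'n) \<Rightarrow> real) \<in> borel_measurable borel"
    unfolding rise_def[abs_def] by measurable
  show b: "(box_cutoff \<alpha> R :: real \<times> (real^'n) \<Rightarrow> real) \<in> borel_measurable borel"
    unfolding box_cutoff_def[abs_def] by measurable
  show "(space_time_cutoff \<alpha> m R :: real \<times> (real^'n) \<Rightarrow> real) \<in> borel_measurable borel"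
    unfolding space_time_cutoff_def[abs_def] by (intro borel_measurable_times borel_measurable_power r b)
  have "open {z::real \<times> (real^'n). R powr \<alpha> < fst z \<or> R\<^sup>2 / 2 < snd z \<bullet> snd z}"
    by (intro open_Collect_disj open_Collect_less continuous_intros)
  moreover have "shell \<alpha> R = cyl \<alpha> R \<inter> {z::real \<times> (real^'n). R powr \<alpha> < fst z \<or> R\<^sup>2 / 2 < snd z \<bullet> snd z}"
    by (auto simp: shell_def)
  ultimately show "(shell \<alpha> R :: (real \<times> (real^'n)) set) \<in> sets borel"
    by (simp add: borel_compact compact_cyl sets.Int)
qed

lemma measurable_lebesgue_on_borel:
  fixes f :: "real \<times> (real^'n) \<Rightarrow> real"
  assumes "f \<in> borel_measurable borel"
  shows "f \<in> borel_measurable (lebesgue_on S)"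
  using assms by (intro measurable_restrict_space1 measurable_completion) simp

lemma cyl_subset: "1 < R \<Longrightarrow> (cyl \<alpha> R :: (real \<times> (real^'n)) set) \<subseteq> half_space"
  by (auto simp: cyl_def half_space_def intro: less_le_trans[of 0 "1 / R"])

text \<open>\<open>L\<close> is obtained before R and \<delta>: it depends only on m, q, c and the
  slope of \<open>cutoff\<close>. The integrated form of \<open>energy_pointwise\<close> is compared
  with the lower bound for the difference of the nonlinear terms.\<close>

lemma energy_estimate:
  assumes m: "2 \<le> m"
  obtains L where "0 \<le> L"
    "\<And>R. 1 < R \<Longrightarrow> integrable (lebesgue_on half_space) (\<lambda>z. gap_power z * space_time_cutoff \<alpha> m R z)"
    "\<And>R \<delta>. 1 < R \<Longrightarrow> 0 < \<delta> \<Longrightarrow> integrable (lebesgue_on half_space) (majorant m L \<delta> R)"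
    "\<And>R \<delta>. 1 < R \<Longrightarrow> 0 < \<delta> \<Longrightarrow>
      2 powr (- q) * (LINT z|lebesgue_on half_space. gap_power z * space_time_cutoff \<alpha> m R z)
        \<le> integral\<^sup>L (lebesgue_on half_space) (majorant m L \<delta> R)"
proof -
  obtain D C where D: "\<And>s. (cutoff has_real_derivative D s) (at s)" "\<And>s. D s \<le> 0" "\<And>s. - C \<le> D s" "0 \<le> C"
      "\<And>s. \<not> (1 < s \<and> s < 2) \<Longrightarrow> D s = 0"
    using cutoff_derivative by metis
  define \<nu> where "\<nu> = (q - 1) / 2"
  have \<nu>: "0 < \<nu>" "1 + \<nu> = (1 + q) / 2"
    using q by (simp_all add: \<nu>_def field_simps)
  define L0 where "L0 = real m * C + 16 * c * (real m)\<^sup>2 * C\<^sup>2 / \<nu>"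
  have L0: "0 \<le> L0"
    using D(4) c \<nu> by (simp add: L0_def)
  define L where "L = L0 * 4 powr (1 + \<nu>)"
  have L: "0 \<le> L" using L0 by (simp add: L_def)
  have *: "integrable (lebesgue_on half_space) (\<lambda>z. gap_power z * space_time_cutoff \<alpha> m R z) \<and>
      integrable (lebesgue_on half_space) (majorant m L \<delta> R) \<and>
      2 powr (- q) * (LINT z|lebesgue_on half_space. gap_power z * space_time_cutoff \<alpha> m R z)
        \<le> integral\<^sup>L (lebesgue_on half_space) (majorant m L \<delta> R)"
    if R: "1 < R" and \<delta>: "0 < \<delta>" for R \<delta>
  proof -
    define M where "M = scale \<delta> R"
    have M: "0 < M" unfolding M_def by (rule scale_pos[OF R \<delta>])
    \<comment> \<open>A bounded domain slightly larger than the cylinder. Its lower end 1/(2R) keeps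
      it inside the half-space, and being a connected open box it is covered by
      \<open>W_loc\<close>.\<close>
    define \<Omega> where "\<Omega> = {1 / (2 * R)<..<3 * R powr \<alpha>} \<times> ball (0 :: real^'n) (2 * R)"
    have T: "1 \<le> R powr \<alpha>"
      using R \<alpha> by (intro ge_one_powr_ge_zero) auto
    have R2: "1 / (2 * R) < 1"
      using R by (simp add: field_simps)
    have \<Omega>_dom: "open \<Omega>" "connected \<Omega>" "bounded \<Omega>"
      unfolding \<Omega>_def by (intro open_Times connected_Times bounded_Times; simp)+
    have "(R powr \<alpha>, 0) \<in> \<Omega>"
      using R T less_le_trans[OF R2 T] by (simp add: \<Omega>_def)
    then have \<Omega>_ne: "\<Omega> \<noteq> {}" by auto
    have \<Omega>_sub: "\<Omega> \<subseteq> half_space"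
      using R by (auto simp: \<Omega>_def half_space_def intro: less_trans[of 0 "1 / (2 * R)"])
    have cyl_sub: "cyl \<alpha> R \<subseteq> \<Omega>"
    proof
      fix z :: "real \<times> (real^'n)" assume z: "z \<in> cyl \<alpha> R"
      have "1 / (2 * R) < 1 / R" "2 * R powr \<alpha> < 3 * R powr \<alpha>"
        using R T by (simp_all add: field_simps)
      with z R show "z \<in> \<Omega>"
        by (cases z) (auto simp: cyl_def \<Omega>_def)
    qed
    obtain H where H: "\<And>s. (H has_real_derivative profile \<nu> M s) (at s)"
        "\<And>s. 0 \<le> s \<Longrightarrow> 0 \<le> H s" "\<And>s. 0 \<le> s \<Longrightarrow> H s \<le> 2 * s"
      using antiderivative_exists[OF DERIV_isCont[OF profile_has_derivative[OF M]]
          order_trans[OF zero_le_one profile_bounds(1)[OF \<nu>(1)]] profile_bounds(2)[OF \<nu>(1)]]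
      by blast
    let ?\<zeta> = "space_time_cutoff \<alpha> m R :: real \<times> (real^'n) \<Rightarrow> real"
    \<comment> \<open>The last parameter adds the bound 2 of the profile and the bound
      \<open>2 * \<nu> / M\<close> of its derivative, so that it serves both. It is finite for each
      R, which is enough: it enters the limit argument but not the estimate.\<close>
    interpret test_data \<Omega> "cyl \<alpha> R" ?\<zeta> "profile \<nu> M" "profile_deriv \<nu> M" H "2 + 2 * \<nu> / M"
    proof
      show "0 \<le> profile \<nu> M s" "profile \<nu> M s \<le> 2 + 2 * \<nu> / M" for s
        using profile_bounds[OF \<nu>(1), of M s] divide_nonneg_pos[of "2 * \<nu>" M] \<nu>(1) M by linarith+
      show "\<bar>profile_deriv \<nu> M s\<bar> \<le> 2 + 2 * \<nu> / M" for s
        using profile_deriv_bound[OF \<nu>(1) M, of s] by simp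
      show "?\<zeta> z = 0" if "z \<notin> cyl \<alpha> R" for z
        using space_time_cutoff_eq_0[OF R _ that] m by simp
    qed (rule \<Omega>_dom \<Omega>_sub cyl_sub compact_cyl smooth_on_space_time_cutoff space_time_cutoff_bounds
        smooth_on_profile[OF M] profile_has_derivative[OF M] profile_deriv_continuous[OF M] H(1) | assumption)+
    let ?M = "lebesgue_on \<Omega>"
    interpret finite_measure ?M
      by (rule finite_measure_lebesgue_on_bounded) (use \<Omega> in auto)
    have \<Omega>_sets: "\<Omega> \<in> sets lebesgue"
      using \<Omega>(1) by (intro sets_completionI_sets) simp
    note restrict = AE_lebesgue_on_subset[OF _ \<Omega>_sub half_space_sets \<Omega>_sets]
    have am: "(\<lambda>z. a z $ i $ j) \<in> borel_measurable ?M" for i j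
      by (rule measurable_restrict_mono[OF a_meas \<Omega>_sub])
    have Wu: "W_space a q \<Omega> u ut ux" and Wv: "W_space a q \<Omega> v vt vx"
      using W[unfolded W_loc_def, THEN spec[of _ \<Omega>]] \<Omega>_dom \<Omega>_ne \<Omega>_sub by simp_all
    have [measurable]: "u \<in> borel_measurable ?M" "v \<in> borel_measurable ?M"
      by (rule measurable_restrict_mono[OF _ \<Omega>_sub], rule uv_meas)+
    note lim = weak_inequality_limit[OF q(1) am restrict[OF a_sym] restrict[OF a_upper] A_bounded Wu Wv weak]

    have ig: "integrable ?M gap_power"
    proof (rule Bochner_Integration.integrable_bound)
      show "integrable ?M (\<lambda>z. 2 powr q * (\<bar>u z\<bar> powr q + \<bar>v z\<bar> powr q))"
        using Wu Wv q unfolding W_space_def W_finite_def by (auto simp: max_absorb2)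
      show "AE z in ?M. norm (gap_power z) \<le> norm (2 powr q * (\<bar>u z\<bar> powr q + \<bar>v z\<bar> powr q))"
      proof (rule AE_I2)
        fix z
        have "norm (gap_power z) \<le> 2 powr q * (\<bar>u z\<bar> powr q + \<bar>v z\<bar> powr q)"
          using abs_diff_powr_le[of q "u z" "v z"] q by simp
        then show "norm (gap_power z) \<le> norm (2 powr q * (\<bar>u z\<bar> powr q + \<bar>v z\<bar> powr q))"
          unfolding real_norm_def by (rule order_trans[OF _ abs_ge_self])
      qed
    qed measurable
    have igz: "integrable ?M (\<lambda>z. ?\<zeta> z * gap_power z)"
      by (rule integrable_bounded_mult[OF ig measurable_\<zeta>(1), where B=1])
         (simp add: abs_of_nonneg[OF space_time_cutoff_bounds(1)] space_time_cutoff_bounds(2))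
    have [measurable]: "rise R \<in> borel_measurable ?M" "box_cutoff \<alpha> R \<in> borel_measurable ?M"
      "(indicator (shell \<alpha> R) :: _ \<Rightarrow> real) \<in> borel_measurable ?M"
      by (intro measurable_lebesgue_on_borel borel_measurable_indicator borel_measurable_cutoffs)+
    have ip: "integrable ?M (\<lambda>z. \<delta> powr (1 - q) * L * M powr q * (1 + (\<bar>u z - v z\<bar> / M) powr ((1 + q) / 2)))"
    proof (rule integrable_mult_right, rule Bochner_Integration.integrable_bound)
      show "integrable ?M (\<lambda>z. 2 + gap_power z / M powr q)"
        using ig by simp
      show "AE z in ?M. norm (1 + (\<bar>u z - v z\<bar> / M) powr ((1 + q) / 2)) \<le> norm (2 + gap_power z / M powr q)"
      proof (rule AE_I2)
        fix z
        have "(\<bar>u z - v z\<bar> / M) powr ((1 + q) / 2) \<le> 1 + (\<bar>u z - v z\<bar> / M) powr q"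
          using q M by (intro powr_le_one_plus_powr) auto
        also have "\<dots> = 1 + gap_power z / M powr q"
          using M by (simp add: powr_divide)
        finally have "1 + (\<bar>u z - v z\<bar> / M) powr ((1 + q) / 2) \<le> 2 + gap_power z / M powr q" by simp
        then show "norm (1 + (\<bar>u z - v z\<bar> / M) powr ((1 + q) / 2)) \<le> norm (2 + gap_power z / M powr q)"
          by (simp add: add_nonneg_nonneg)
      qed
    qed measurable
    have im: "integrable ?M (majorant m L \<delta> R)"
      unfolding majorant_def[abs_def] M_def[symmetric]
    proof (rule integrable_bounded_mult[OF ip, of _ 1])
      show "\<bar>indicator (shell \<alpha> R) z * (rise R z * box_cutoff \<alpha> R z ^ (m - 2))\<bar> \<le> 1" for z :: "real \<times> (real^'n)"
        using rise_bounds[of R z] box_cutoff_bounds[of \<alpha> R z]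
        by (auto simp: indicator_def power_le_one abs_mult intro!: mult_le_one)
    qed measurable

    have "2 powr (- q) * (LINT z|?M. ?\<zeta> z * gap_power z) = (LINT z|?M. 2 powr (- q) * (?\<zeta> z * gap_power z))"
      by simp
    \<comment> \<open>The profile is at least 1 and the difference of the nonlinear terms is
      non-negative, so inserting the profile only increases the integrand.\<close>
    also have "\<dots> \<le> (LINT z|?M. profile \<nu> M (u z - v z) * ?\<zeta> z *
        (\<bar>u z\<bar> powr (q - 1) * u z - \<bar>v z\<bar> powr (q - 1) * v z))"
    proof (rule integral_mono_AE[OF integrable_mult_right[OF igz] lim(1)])
      show "AE z in ?M. 2 powr (- q) * (?\<zeta> z * gap_power z) \<le> profile \<nu> M (u z - v z) * ?\<zeta> z *
        (\<bar>u z\<bar> powr (q - 1) * u z - \<bar>v z\<bar> powr (q - 1) * v z)"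
        using restrict[OF ordered]
      proof eventually_elim
        case (elim z)
        define N where "N = \<bar>u z\<bar> powr (q - 1) * u z - \<bar>v z\<bar> powr (q - 1) * v z"
        have N: "2 powr (- q) * gap_power z \<le> N"
          using signed_power_diff_ge[OF q(1) elim] elim by (simp add: N_def)
        moreover have "0 \<le> 2 powr (- q) * gap_power z" by simp
        ultimately have "0 \<le> N" by linarith
        have "2 powr (- q) * (?\<zeta> z * gap_power z) = ?\<zeta> z * (2 powr (- q) * gap_power z)"
          by simp
        also have "\<dots> \<le> ?\<zeta> z * (profile \<nu> M (u z - v z) * N)"
        proof (rule mult_left_mono)
          have "1 * N \<le> profile \<nu> M (u z - v z) * N"
            using profile_bounds(1)[OF \<nu>(1)] \<open>0 \<le> N\<close> by (rule mult_right_mono)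
          then show "2 powr (- q) * gap_power z \<le> profile \<nu> M (u z - v z) * N"
            using N by simp
        qed (rule space_time_cutoff_bounds)
        finally show ?case by (simp add: N_def mult_ac)
      qed
    qed
    also note lim(3)
    also have "(LINT z|?M. profile \<nu> M (u z - v z) * aform (a z) (space_grad ?\<zeta> z) (ux z - vx z)
        + profile_deriv \<nu> M (u z - v z) * ?\<zeta> z * aform (a z) (ux z - vx z) (ux z - vx z)
        - H (u z - v z) * time_deriv ?\<zeta> z) \<le> integral\<^sup>L ?M (majorant m L \<delta> R)"
    proof (rule integral_mono_AE[OF lim(2) im])
      show "AE z in ?M. profile \<nu> M (u z - v z) * aform (a z) (space_grad ?\<zeta> z) (ux z - vx z)
        + profile_deriv \<nu> M (u z - v z) * ?\<zeta> z * aform (a z) (ux z - vx z) (ux z - vx z)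
        - H (u z - v z) * time_deriv ?\<zeta> z \<le> majorant m L \<delta> R z"
        using restrict[OF ordered] restrict[OF a_sym] restrict[OF a_upper] restrict[OF A_annulus[OF R]]
      proof eventually_elim
        case (elim z)
        define w where "w = u z - v z"
        have w: "0 \<le> w" using elim by (simp add: w_def)
        have "profile \<nu> M w * aform (a z) (space_grad ?\<zeta> z) (ux z - vx z)
          + profile_deriv \<nu> M w * ?\<zeta> z * aform (a z) (ux z - vx z) (ux z - vx z) - H w * time_deriv ?\<zeta> z
          \<le> indicator (shell \<alpha> R) z * (rise R z * box_cutoff \<alpha> R z ^ (m - 2)) *
            (R powr (- \<alpha>) * M * (L0 * (2 + 2 * (w / M)) powr (1 + \<nu>)))"
          unfolding L0_def
          by (rule energy_pointwise[OF D R m \<nu>(1) M less_imp_le[OF c], where S="A z"])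
             (use elim w H in auto)
        also have "\<dots> \<le> majorant m L \<delta> R z"
          unfolding majorant_def M_def[symmetric]
        proof (rule mult_left_mono)
          have "L0 * (2 + 2 * (w / M)) powr (1 + \<nu>) \<le> L0 * (4 powr (1 + \<nu>) * (1 + (w / M) powr (1 + \<nu>)))"
            using w M \<nu> L0 by (intro mult_left_mono one_plus_powr_le) auto
          then have le: "\<delta> powr (1 - q) * M powr q * (L0 * (2 + 2 * (w / M)) powr (1 + \<nu>))
            \<le> \<delta> powr (1 - q) * M powr q * (L0 * (4 powr (1 + \<nu>) * (1 + (w / M) powr (1 + \<nu>))))"
            by (rule mult_left_mono) simp
          have e: "R powr (- \<alpha>) * M = \<delta> powr (1 - q) * M powr q"
            unfolding M_def scale_def by (rule scale_powr(2)[OF R \<delta> q(1)])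
          show "R powr (- \<alpha>) * M * (L0 * (2 + 2 * (w / M)) powr (1 + \<nu>))
            \<le> \<delta> powr (1 - q) * L * M powr q * (1 + (\<bar>u z - v z\<bar> / M) powr ((1 + q) / 2))"
            unfolding e L_def \<nu>(2)[symmetric] w_def[symmetric] abs_of_nonneg[OF w] using le by (simp only: mult_ac)
          show "0 \<le> indicator (shell \<alpha> R) z * (rise R z * box_cutoff \<alpha> R z ^ (m - 2))"
            using rise_bounds[of R z] box_cutoff_bounds[of \<alpha> R z] by simp
        qed
        finally show ?case unfolding w_def .
      qed
    qed
    finally have fin: "2 powr (- q) * (LINT z|?M. ?\<zeta> z * gap_power z) \<le> integral\<^sup>L ?M (majorant m L \<delta> R)" .
    have s1: "?\<zeta> z * gap_power z = 0" and s2: "majorant m L \<delta> R z = 0" if "z \<notin> \<Omega>" for z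
    proof -
      have "z \<notin> cyl \<alpha> R" using that cyl_sub by auto
      then show "?\<zeta> z * gap_power z = 0" "majorant m L \<delta> R z = 0"
        by (simp_all add: \<zeta>(3) majorant_def shell_def)
    qed
    show ?thesis
      using fin igz im
        integral_lebesgue_on_support[OF \<Omega>_sub half_space_sets \<Omega>_sets s1]
        integrable_lebesgue_on_support[OF \<Omega>_sub half_space_sets \<Omega>_sets s1]
        integral_lebesgue_on_support[OF \<Omega>_sub half_space_sets \<Omega>_sets s2]
        integrable_lebesgue_on_support[OF \<Omega>_sub half_space_sets \<Omega>_sets s2]
      by (simp add: mult.commute)
  qed
  show thesis
  proof (rule that[OF L])
    fix R \<delta> :: real assume "1 < R"
    show "integrable (lebesgue_on half_space) (\<lambda>z. gap_power z * space_time_cutoff \<alpha> m R z)"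
      using *[OF \<open>1 < R\<close> zero_less_one] by blast
    assume "0 < \<delta>"
    show "integrable (lebesgue_on half_space) (majorant m L \<delta> R)"
      "2 powr (- q) * (LINT z|lebesgue_on half_space. gap_power z * space_time_cutoff \<alpha> m R z)
        \<le> integral\<^sup>L (lebesgue_on half_space) (majorant m L \<delta> R)"
      using *[OF \<open>1 < R\<close> \<open>0 < \<delta>\<close>] by blast+
  qed
qed

section \<open>Exhaustion of the half-space\<close>

definition radius :: "nat \<Rightarrow> real" where
  "radius k = real k + 2"

text \<open>The shift by 2 in \<open>radius\<close> makes the inequality strict already at
  \<open>k = 0\<close>.\<close>

lemma radius_gt_1: "1 < radius k"
  by (simp add: radius_def)

lemma radius_at_top: "filterlim radius at_top sequentially"
  unfolding radius_def[abs_def]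
  by (rule filterlim_at_top_mono[OF filterlim_real_sequentially]) simp

lemma eventually_inside:
  fixes z :: "real \<times> (real^'n)"
  assumes "z \<in> half_space"
  shows "\<forall>\<^sub>F k in sequentially. 2 \<le> radius k * fst z \<and> fst z \<le> radius k powr \<alpha> \<and> snd z \<bullet> snd z \<le> (radius k)\<^sup>2 / 2"
proof -
  have t: "0 < fst z"
    using assms by (auto simp: half_space_def)
  \<comment> \<open>Three thresholds: the first saturates \<open>rise\<close>, the second puts the
    time below R^\<alpha>, and the third, together with R \<le> R^2, puts |x|^2 below R^2/2.\<close>
  define r where "r = max (2 / fst z) (max (fst z powr (1 / \<alpha>)) (1 + 2 * (snd z \<bullet> snd z)))"
  have "\<forall>\<^sub>F k in sequentially. r \<le> radius k"
    using radius_at_top by (simp add: filterlim_at_top)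
  then show ?thesis
  proof eventually_elim
    case (elim k)
    then have k: "2 / fst z \<le> radius k" "fst z powr (1 / \<alpha>) \<le> radius k" "1 + 2 * (snd z \<bullet> snd z) \<le> radius k"
      by (auto simp: r_def)
    have "2 \<le> radius k * fst z"
      using k(1) t by (simp add: field_simps)
    moreover have "fst z \<le> radius k powr \<alpha>"
    proof -
      have "(fst z powr (1 / \<alpha>)) powr \<alpha> \<le> radius k powr \<alpha>"
        using k(2) \<alpha> by (intro powr_mono2) auto
      then show ?thesis
        using \<alpha> t by (simp add: powr_powr)
    qed
    moreover have "snd z \<bullet> snd z \<le> (radius k)\<^sup>2 / 2"
    proof -
      have "radius k * 1 \<le> radius k * radius k"
        using radius_gt_1[of k] by (intro mult_left_mono) auto
      then show ?thesis
        using k(3) by (simp add: power2_eq_square)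
    qed
    ultimately show ?case by blast
  qed
qed

lemma space_time_cutoff_tendsto:
  fixes z :: "real \<times> (real^'n)"
  assumes "z \<in> half_space"
  shows "(\<lambda>k. space_time_cutoff \<alpha> m (radius k) z) \<longlonglongrightarrow> 1"
proof (rule tendsto_eventually, use eventually_inside[OF assms] in eventually_elim)
  case (elim k)
  have "0 < radius k powr \<alpha>" "0 < (radius k)\<^sup>2"
    using radius_gt_1[of k] by auto
  then have "fst z / radius k powr \<alpha> \<le> 1" "2 * (snd z \<bullet> snd z) / (radius k)\<^sup>2 \<le> 1"
    using elim by (simp_all add: divide_le_eq)
  then show ?case
    using elim by (simp add: space_time_cutoff_def rise_def box_cutoff_def cutoff_eq_1 cutoff_eq_0)
qed

lemma shell_tendsto:
  fixes z :: "real \<times> (real^'n)"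
  assumes "z \<in> half_space"
  shows "(\<lambda>k. indicator (shell \<alpha> (radius k)) z :: real) \<longlonglongrightarrow> 0"
proof (rule tendsto_eventually, use eventually_inside[OF assms] in eventually_elim)
  case (elim k)
  then show ?case
    by (simp add: shell_def indicator_def)
qed

lemma measure_cyl_half_space:
  assumes "1 < R"
  shows "measure (lebesgue_on half_space) (cyl \<alpha> R :: (real \<times> (real^'n)) set)
      \<le> 2 * unit_ball_vol (real CARD('n)) * R powr (\<alpha> + real CARD('n))"
    and "integrable (lebesgue_on half_space) (indicator (cyl \<alpha> R) :: real \<times> (real^'n) \<Rightarrow> real)"
    and "integral\<^sup>L (lebesgue_on half_space) (indicator (cyl \<alpha> R) :: real \<times> (real^'n) \<Rightarrow> real)
      = measure (lebesgue_on half_space) (cyl \<alpha> R :: (real \<times> (real^'n)) set)"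
proof -
  have s: "(cyl \<alpha> R :: (real \<times> (real^'n)) set) \<in> sets lebesgue"
    by (intro sets_completionI_sets) (simp add: borel_compact compact_cyl)
  note sub = cyl_subset[OF assms]
  have s': "(cyl \<alpha> R :: (real \<times> (real^'n)) set) \<in> sets (lebesgue_on half_space)"
    using s sub by (simp add: sets_restrict_space_iff half_space_sets)
  show "measure (lebesgue_on half_space) (cyl \<alpha> R :: (real \<times> (real^'n)) set)
      \<le> 2 * unit_ball_vol (real CARD('n)) * R powr (\<alpha> + real CARD('n))"
    using sub by (simp add: measure_restrict_space half_space_sets measure_cyl_le[OF assms \<alpha>])
  have "emeasure (lebesgue_on half_space) (cyl \<alpha> R :: (real \<times> (real^'n)) set) = emeasure lebesgue (cyl \<alpha> R :: (real \<times> (real^'n)) set)"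
    using sub by (simp add: emeasure_restrict_space half_space_sets)
  also have "\<dots> < \<infinity>"
    using fmeasurableD2[OF lmeasurable_compact[OF compact_cyl]] by (simp add: less_top)
  finally show "integrable (lebesgue_on half_space) (indicator (cyl \<alpha> R) :: real \<times> (real^'n) \<Rightarrow> real)"
    using s' by (intro integrable_real_indicator) auto
  show "integral\<^sup>L (lebesgue_on half_space) (indicator (cyl \<alpha> R) :: real \<times> (real^'n) \<Rightarrow> real)
      = measure (lebesgue_on half_space) (cyl \<alpha> R :: (real \<times> (real^'n)) set)"
    using sub by (simp add: space_restrict_space Int_absorb2)
qed

lemma scale_measure_le:
  assumes "1 < R" "0 < \<delta>"
  shows "scale \<delta> R powr q * measure (lebesgue_on half_space) (cyl \<alpha> R :: (real \<times> (real^'n)) set)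
    \<le> 2 * unit_ball_vol (real CARD('n)) * \<delta> powr q"
proof -
  have "scale \<delta> R powr q * measure (lebesgue_on half_space) (cyl \<alpha> R :: (real \<times> (real^'n)) set)
    \<le> scale \<delta> R powr q * (2 * unit_ball_vol (real CARD('n)) * R powr (\<alpha> + real CARD('n)))"
    by (intro mult_left_mono measure_cyl_half_space(1)[OF assms(1)]) simp
  also have "\<dots> = 2 * unit_ball_vol (real CARD('n)) * (scale \<delta> R powr q * R powr (\<alpha> + real CARD('n)))"
    by (simp add: mult_ac)
  also have "\<dots> \<le> 2 * unit_ball_vol (real CARD('n)) * \<delta> powr q"
    unfolding scale_def using assms q
    by (intro mult_left_mono scale_volume) (auto simp: unit_ball_vol_nonneg)
  finally show ?thesis .
qed

lemma gap_power_measurable: "gap_power \<in> borel_measurable (lebesgue_on half_space)"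
  using uv_meas by measurable

text \<open>For each R the integral against the cutoff is already finite, so part of the majorant
  can be subtracted from the left. The resulting bound does not depend on R, and Fatou's lemma
  carries it to the whole half-space.\<close>

lemma integrable_gap_power: "integrable (lebesgue_on half_space) gap_power"
proof -
  let ?M = "lebesgue_on (half_space :: (real \<times> (real^'n)) set)"
  define p where "p = (1 + q) / 2"
  have p: "0 < p" "p < q" using q by (simp_all add: p_def field_simps)
  \<comment> \<open>The smallest convenient power for \<open>powr_absorb\<close>: the 3 secures a
    positive exponent \<open>m - 2\<close>, the ceiling its lower bound.\<close>
  define m where "m = 3 + nat \<lceil>2 * (p / (q - p))\<rceil>"
  have m: "3 \<le> m" "2 * (p / (q - p)) \<le> real (m - 2)"
    unfolding m_def by (simp, linarith)
  have m2: "2 \<le> m" using m(1) by simp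
  obtain L where L: "0 \<le> L"
    "\<And>R. 1 < R \<Longrightarrow> integrable ?M (\<lambda>z. gap_power z * space_time_cutoff \<alpha> m R z)"
    "\<And>R \<delta>. 1 < R \<Longrightarrow> 0 < \<delta> \<Longrightarrow> integrable ?M (majorant m L \<delta> R)"
    "\<And>R \<delta>. 1 < R \<Longrightarrow> 0 < \<delta> \<Longrightarrow> 2 powr (- q) * (LINT z|?M. gap_power z * space_time_cutoff \<alpha> m R z)
        \<le> integral\<^sup>L ?M (majorant m L \<delta> R)"
    using energy_estimate[OF m2] by blast
  \<comment> \<open>Half of the coefficient on the left of the energy estimate: one half pays for
    the absorption, the other half survives.\<close>
  define \<kappa> where "\<kappa> = 2 powr (- q) / 2"
  have \<kappa>: "0 < \<kappa>" by (simp add: \<kappa>_def)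
  \<comment> \<open>The first \<open>L\<close> bounds the contribution of the 1 in
    \<open>1 + W powr p\<close>; the second summand is the remainder left by
    \<open>powr_absorb\<close>.\<close>
  define L1 where "L1 = L + L * (L / \<kappa>) powr (p / (q - p))"
  have L1: "0 \<le> L1" using L(1) by (simp add: L1_def)
  define V where "V = 2 * unit_ball_vol (real CARD('n))"
  have bound: "(LINT z|?M. gap_power z * space_time_cutoff \<alpha> m R z) \<le> L1 * V / \<kappa>" if R: "1 < R" for R
  proof -
    define M where "M = scale 1 R"
    have M: "0 < M" unfolding M_def by (rule scale_pos[OF R zero_less_one])
    have le: "majorant m L 1 R z \<le> L1 * M powr q * indicator (cyl \<alpha> R) z + \<kappa> * (gap_power z * space_time_cutoff \<alpha> m R z)" for z
    proof (cases "z \<in> shell \<alpha> R")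
      case False
      have "0 \<le> L1 * M powr q * indicator (cyl \<alpha> R) z + \<kappa> * (gap_power z * space_time_cutoff \<alpha> m R z)"
        using L1 \<kappa> space_time_cutoff_bounds(1)[of \<alpha> m R z] by (intro add_nonneg_nonneg mult_nonneg_nonneg) auto
      then show ?thesis
        using False by (simp add: majorant_def)
    next
      case True
      then have cyl: "z \<in> cyl \<alpha> R" by (simp add: shell_def)
      let ?\<sigma> = "box_cutoff \<alpha> R z" and ?W = "\<bar>u z - v z\<bar> / M"
      have W: "0 \<le> ?W" using M by simp
      have "L * ?\<sigma> ^ (m - 2) * (1 + ?W powr p) \<le> L1 + \<kappa> * ?\<sigma> ^ m * ?W powr q"
      proof -
        have "L * ?\<sigma> ^ (m - 2) * 1 \<le> L * 1"
          using L(1) box_cutoff_bounds[of \<alpha> R z] by (auto intro!: mult_left_le power_le_one)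
        moreover have "L * ?\<sigma> ^ (m - 2) * ?W powr p \<le> \<kappa> * ?\<sigma> ^ m * ?W powr q + L * (L / \<kappa>) powr (p / (q - p))"
          by (rule powr_absorb[OF p \<kappa> L(1) box_cutoff_bounds W m])
        ultimately show ?thesis
          by (simp add: L1_def distrib_left)
      qed
      then have "rise R z * M powr q * (L * ?\<sigma> ^ (m - 2) * (1 + ?W powr p))
          \<le> rise R z * M powr q * (L1 + \<kappa> * ?\<sigma> ^ m * ?W powr q)"
        using rise_bounds[of R z] by (intro mult_left_mono) auto
      also have "\<dots> = rise R z * (L1 * M powr q) + \<kappa> * ((M powr q * ?W powr q) * (rise R z * ?\<sigma> ^ m))"
        by (simp add: algebra_simps)
      also have "M powr q * ?W powr q = gap_power z"
        unfolding M_def by (rule gap_power_scale[OF R zero_less_one])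
      also have "rise R z * (L1 * M powr q) \<le> 1 * (L1 * M powr q)"
        using rise_bounds[of R z] L1 by (intro mult_right_mono) auto
      finally show ?thesis
        using True cyl
        by (simp add: majorant_def space_time_cutoff_def M_def[symmetric] p_def[symmetric] mult_ac)
    qed
    have "2 powr (- q) * (LINT z|?M. gap_power z * space_time_cutoff \<alpha> m R z) \<le> integral\<^sup>L ?M (majorant m L 1 R)"
      by (rule L(4)[OF R zero_less_one])
    also have "\<dots> \<le> (LINT z|?M. L1 * M powr q * indicator (cyl \<alpha> R) z + \<kappa> * (gap_power z * space_time_cutoff \<alpha> m R z))"
      by (intro integral_mono L(3)[OF R zero_less_one] le Bochner_Integration.integrable_add integrable_mult_right
          measure_cyl_half_space(2)[OF R] L(2)[OF R])
    also have "\<dots> = L1 * (M powr q * measure ?M (cyl \<alpha> R)) + \<kappa> * (LINT z|?M. gap_power z * space_time_cutoff \<alpha> m R z)"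
      using measure_cyl_half_space(3)[OF R]
      by (subst Bochner_Integration.integral_add[OF integrable_mult_right[OF measure_cyl_half_space(2)[OF R]]
            integrable_mult_right[OF L(2)[OF R]]]) simp
    also have "L1 * (M powr q * measure ?M (cyl \<alpha> R)) \<le> L1 * V"
      using scale_measure_le[OF R zero_less_one] L1 unfolding M_def V_def by (intro mult_left_mono) auto
    finally have "\<kappa> * (LINT z|?M. gap_power z * space_time_cutoff \<alpha> m R z) \<le> L1 * V"
      by (simp add: \<kappa>_def)
    then show ?thesis
      using \<kappa> by (simp add: field_simps)
  qed
  let ?f = "\<lambda>k z. gap_power z * space_time_cutoff \<alpha> m (radius k) z"
  have f0: "0 \<le> ?f k z" for k z
    by (intro mult_nonneg_nonneg space_time_cutoff_bounds(1)) simp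
  have nn: "(\<integral>\<^sup>+z. ennreal (?f k z) \<partial>?M) \<le> ennreal (L1 * V / \<kappa>)" for k
    using bound[OF radius_gt_1] by (subst nn_integral_eq_integral[OF L(2)[OF radius_gt_1]]) (auto simp: f0 intro: ennreal_leI)
  \<comment> \<open>Each point of the half-space is eventually in the region where the cutoff is 1,
    so the limit inferior recovers the full integrand.\<close>
  have "(\<integral>\<^sup>+z. ennreal (gap_power z) \<partial>?M) = (\<integral>\<^sup>+z. liminf (\<lambda>k. ennreal (?f k z)) \<partial>?M)"
  proof (rule nn_integral_cong)
    fix z assume "z \<in> space ?M"
    then have "z \<in> half_space" by (simp add: space_restrict_space)
    from tendsto_mult[OF tendsto_const space_time_cutoff_tendsto[OF this]]
    have "(\<lambda>k. ?f k z) \<longlonglongrightarrow> gap_power z * 1" .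
    then have "(\<lambda>k. ennreal (?f k z)) \<longlonglongrightarrow> ennreal (gap_power z * 1)"
      by (rule tendsto_ennrealI)
    then show "ennreal (gap_power z) = liminf (\<lambda>k. ennreal (?f k z))"
      by (simp add: lim_imp_Liminf)
  qed
  also have "\<dots> \<le> liminf (\<lambda>k. \<integral>\<^sup>+z. ennreal (?f k z) \<partial>?M)"
    by (rule nn_integral_liminf) (use L(2)[OF radius_gt_1] in \<open>auto intro: measurable_compose[OF borel_measurable_integrable measurable_ennreal]\<close>)
  also have "\<dots> \<le> liminf (\<lambda>k::nat. ennreal (L1 * V / \<kappa>))"
    by (rule Liminf_mono) (simp add: nn)
  also have "\<dots> < \<infinity>"
    by (simp add: Liminf_const)
  finally show ?thesis
    using gap_power_measurable by (intro integrableI_bounded) auto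
qed

text \<open>With integrability known nothing has to be absorbed, so \<open>m = 2\<close> suffices:
  the weight is at most 1 and W^p is bounded by 1 + W^q. The factor
  \<open>\<delta> powr (1 - q)\<close> blows up for small \<delta>, but it multiplies
  \<open>J k\<close>, which vanishes as k grows; hence the limit in k precedes the choice of
  \<delta>.\<close>

lemma eq_AE: "AE z in lebesgue_on half_space. u z = v z"
proof -
  let ?M = "lebesgue_on (half_space :: (real \<times> (real^'n)) set)"
  obtain L where L: "0 \<le> L"
    "\<And>R. 1 < R \<Longrightarrow> integrable ?M (\<lambda>z. gap_power z * space_time_cutoff \<alpha> 2 R z)"
    "\<And>R \<delta>. 1 < R \<Longrightarrow> 0 < \<delta> \<Longrightarrow> integrable ?M (majorant 2 L \<delta> R)"
    "\<And>R \<delta>. 1 < R \<Longrightarrow> 0 < \<delta> \<Longrightarrow> 2 powr (- q) * (LINT z|?M. gap_power z * space_time_cutoff \<alpha> 2 R z)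
        \<le> integral\<^sup>L ?M (majorant 2 L \<delta> R)"
    using energy_estimate[OF order_refl] by blast
  define V where "V = 2 * unit_ball_vol (real CARD('n))"
  define I where "I = integral\<^sup>L ?M gap_power"
  define J where "J k = (LINT z|?M. indicator (shell \<alpha> (radius k)) z * gap_power z)" for k
  have sm: "(indicator (shell \<alpha> R) :: real \<times> (real^'n) \<Rightarrow> real) \<in> borel_measurable ?M" for R
    by (intro measurable_lebesgue_on_borel borel_measurable_indicator borel_measurable_cutoffs)
  have iJ: "integrable ?M (\<lambda>z. indicator (shell \<alpha> R) z * gap_power z)" for R
    by (rule integrable_bounded_mult[OF integrable_gap_power sm, where B=1]) (simp add: indicator_def)
  have AE_half: "AE z in ?M. z \<in> half_space"
    by (rule AE_I2) (simp add: space_restrict_space)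
  have J0: "J \<longlonglongrightarrow> 0"
  proof -
    have "J \<longlonglongrightarrow> (LINT z|?M. 0 * gap_power z)"
      unfolding J_def[abs_def]
    proof (rule tendsto_integral_bounded_mult[OF integrable_gap_power sm])
      show "AE z in ?M. (\<lambda>k. indicator (shell \<alpha> (radius k)) z :: real) \<longlonglongrightarrow> 0"
        using AE_half by eventually_elim (rule shell_tendsto)
      show "\<bar>indicator (shell \<alpha> (radius k)) z :: real\<bar> \<le> 1" for k and z :: "real \<times> (real^'n)"
        by (simp add: indicator_def)
    qed simp
    then show ?thesis by simp
  qed
  have I_lim: "(\<lambda>k. LINT z|?M. space_time_cutoff \<alpha> 2 (radius k) z * gap_power z) \<longlonglongrightarrow> (LINT z|?M. 1 * gap_power z)"
  proof (rule tendsto_integral_bounded_mult[OF integrable_gap_power])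
    show "(space_time_cutoff \<alpha> 2 (radius k) :: real \<times> (real^'n) \<Rightarrow> real) \<in> borel_measurable ?M" for k
      by (intro measurable_lebesgue_on_borel borel_measurable_cutoffs)
    show "AE z in ?M. (\<lambda>k. space_time_cutoff \<alpha> 2 (radius k) z) \<longlonglongrightarrow> 1"
      using AE_half by eventually_elim (rule space_time_cutoff_tendsto)
    show "\<bar>space_time_cutoff \<alpha> 2 (radius k) z\<bar> \<le> 1" for k and z :: "real \<times> (real^'n)"
      using space_time_cutoff_bounds[of \<alpha> 2 "radius k" z] by simp
  qed simp
  have I_le: "2 powr (- q) * I \<le> 2 * L * V * \<delta>" if \<delta>: "0 < \<delta>" for \<delta>
  proof -
    define E where "E = \<delta> powr (1 - q) * L"
    have E: "0 \<le> E" using L(1) by (simp add: E_def)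
    have step: "2 powr (- q) * (LINT z|?M. space_time_cutoff \<alpha> 2 (radius k) z * gap_power z)
        \<le> 2 * L * V * \<delta> + E * J k" for k
    proof -
      let ?R = "radius k"
      define M where "M = scale \<delta> ?R"
      have M: "0 < M" unfolding M_def by (rule scale_pos[OF radius_gt_1 \<delta>])
      have le: "majorant 2 L \<delta> ?R z \<le> E * (2 * M powr q * indicator (cyl \<alpha> ?R) z + indicator (shell \<alpha> ?R) z * gap_power z)" for z
      proof (cases "z \<in> shell \<alpha> ?R")
        case False
        then show ?thesis
          using E by (simp add: majorant_def)
      next
        case True
        then have cyl: "z \<in> cyl \<alpha> ?R" by (simp add: shell_def)
        let ?W = "\<bar>u z - v z\<bar> / M"
        have "?W powr ((1 + q) / 2) \<le> 1 + ?W powr q"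
          using M q by (intro powr_le_one_plus_powr) auto
        then have "M powr q * (1 + ?W powr ((1 + q) / 2)) \<le> M powr q * (2 + ?W powr q)"
          by (intro mult_left_mono) auto
        also have "\<dots> = 2 * M powr q + gap_power z"
          using gap_power_scale[OF radius_gt_1 \<delta>, of k z] by (simp add: M_def algebra_simps)
        finally have "E * (M powr q * (1 + ?W powr ((1 + q) / 2))) \<le> E * (2 * M powr q + gap_power z)"
          using E by (intro mult_left_mono)
        moreover have "rise ?R z * (E * (M powr q * (1 + ?W powr ((1 + q) / 2)))) \<le> 1 * (E * (M powr q * (1 + ?W powr ((1 + q) / 2))))"
          using rise_bounds[of ?R z] E by (intro mult_right_mono mult_nonneg_nonneg) auto
        ultimately show ?thesis
          using True cyl by (simp add: majorant_def M_def[symmetric] E_def mult_ac)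
      qed
      have "2 powr (- q) * (LINT z|?M. space_time_cutoff \<alpha> 2 ?R z * gap_power z) \<le> integral\<^sup>L ?M (majorant 2 L \<delta> ?R)"
        using L(4)[OF radius_gt_1 \<delta>] by (simp add: mult.commute)
      also have "\<dots> \<le> (LINT z|?M. E * (2 * M powr q * indicator (cyl \<alpha> ?R) z + indicator (shell \<alpha> ?R) z * gap_power z))"
        by (intro integral_mono L(3)[OF radius_gt_1 \<delta>] le Bochner_Integration.integrable_add integrable_mult_right
            measure_cyl_half_space(2)[OF radius_gt_1] iJ)
      also have "\<dots> = E * (2 * (M powr q * measure ?M (cyl \<alpha> ?R)) + J k)"
        using measure_cyl_half_space(3)[OF radius_gt_1, of k] unfolding J_def
        by (simp add: Bochner_Integration.integral_add[OF integrable_mult_right[OF measure_cyl_half_space(2)[OF radius_gt_1]] iJ])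
      also have "\<dots> \<le> E * (2 * (V * \<delta> powr q) + J k)"
      proof (rule mult_left_mono[OF _ E])
        have "M powr q * measure ?M (cyl \<alpha> ?R) \<le> V * \<delta> powr q"
          unfolding M_def V_def by (rule scale_measure_le[OF radius_gt_1 \<delta>])
        then show "2 * (M powr q * measure ?M (cyl \<alpha> ?R)) + J k \<le> 2 * (V * \<delta> powr q) + J k"
          by simp
      qed
      also have "\<dots> = 2 * L * V * (\<delta> powr (1 - q) * \<delta> powr q) + E * J k"
        by (simp add: E_def algebra_simps)
      \<comment> \<open>The loss 1 - q from the scale and the gain q from the volume leave one
        positive power of \<delta>.\<close>
      also have "\<delta> powr (1 - q) * \<delta> powr q = \<delta>"
        using \<delta> by (simp flip: powr_add)
      finally show ?thesis .
    qed
    have "2 powr (- q) * (LINT z|?M. 1 * gap_power z) \<le> 2 * L * V * \<delta> + E * 0"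
      by (rule LIMSEQ_le[OF tendsto_mult[OF tendsto_const I_lim] tendsto_add[OF tendsto_const tendsto_mult[OF tendsto_const J0]]])
         (use step in auto)
    then show ?thesis by (simp add: I_def)
  qed
  have "2 powr (- q) * I \<le> 0"
  proof (rule field_le_epsilon)
    fix e :: real assume "0 < e"
    have LV: "0 \<le> 2 * L * V"
      using L(1) by (simp add: V_def unit_ball_vol_nonneg)
    \<comment> \<open>The added 1 keeps the choice of \<delta> meaningful when \<open>L\<close> is
      0.\<close>
    have "2 * L * V * (e / (2 * L * V + 1)) \<le> e"
      using LV \<open>0 < e\<close> by (simp add: field_simps)
    then show "2 powr (- q) * I \<le> 0 + e"
      using I_le[of "e / (2 * L * V + 1)"] LV \<open>0 < e\<close> by simp
  qed
  then have "I \<le> 0"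
    by (simp add: mult_le_0_iff)
  moreover have "0 \<le> I"
    unfolding I_def by (rule integral_nonneg_AE) simp
  ultimately have "integral\<^sup>L ?M gap_power = 0"
    unfolding I_def by (rule antisym)
  then have "AE z in ?M. gap_power z = 0"
    using integral_nonneg_eq_0_iff_AE[OF integrable_gap_power] by simp
  then show ?thesis
    by eventually_elim simp
qed

end

theorem theorem4:
  fixes a :: "real \<times> (real^'n) \<Rightarrow> real^'n^'n"
    and A :: "real \<times> (real^'n) \<Rightarrow> real"
    and u v :: "real \<times> (real^'n) \<Rightarrow> real"
    and \<alpha> q c :: real
  assumes "\<alpha> > 0" and "1 < q" and "q \<le> 1 + \<alpha> / real CARD('n)"
    and "\<And>i j. (\<lambda>z. a z $ i $ j) \<in> borel_measurable (lebesgue_on half_space)"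
    and "\<And>i j. locally_bounded_on half_space (\<lambda>z. a z $ i $ j)"
    and "\<And>i j. AE z in lebesgue_on half_space. a z $ i $ j = a z $ j $ i"
    and "A \<in> borel_measurable (lebesgue_on half_space)"
    and "\<And>z. z \<in> half_space \<Longrightarrow> 0 \<le> A z"
    and "locally_bounded_on half_space A"
    and "AE z in lebesgue_on half_space.
           \<forall>\<xi>. 0 \<le> aform (a z) \<xi> \<xi> \<and> aform (a z) \<xi> \<xi> \<le> A z * (norm \<xi>)\<^sup>2"
    and "c > 0"
    and "\<And>R. R > 1 \<Longrightarrow>
           esssup (lebesgue_on ({0<..} \<times> {x. R / 2 < norm x \<and> norm x < R})) (\<lambda>z. ereal (A z))
             \<le> ereal (c * R powr (2 - \<alpha>))"
    and "entire_weak_solution a q u v"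
    and "AE z in lebesgue_on half_space. u z \<ge> v z"
  shows "AE z in lebesgue_on half_space. u z = v z"
proof -
  obtain ut ux vt vx where W: "W_loc a q u ut ux" "W_loc a q v vt vx"
    and weak: "\<And>\<phi>. test_function \<phi> \<Longrightarrow> (\<forall>z\<in>half_space. 0 \<le> \<phi> z) \<Longrightarrow>
      weak_functional a q v vt vx \<phi> \<le> weak_functional a q u ut ux \<phi>"
    and meas: "u \<in> borel_measurable (lebesgue_on half_space)" "v \<in> borel_measurable (lebesgue_on half_space)"
    using assms(13) unfolding entire_weak_solution_def by blast
  have annulus: "AE z in lebesgue_on half_space.
      R / 2 < norm (snd z) \<and> norm (snd z) < R \<longrightarrow> A z \<le> c * R powr (2 - \<alpha>)" if "1 < R" for R
  proof -
    let ?S = "{0<..} \<times> {x. R / 2 < norm x \<and> norm x < R} :: (real \<times> (real^'n)) set"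
    have "open ?S"
      by (intro open_Times open_Collect_conj open_Collect_less continuous_intros) auto
    then have S: "?S \<in> sets lebesgue"
      by (intro sets_completionI_sets) simp
    \<comment> \<open>\<open>A\<close> stays below its essential supremum off a null set. The bound
      is then rephrased as an implication on the half-space, the form in which the pointwise energy
      estimate can use it.\<close>
    have "AE z in lebesgue_on ?S. A z \<le> c * R powr (2 - \<alpha>)"
      using esssup_AE[of "\<lambda>z. ereal (A z)" "lebesgue_on ?S"]
    proof eventually_elim
      case (elim z)
      then have "ereal (A z) \<le> ereal (c * R powr (2 - \<alpha>))"
        using assms(12)[OF that] by (rule order_trans)
      then show ?case by simp
    qed
    then have "AE z in lebesgue. z \<in> ?S \<longrightarrow> A z \<le> c * R powr (2 - \<alpha>)"
      using S by (simp add: AE_restrict_space_iff)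
    then have "AE z in lebesgue. z \<in> half_space \<longrightarrow>
        (R / 2 < norm (snd z) \<and> norm (snd z) < R \<longrightarrow> A z \<le> c * R powr (2 - \<alpha>))"
      by eventually_elim (auto simp: half_space_def)
    then show ?thesis
      by (simp add: AE_restrict_space_iff half_space_sets)
  qed
  have sym: "AE z in lebesgue_on half_space. \<forall>i j. a z $ i $ j = a z $ j $ i"
    by (intro eventually_all_finite assms(6))
  interpret difference_inequality a A u v ut vt ux vx \<alpha> q c
    by unfold_locales (use assms sym annulus W weak meas in auto)
  show ?thesis
    by (rule eq_AE)
qed

end
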